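(* Let $q$ be a prime power and $n\ge 4$. The graph $\mathcal{G}_n=\mathrm{NU}(n+1,q^2)$ is not isomorphic to $\mathcal{G}'_n$ if $q>2$, and it is not isomorphic to $\mathcal{G}''_n$.
   Context: For a graph $\mathcal{G}$ and a vertex $u$, $N_{\mathcal{G}}(u)$ is the set of neighbours of $u$. Let $\mathcal{H}(n,q^2)$ be a non-degenerate Hermitian variety of $\mathrm{PG}(n,q^2)$ (the absolute points of a unitary polarity). A line is tangent to $\mathcal{H}(n,q^2)$ if it meets it in exactly one point. $\mathcal{G}_n=\mathrm{NU}(n+1,q^2)$ is the graph whose vertices are the points of $\mathrm{PG}(n,q^2)\setminus\mathcal{H}(n,q^2)$, two distinct vertices being adjacent if the line joining them is tangent to $\mathcal{H}(n,q^2)$. Fix a point $P\in\mathcal{H}(n,q^2)$ and two distinct lines $\bar\ell_1,\bar\ell_2$ with $\bar\ell_1\cap\mathcal{H}(n,q^2)=\bar\ell_2\cap\mathcal{H}(n,q^2)=\{P\}$. Let $\pi=\langle\bar\ell_1,\bar\ell_2\rangle$ and $\ell_i=\bar\ell_i\setminus\{P\}$, $i=1,2$. Then $\pi\cap\mathcal{H}(n,q^2)$ is either a Hermitian pencil of lines (a cone with vertex a point $V$ over a Baer subline of a line not through $V$, i.e. $q+1$ lines through $V$) or a line. Define $\mathcal{A}=\left(\bigcap_{u\in\ell_1}N_{\mathcal{G}_n}(u)\right)\cap\left(\bigcap_{u\in\ell_2}N_{\mathcal{G}_n}(u)\right)$, $\mathcal{A}_1=\left(\bigcap_{u\in\ell_1}N_{\mathcal{G}_n}(u)\right)\setminus(\mathcal{A}\cup\ell_2)$,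 $\mathcal{A}_2=\left(\bigcap_{u\in\ell_2}N_{\mathcal{G}_n}(u)\right)\setminus(\mathcal{A}\cup\ell_1)$. The following graph is denoted $\mathcal{G}'_n$ if $\pi\cap\mathcal{H}(n,q^2)$ is a Hermitian pencil of lines and $\mathcal{G}''_n$ if $\pi\cap\mathcal{H}(n,q^2)$ is a line: its vertices are the vertices of $\mathcal{G}_n$, and the neighbourhood of a vertex $u$ is $N_{\mathcal{G}_n}(u)$ if $u\notin\mathcal{A}_1\cup\mathcal{A}_2\cup\ell_1\cup\ell_2$; $(N_{\mathcal{G}_n}(u)\setminus\mathcal{A}_1)\cup\mathcal{A}_2$ if $u\in\ell_1$; $(N_{\mathcal{G}_n}(u)\setminus\mathcal{A}_2)\cup\mathcal{A}_1$ if $u\in\ell_2$; $(N_{\mathcal{G}_n}(u)\setminus\ell_1)\cup\ell_2$ if $u\in\mathcal{A}_1$; $(N_{\mathcal{G}_n}(u)\setminus\ell_2)\cup\ell_1$ if $u\in\mathcal{A}_2$. *)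

theory Defs
  imports
    "HOL-Analysis.Analysis"
    "HOL-Number_Theory.Prime_Powers"
    "Graph_Theory.Graph_Theory"
begin

section \<open>Projective geometry\<close>

text \<open>
  Subspaces of the projective space of \<^typ>\<open>'a::field ^ 'n\<close>, which has projective dimension
  \<open>CARD('n) - 1\<close>, are represented by linear subspaces of the vector space. Sets of points, such
  as Hermitian varieties, are sets of one-dimensional linear subspaces.
\<close>

definition is_point :: "('a::field ^ 'n) set \<Rightarrow> bool" where
  "is_point X \<longleftrightarrow> vec.subspace X \<and> vec.dim X = 1"

definition is_line :: "('a::field ^ 'n) set \<Rightarrow> bool" where
  "is_line L \<longleftrightarrow> vec.subspace L \<and> vec.dim L = 2"

definition points_of :: "('a::field ^ 'n) set \<Rightarrow> ('a ^ 'n) set set" where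
  "points_of U = {X. is_point X \<and> X \<subseteq> U}"

definition join :: "('a::field ^ 'n) set \<Rightarrow> ('a ^ 'n) set \<Rightarrow> ('a ^ 'n) set" where
  "join U W = vec.span (U \<union> W)"


section \<open>Hermitian varieties and Hermitian pencils\<close>

text \<open>The ground field is understood to have order \<open>q\<^sup>2\<close>, so that \<open>x \<mapsto> x ^ q\<close> is its involutory
  automorphism, with fixed field of order \<open>q\<close>.\<close>

definition hermitian_form :: "nat \<Rightarrow> ('a::field ^ 'n \<Rightarrow> 'a ^ 'n \<Rightarrow> 'a) \<Rightarrow> bool" where
  "hermitian_form q h \<longleftrightarrow>
     (\<forall>x y z. h (x + y) z = h x z + h y z) \<and>
     (\<forall>c x y. h (c *s x) y = c * h x y) \<and>
     (\<forall>x y. h y x = h x y ^ q)"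

definition nondegenerate_form :: "('a::field ^ 'n \<Rightarrow> 'a ^ 'n \<Rightarrow> 'a) \<Rightarrow> bool" where
  "nondegenerate_form h \<longleftrightarrow> (\<forall>x. (\<forall>y. h x y = 0) \<longrightarrow> x = 0)"

definition unitary_polarity :: "nat \<Rightarrow> (('a::field ^ 'n) set \<Rightarrow> ('a ^ 'n) set) \<Rightarrow> bool" where
  "unitary_polarity q \<rho> \<longleftrightarrow>
     (\<exists>h. hermitian_form q h \<and> nondegenerate_form h \<and>
       (\<forall>U. vec.subspace U \<longrightarrow> \<rho> U = {x. \<forall>u\<in>U. h x u = 0}))"

definition absolute_points :: "(('a::field ^ 'n) set \<Rightarrow> ('a ^ 'n) set) \<Rightarrow> ('a ^ 'n) set set" where
  "absolute_points \<rho> = {X. is_point X \<and> X \<subseteq> \<rho> X}"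

definition hermitian_variety :: "nat \<Rightarrow> ('a::field ^ 'n) set set \<Rightarrow> bool" where
  "hermitian_variety q H \<longleftrightarrow> (\<exists>\<rho>. unitary_polarity q \<rho> \<and> H = absolute_points \<rho>)"

definition tangent_line :: "('a::field ^ 'n) set set \<Rightarrow> ('a ^ 'n) set \<Rightarrow> bool" where
  "tangent_line H L \<longleftrightarrow> is_line L \<and> (\<exists>!X. X \<in> points_of L \<inter> H)"

text \<open>The points of the line \<open>m\<close> that have coordinates in the subfield of order \<open>q\<close> with respect to
  some basis \<open>u, v\<close> of \<open>m\<close>; the basis vectors are linearly independent because \<open>m\<close> is a line.\<close>

definition baer_subline :: "nat \<Rightarrow> ('a::field ^ 'n) set \<Rightarrow> ('a ^ 'n) set set \<Rightarrow> bool" where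
  "baer_subline q m B \<longleftrightarrow> is_line m \<and>
     (\<exists>u v. m = vec.span {u, v} \<and>
       B = {vec.span {a *s u + b *s v} | a b. a ^ q = a \<and> b ^ q = b \<and> (a, b) \<noteq> (0, 0)})"

definition hermitian_pencil :: "nat \<Rightarrow> ('a::field ^ 'n) set set \<Rightarrow> bool" where
  "hermitian_pencil q S \<longleftrightarrow>
     (\<exists>V m B. is_point V \<and> is_line m \<and> \<not> V \<subseteq> m \<and> baer_subline q m B \<and>
       S = (\<Union>b\<in>B. points_of (join V b)))"


section \<open>The graphs\<close>

text \<open>Undirected graphs are symmetric digraphs, as in the locale \<^locale>\<open>pair_graph\<close>.\<close>

definition NU :: "('a::field ^ 'n) set set \<Rightarrow> ('a ^ 'n) set pair_pre_digraph" where
  "NU H = \<lparr> pverts = {X. is_point X} - H,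
            parcs = {(X, Y). X \<in> {X. is_point X} - H \<and> Y \<in> {X. is_point X} - H \<and>
                             X \<noteq> Y \<and> tangent_line H (join X Y)} \<rparr>"

definition nbrs :: "'v pair_pre_digraph \<Rightarrow> 'v \<Rightarrow> 'v set" where
  "nbrs G u = {v. (u, v) \<in> parcs G}"

definition common_nbrs :: "'v pair_pre_digraph \<Rightarrow> 'v set \<Rightarrow> 'v set" where
  "common_nbrs G S = (\<Inter>u\<in>S. nbrs G u)"

text \<open>With \<open>A = common_nbrs G l1 \<inter> common_nbrs G l2\<close>, the sets \<open>\<A>\<^sub>1\<close> and \<open>\<A>\<^sub>2\<close> are
  \<open>switch_part G l1 l2\<close> and \<open>switch_part G l2 l1\<close>.\<close>

definition switch_part :: "'v pair_pre_digraph \<Rightarrow> 'v set \<Rightarrow> 'v set \<Rightarrow> 'v set" where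
  "switch_part G l1 l2 = common_nbrs G l1 - ((common_nbrs G l1 \<inter> common_nbrs G l2) \<union> l2)"

definition switched_nbrs :: "'v pair_pre_digraph \<Rightarrow> 'v set \<Rightarrow> 'v set \<Rightarrow> 'v \<Rightarrow> 'v set" where
  "switched_nbrs G l1 l2 u =
    (let A1 = switch_part G l1 l2; A2 = switch_part G l2 l1 in
      if u \<in> l1 then (nbrs G u - A1) \<union> A2
      else if u \<in> l2 then (nbrs G u - A2) \<union> A1
      else if u \<in> A1 then (nbrs G u - l1) \<union> l2
      else if u \<in> A2 then (nbrs G u - l2) \<union> l1
      else nbrs G u)"

definition switched_graph :: "'v pair_pre_digraph \<Rightarrow> 'v set \<Rightarrow> 'v set \<Rightarrow> 'v pair_pre_digraph" where
  "switched_graph G l1 l2 =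
     \<lparr> pverts = pverts G, parcs = {(u, v). u \<in> pverts G \<and> v \<in> switched_nbrs G l1 l2 u} \<rparr>"

definition graph_isomorphic :: "'v pair_pre_digraph \<Rightarrow> 'w pair_pre_digraph \<Rightarrow> bool" where
  "graph_isomorphic G G' \<longleftrightarrow> digraph_iso (with_proj G) (with_proj G')"


section \<open>Well-formedness\<close>

lemma join_commute: "join U W = join W U"
  by (simp add: join_def Un_commute)

lemma pair_graph_NU: "pair_graph (NU (H :: ('a::{field,finite} ^ 'n) set set))"
  by unfold_locales
    (auto simp: NU_def symmetric_def join_commute intro!: symI intro: finite_subset[OF _ finite])

text \<open>The four special cases of the switched neighbourhood exclude one another, and the switched
  graph is again an undirected loopless graph.\<close>

lemma switch_disjoint:
  assumes "pair_graph G" "l1 \<inter> l2 = {}"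
  shows "switch_part G l1 l2 \<inter> switch_part G l2 l1 = {}"
    "switch_part G l1 l2 \<inter> (l1 \<union> l2) = {}" "switch_part G l2 l1 \<inter> (l1 \<union> l2) = {}"
proof -
  interpret pair_graph G by fact
  have "(u, u) \<notin> parcs G" for u using pair_no_loops by fastforce
  then show "switch_part G l1 l2 \<inter> switch_part G l2 l1 = {}"
    "switch_part G l1 l2 \<inter> (l1 \<union> l2) = {}" "switch_part G l2 l1 \<inter> (l1 \<union> l2) = {}"
    by (auto simp: switch_part_def common_nbrs_def nbrs_def)
qed

lemma pair_graph_switched_graph:
  assumes G: "pair_graph G" and l: "l1 \<inter> l2 = {}" "l1 \<noteq> {}" "l2 \<noteq> {}"
    "l1 \<subseteq> pverts G" "l2 \<subseteq> pverts G"
  shows "pair_graph (switched_graph G l1 l2)"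
proof -
  interpret pair_graph G by fact
  define A1 A2 where A: "A1 = switch_part G l1 l2" "A2 = switch_part G l2 l1"
  have sym: "v \<in> nbrs G u \<longleftrightarrow> u \<in> nbrs G v" for u v
    using pair_sym_arcs by (auto simp: nbrs_def symmetric_def dest: symD)
  have V: "nbrs G u \<subseteq> pverts G" for u
    by (auto simp: nbrs_def dest: in_arcsD2)
  have irr: "u \<notin> nbrs G u" for u using pair_no_loops by (fastforce simp: nbrs_def)
  have AV: "A1 \<subseteq> pverts G" "A2 \<subseteq> pverts G"
    using l V by (fastforce simp: A switch_part_def common_nbrs_def)+
  note disj = switch_disjoint[OF G l(1), folded A]
  define N where "N = switched_nbrs G l1 l2"
  have N: "N u = (if u \<in> l1 then (nbrs G u - A1) \<union> A2
      else if u \<in> l2 then (nbrs G u - A2) \<union> A1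
      else if u \<in> A1 then (nbrs G u - l1) \<union> l2
      else if u \<in> A2 then (nbrs G u - l2) \<union> l1 else nbrs G u)" for u
    by (simp add: N_def switched_nbrs_def A Let_def)
  have NV: "N u \<subseteq> pverts G" for u using V[of u] AV l by (auto simp: N)
  have Nirr: "u \<notin> N u" for u using irr[of u] disj l(1) by (auto simp: N)
  have Nsym: "u \<in> N v" if "v \<in> N u" for u v
    using that sym[of u v] disj l(1) unfolding N by (auto split: if_splits)
  have arcs: "parcs (switched_graph G l1 l2) = {(u, v). u \<in> pverts G \<and> v \<in> N u}"
    and verts: "pverts (switched_graph G l1 l2) = pverts G"
    by (simp_all add: switched_graph_def N_def)
  have fin: "finite {(u, v). u \<in> pverts G \<and> v \<in> N u}"
    by (rule finite_subset[of _ "pverts G \<times> pverts G"]) (use NV pair_finite_verts in auto)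
  show ?thesis
    by unfold_locales
      (use NV[THEN subsetD] Nirr Nsym fin pair_finite_verts in \<open>auto simp: arcs verts symmetric_def intro!: symI\<close>)
qed

lemma graph_isomorphic_iff:
  assumes "pair_graph G" "pair_graph G'"
  shows "graph_isomorphic G G' \<longleftrightarrow>
    (\<exists>f. bij_betw f (pverts G) (pverts G') \<and>
      (\<forall>u\<in>pverts G. \<forall>v\<in>pverts G. (u, v) \<in> parcs G \<longleftrightarrow> (f u, f v) \<in> parcs G'))"
    (is "?L \<longleftrightarrow> ?R")
proof -
  interpret G: pair_graph G by fact
  interpret G': pair_graph G' by fact
  show ?thesis
  proof
    assume ?L
    then obtain h where h: "pre_digraph.digraph_isomorphism (with_proj G) h"
      and e: "with_proj G' = app_iso h (with_proj G)"
      unfolding graph_isomorphic_def digraph_iso_def by blast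
    have V: "pverts G' = iso_verts h ` pverts G" and E: "parcs G' = iso_arcs h ` parcs G"
      and t: "iso_tail h = fst" and d: "iso_head h = snd"
      using e by (simp_all add: with_proj_def app_iso_def)
    have a: "iso_arcs h (u, v) = (iso_verts h u, iso_verts h v)" if "(u, v) \<in> parcs G" for u v
      using h that by (auto simp: pre_digraph.digraph_isomorphism_def t d prod_eq_iff)
    have inj: "inj_on (iso_verts h) (pverts G)"
      using h by (simp add: pre_digraph.digraph_isomorphism_def)
    have "(u, v) \<in> parcs G \<longleftrightarrow> (iso_verts h u, iso_verts h v) \<in> parcs G'"
      if uv: "u \<in> pverts G" "v \<in> pverts G" for u v
    proof
      assume "(u, v) \<in> parcs G"
      then show "(iso_verts h u, iso_verts h v) \<in> parcs G'" using a E by (metis image_eqI)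
    next
      assume "(iso_verts h u, iso_verts h v) \<in> parcs G'"
      then obtain x y where xy: "(x, y) \<in> parcs G"
        "(iso_verts h u, iso_verts h v) = (iso_verts h x, iso_verts h y)"
        using a E by (smt (verit) image_iff surj_pair)
      then show "(u, v) \<in> parcs G"
        using uv inj G.in_arcsD1 G.in_arcsD2 by (metis Pair_inject inj_onD)
    qed
    then show ?R using inj V by (auto simp: bij_betw_def intro!: exI[of _ "iso_verts h"])
  next
    assume ?R
    then obtain f where f: "inj_on f (pverts G)" "f ` pverts G = pverts G'"
      and a: "\<And>u v. u \<in> pverts G \<Longrightarrow> v \<in> pverts G \<Longrightarrow> (u, v) \<in> parcs G \<longleftrightarrow> (f u, f v) \<in> parcs G'"
      unfolding bij_betw_def by blast
    define h where "h = \<lparr> iso_verts = f, iso_arcs = map_prod f f, iso_head = snd, iso_tail = fst \<rparr>"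
    have "inj_on (map_prod f f) (parcs G)"
      by (rule inj_on_subset[OF map_prod_inj_on[OF f(1) f(1)]])
        (auto dest: G.in_arcsD1 G.in_arcsD2)
    then have "pre_digraph.digraph_isomorphism (with_proj G) h"
      using f(1) G.wf_digraph_axioms by (auto simp: pre_digraph.digraph_isomorphism_def h_def)
    moreover have "map_prod f f ` parcs G = parcs G'"
    proof (intro equalityI subsetI)
      fix e assume "e \<in> map_prod f f ` parcs G"
      then show "e \<in> parcs G'" using a by (auto dest: G.in_arcsD1 G.in_arcsD2)
    next
      fix e assume e: "e \<in> parcs G'"
      obtain x y where xy: "e = (x, y)" by force
      then obtain u v where "u \<in> pverts G" "v \<in> pverts G" "x = f u" "y = f v"
        using e f(2) G'.in_arcsD1 G'.in_arcsD2 by (metis imageE)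
      then show "e \<in> map_prod f f ` parcs G" using a e xy by force
    qed
    then have "with_proj G' = app_iso h (with_proj G)"
      using f(2) by (simp add: with_proj_def app_iso_def h_def)
    ultimately show ?L unfolding graph_isomorphic_def digraph_iso_def by blast
  qed
qed

end

theory Submission
  imports Defs
begin

text \<open>
  Throughout, \<open>h\<close> is the Hermitian form, \<open>Nm x = x\<^sup>q\<^sup>+\<^sup>1\<close> the norm to the field of order
  \<open>q\<close>, and \<open>\<langle>x\<rangle>\<close> the point spanned by \<open>x\<close>. The proof compares \<^emph>\<open>codegrees\<close>: numbers of
  common neighbours of three vertices.

  \<^bold>\<open>The original graph.\<close> Every vertex is \<open>\<langle>v\<rangle>\<close> with \<open>h v v = 1\<close>. Its neighbours are the
  points \<open>\<langle>v + z\<rangle>\<close> for the nonzero isotropic vectors \<open>z\<close> of the hyperplane \<open>v\<^sup>\<bottom>\<close>, and two of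
  them, \<open>\<langle>v + a\<rangle>\<close> and \<open>\<langle>v + b\<rangle>\<close>, are adjacent iff \<open>h a b\<close> lies in \<open>K = {k. Nm (1 + k) = 1}\<close>,
  a set with \<open>q + 1\<close> elements containing \<open>0\<close>. So the codegree of a triangle is, up to the
  constant 3, the number of isotropic \<open>z\<close> in \<open>v\<^sup>\<bottom>\<close> with \<open>h z a\<close> and \<open>h z b\<close> in \<open>K\<close>. It takes
  at most four values (lemma \<open>triangle_codegrees\<close>): one if \<open>a\<close> and \<open>b\<close> span a totally
  isotropic plane, one if \<open>h a b \<noteq> 0\<close>, and two if \<open>b = t a\<close>, according to whether \<open>t\<close> is
  fixed by \<open>x \<mapsto> x\<^sup>q\<close>. All four are expressed through the number \<open>X\<close> of isotropic vectors in
  \<open>v\<^sup>\<bottom>\<close>. This number is the same for all \<open>v\<close>, and its value never has to be known.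

  \<^bold>\<open>The switched graph.\<close> Let \<open>P = \<langle>p\<rangle>\<close>. A vertex in the tangent hyperplane \<open>p\<^sup>\<bottom>\<close> outside
  \<open>\<ell>\<^sub>i\<close> is adjacent to all points of \<open>\<ell>\<^sub>i\<close> or to none. Therefore switching acts on \<open>p\<^sup>\<bottom>\<close> as
  exchanging \<open>\<ell>\<^sub>1\<close> with \<open>\<ell>\<^sub>2\<close> by an involution \<open>\<tau>\<close>, while adjacency between \<open>p\<^sup>\<bottom>\<close> and its
  complement stays as it was. For a set \<open>T\<close> of vertices in \<open>p\<^sup>\<bottom>\<close> this gives (lemma
  \<open>card_common_nbrs_switched\<close>)

  \<open>codeg' T = codeg (\<tau> T) - out (\<tau> T) + out T\<close>,

  where \<open>out\<close> counts the common neighbours outside \<open>p\<^sup>\<bottom>\<close>. Now \<open>out\<close> depends on linear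
  dependence: it differs for three vectors that are independent modulo \<open>p\<close>
  (\<open>card_outer_independent\<close>) and for three points \<open>\<langle>u\<rangle>, \<langle>u + r\<rangle>, \<langle>u + s r\<rangle>\<close> of a tangent
  line (\<open>card_outer_collinear\<close>), and \<open>\<tau>\<close> can turn one kind into the other.

  \<^bold>\<open>The case \<open>q > 2\<close>.\<close> Write \<open>\<ell>\<^sub>i = {\<langle>u\<^sub>i + t p\<rangle>}\<close> and choose an isotropic \<open>r\<close> orthogonal to
  \<open>p\<close> and \<open>u\<^sub>2\<close> but outside \<open>\<langle>p, u\<^sub>1, u\<^sub>2\<rangle>\<close>, and \<open>s\<close> not fixed by \<open>x \<mapsto> x\<^sup>q\<close>. The triangle \<open>T
  = {\<langle>u\<^sub>1\<rangle>, \<langle>u\<^sub>2 + r\<rangle>, \<langle>u\<^sub>2 + s r\<rangle>}\<close> of the switched graph is independent modulo \<open>p\<close> while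
  \<open>\<tau> T\<close> is collinear, and the resulting codegree is none of the four values. For the value
  belonging to \<open>h a b \<noteq> 0\<close> this is a matter of divisibility: equality would force the number
  \<open>q\<^sup>3 - 3q\<^sup>2 + 2q + 1\<close>, which is prime to \<open>q\<close> and greater than 1, to divide a power of \<open>q\<close>.

  \<^bold>\<open>The case \<open>q = 2\<close>.\<close> That number is then 1, and in dimension 5 the codegree of such a
  triangle does occur in the original graph. However, two distinct vertices are now
  non-adjacent iff they are orthogonal, and all paths \<open>\<langle>x\<^sub>2\<rangle>, \<langle>v\<rangle>, \<langle>x\<^sub>3\<rangle>\<close> with
  \<open>h x\<^sub>2 x\<^sub>3 = 0\<close> have the same codegree (\<open>path_codegree\<close>). If the plane of the two lines
  meets the Hermitian variety in a line, then \<open>h u\<^sub>1 u\<^sub>2 \<noteq> 0\<close>, and one finds a tangent line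
  through \<open>\<langle>u\<^sub>1\<rangle>\<close> with two further points of which \<open>u\<^sub>2\<close> is orthogonal to just one. Together
  with \<open>\<langle>u\<^sub>1\<rangle>\<close> these two points form a path of the switched graph, whose codegree is off by
  the difference of the two values of \<open>out\<close>.
\<close>

section \<open>Counting by fibres\<close>

text \<open>
  Pigeonhole: at most \<open>k\<close> summands of size at most \<open>m\<close> can only add up to \<open>k * m\<close> if both
  bounds are attained. It turns upper bounds for numbers of roots into exact fibre sizes of
  the trace and the norm.
\<close>
lemma sum_bound_attained:
  fixes f :: "'b \<Rightarrow> nat"
  assumes A: "finite A" "card A \<le> k" and f: "\<And>a. a \<in> A \<Longrightarrow> f a \<le> m" and "m > 0"
    and s: "sum f A = k * m"
  shows "card A = k" "\<And>a. a \<in> A \<Longrightarrow> f a = m"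
proof -
  have le: "sum f A \<le> card A * m"
    using sum_bounded_above[of A f m] f by simp
  then have "k * m \<le> card A * m" using s by simp
  then show k: "card A = k" using A(2) \<open>m > 0\<close> by simp
  show "f a = m" if a: "a \<in> A" for a
  proof (rule ccontr)
    assume "f a \<noteq> m"
    then have "f a < m" using f[OF a] by simp
    then have "sum f A < (\<Sum>a\<in>A. m)"
      using A(1) a f by (intro sum_strict_mono_ex1) auto
    then show False using s k by simp
  qed
qed

lemma card_sum_fibers:
  assumes "finite S" "finite T" "f ` S \<subseteq> T"
  shows "card S = (\<Sum>t\<in>T. card {x\<in>S. f x = t})"
proof -
  have "S = (\<Union>t\<in>T. {x\<in>S. f x = t})" using assms(3) by auto
  then have "card S = card (\<Union>t\<in>T. {x\<in>S. f x = t})" by simp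
  also have "\<dots> = (\<Sum>t\<in>T. card {x\<in>S. f x = t})"
    using assms by (intro card_UN_disjoint) auto
  finally show ?thesis .
qed

lemma card_values_in:
  assumes "finite S" "finite T"
  shows "card {z\<in>S. f z \<in> T} = (\<Sum>t\<in>T. card {z\<in>S. f z = t})"
proof -
  have "card {z\<in>S. f z \<in> T} = (\<Sum>t\<in>T. card {z\<in>{z\<in>S. f z \<in> T}. f z = t})"
    by (rule card_sum_fibers) (use assms in auto)
  also have "\<dots> = (\<Sum>t\<in>T. card {z\<in>S. f z = t})"
    by (rule sum.cong) (auto intro: arg_cong[where f = card])
  finally show ?thesis .
qed

text \<open>
  Used twice for the same \<open>f\<close> and two sets \<open>T\<close>, this relates two counts without knowing the
  exceptional fibre over \<open>t0\<close>.
\<close>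
lemma card_values_in_off:
  assumes "finite S" "finite T" "t0 \<in> T"
    and "\<And>t. t \<in> T \<Longrightarrow> t \<noteq> t0 \<Longrightarrow> card {z\<in>S. f z = t} = m"
  shows "int (card {z\<in>S. f z \<in> T}) = int (card {z\<in>S. f z = t0}) + (int (card T) - 1) * int m"
proof -
  have "card {z\<in>S. f z \<in> T} = (\<Sum>t\<in>T. card {z\<in>S. f z = t})"
    by (rule card_values_in) (use assms in auto)
  also have "\<dots> = card {z\<in>S. f z = t0} + (\<Sum>t\<in>T - {t0}. card {z\<in>S. f z = t})"
    by (rule sum.remove) (use assms in auto)
  also have "(\<Sum>t\<in>T - {t0}. card {z\<in>S. f z = t}) = (\<Sum>t\<in>T - {t0}. m)"
    by (rule sum.cong) (use assms(4) in auto)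
  also have "\<dots> = (card T - 1) * m" using assms by simp
  finally have "card {z\<in>S. f z \<in> T} = card {z\<in>S. f z = t0} + (card T - 1) * m" .
  moreover have "card T \<ge> 1" using assms(2,3) by (metis One_nat_def Suc_leI card_gt_0_iff empty_iff)
  ultimately show ?thesis by (simp add: of_nat_diff)
qed

lemma card_filter_not: "finite T \<Longrightarrow> int (card {p\<in>T. \<not> P p}) = int (card T) - int (card {p\<in>T. P p})"
proof -
  assume T: "finite T"
  have "{p\<in>T. \<not> P p} = T - {p\<in>T. P p}" by auto
  then show ?thesis using T by (simp add: card_Diff_subset card_mono of_nat_diff)
qed

section \<open>Codegrees under isomorphism and under switching\<close>

lemma common_nbrs3: "Y \<in> common_nbrs Gr {A, B, C} \<longleftrightarrow> Y \<in> nbrs Gr A \<and> Y \<in> nbrs Gr B \<and> Y \<in> nbrs Gr C"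
  by (simp add: common_nbrs_def)

text \<open>
  The form in which an isomorphism is refuted: a configuration of the second graph can be
  pulled back to one of the first graph with the same internal adjacencies and the same
  number of common neighbours.
\<close>
lemma graph_isomorphic_codegree:
  assumes G: "pair_graph G" "pair_graph G'" and iso: "graph_isomorphic G G'"
    and X: "X \<subseteq> pverts G'" "X \<noteq> {}"
  obtains f where "inj_on f X" "f ` X \<subseteq> pverts G"
    "\<And>x y. x \<in> X \<Longrightarrow> y \<in> X \<Longrightarrow> f y \<in> nbrs G (f x) \<longleftrightarrow> y \<in> nbrs G' x"
    "card (common_nbrs G (f ` X)) = card (common_nbrs G' X)"
proof -
  interpret G: pair_graph G by fact
  interpret G': pair_graph G' by fact
  obtain g where g: "bij_betw g (pverts G) (pverts G')"
    and arcs: "\<And>u v. u \<in> pverts G \<Longrightarrow> v \<in> pverts G \<Longrightarrow> v \<in> nbrs G u \<longleftrightarrow> g v \<in> nbrs G' (g u)"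
    using iso unfolding graph_isomorphic_iff[OF G] nbrs_def by blast
  define f where "f = inv_into (pverts G) g"
  have f: "bij_betw f (pverts G') (pverts G)" unfolding f_def by (rule bij_betw_inv_into[OF g])
  have gf: "g (f x) = x" "f x \<in> pverts G" if "x \<in> pverts G'" for x
    using that g f by (auto simp: f_def bij_betw_def f_inv_into_f inv_into_into)
  have fg: "f (g x) = x" "g x \<in> pverts G'" if "x \<in> pverts G" for x
    using that g by (auto simp: f_def bij_betw_def)
  have adj: "f y \<in> nbrs G (f x) \<longleftrightarrow> y \<in> nbrs G' x" if "x \<in> pverts G'" "y \<in> pverts G'" for x y
    using arcs[of "f x" "f y"] gf that by simp
  have sub: "nbrs G x \<subseteq> pverts G" "nbrs G' y \<subseteq> pverts G'" for x y
    by (auto simp: nbrs_def dest: G.in_arcsD2 G'.in_arcsD2)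
  obtain x0 where x0: "x0 \<in> X" using X(2) by blast
  then have sub': "common_nbrs G' X \<subseteq> pverts G'" "common_nbrs G (f ` X) \<subseteq> pverts G"
    using sub(2)[of x0] sub(1)[of "f x0"] by (auto simp: common_nbrs_def)
  have "common_nbrs G (f ` X) = f ` common_nbrs G' X"
  proof (intro equalityI subsetI)
    fix z assume z: "z \<in> common_nbrs G (f ` X)"
    then have zV: "z \<in> pverts G" using sub' by blast
    have "g z \<in> nbrs G' x" if "x \<in> X" for x
      using z that X adj[of x "g z"] fg[OF zV] by (auto simp: common_nbrs_def)
    then show "z \<in> f ` common_nbrs G' X"
      using fg[OF zV] by (auto simp: common_nbrs_def intro!: image_eqI[of z f "g z"])
  next
    fix z assume "z \<in> f ` common_nbrs G' X"
    then obtain y where y: "z = f y" "y \<in> common_nbrs G' X" by blast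
    then have "y \<in> pverts G'" using sub' by blast
    then show "z \<in> common_nbrs G (f ` X)" using y adj X by (auto simp: common_nbrs_def)
  qed
  moreover have "inj_on f (common_nbrs G' X)"
    by (rule inj_on_subset[OF bij_betw_imp_inj_on[OF f]]) (rule sub')
  ultimately have "card (common_nbrs G (f ` X)) = card (common_nbrs G' X)" by (simp add: card_image)
  moreover have "inj_on f X" by (rule inj_on_subset[OF bij_betw_imp_inj_on[OF f] X(1)])
  moreover have "f ` X \<subseteq> pverts G" using X(1) gf by auto
  ultimately show ?thesis using that adj X(1) by blast
qed

text \<open>
  The combinatorial setting of the switching. The set \<open>S\<close> will be the set of vertices in the
  tangent hyperplane, and \<open>\<tau>\<close> exchanges the two cliques. From outside \<open>S\<close> no vertex sees all
  of \<open>l1\<close> or all of \<open>l2\<close>, so switching affects only pairs inside \<open>S\<close>.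
\<close>
locale line_switching = pair_graph G for G :: "'v pair_pre_digraph" +
  fixes l1 l2 S :: "'v set" and \<tau> :: "'v \<Rightarrow> 'v"
  assumes lines: "l1 \<noteq> {}" "l2 \<noteq> {}" "l1 \<inter> l2 = {}" "l1 \<subseteq> S" "l2 \<subseteq> S" "S \<subseteq> pverts G"
    and cliques: "\<And>x y. x \<in> l1 \<Longrightarrow> y \<in> l1 \<Longrightarrow> x \<noteq> y \<Longrightarrow> y \<in> nbrs G x"
      "\<And>x y. x \<in> l2 \<Longrightarrow> y \<in> l2 \<Longrightarrow> x \<noteq> y \<Longrightarrow> y \<in> nbrs G x"
    and uniform: "\<And>x y. x \<in> S - l1 \<Longrightarrow> y \<in> l1 \<Longrightarrow> y \<in> nbrs G x \<Longrightarrow> x \<in> common_nbrs G l1"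
      "\<And>x y. x \<in> S - l2 \<Longrightarrow> y \<in> l2 \<Longrightarrow> y \<in> nbrs G x \<Longrightarrow> x \<in> common_nbrs G l2"
    and inner: "common_nbrs G l1 \<subseteq> S" "common_nbrs G l2 \<subseteq> S"
    and swap: "\<And>x. x \<in> l1 \<Longrightarrow> \<tau> x \<in> l2" "\<And>x. x \<in> l2 \<Longrightarrow> \<tau> x \<in> l1"
      "\<And>x. x \<notin> l1 \<Longrightarrow> x \<notin> l2 \<Longrightarrow> \<tau> x = x" "\<And>x. \<tau> (\<tau> x) = x"

begin

abbreviation G' where "G' \<equiv> switched_graph G l1 l2"

lemma nbr_sym: "y \<in> nbrs G x \<longleftrightarrow> x \<in> nbrs G y"
  using pair_sym_arcs by (auto simp: nbrs_def symmetric_def dest: symD)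

lemma not_own_nbr: "x \<notin> nbrs G x"
  using pair_no_loops by (fastforce simp: nbrs_def)

lemma nbrs_subset: "nbrs G x \<subseteq> pverts G"
  by (auto simp: nbrs_def dest: in_arcsD2)

lemma line_nbr_iff:
  "x \<in> S \<Longrightarrow> x \<notin> l1 \<Longrightarrow> y \<in> l1 \<Longrightarrow> y \<in> nbrs G x \<longleftrightarrow> x \<in> common_nbrs G l1"
  "x \<in> S \<Longrightarrow> x \<notin> l2 \<Longrightarrow> y \<in> l2 \<Longrightarrow> y \<in> nbrs G x \<longleftrightarrow> x \<in> common_nbrs G l2"
  using uniform(1)[of x y] uniform(2)[of x y] nbr_sym[of y x] unfolding common_nbrs_def by blast+

lemma line_nbr_iff':
  "x \<in> S \<Longrightarrow> x \<notin> l1 \<Longrightarrow> y \<in> l1 \<Longrightarrow> x \<in> nbrs G y \<longleftrightarrow> x \<in> common_nbrs G l1"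
  "x \<in> S \<Longrightarrow> x \<notin> l2 \<Longrightarrow> y \<in> l2 \<Longrightarrow> x \<in> nbrs G y \<longleftrightarrow> x \<in> common_nbrs G l2"
  using line_nbr_iff nbr_sym by blast+

lemma not_common_nbr: "x \<in> l1 \<Longrightarrow> x \<notin> common_nbrs G l1" "x \<in> l2 \<Longrightarrow> x \<notin> common_nbrs G l2"
  using not_own_nbr by (auto simp: common_nbrs_def)

lemma cross_nbr: "x \<in> l1 \<Longrightarrow> y \<in> l2 \<Longrightarrow> x' \<in> l1 \<Longrightarrow> y' \<in> l2 \<Longrightarrow> y \<in> nbrs G x \<longleftrightarrow> y' \<in> nbrs G x'"
  using line_nbr_iff line_nbr_iff' lines by (metis disjoint_iff subsetD)

lemma line_clique_iff: "x \<in> l1 \<Longrightarrow> y \<in> l1 \<Longrightarrow> y \<in> nbrs G x \<longleftrightarrow> x \<noteq> y"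
  "x \<in> l2 \<Longrightarrow> y \<in> l2 \<Longrightarrow> y \<in> nbrs G x \<longleftrightarrow> x \<noteq> y"
  using cliques not_own_nbr by metis+

lemma swap_eq_iff: "\<tau> x = \<tau> y \<longleftrightarrow> x = y"
  using swap(4) by metis

lemma switch_part_iff:
  "x \<in> switch_part G l1 l2 \<longleftrightarrow> x \<in> common_nbrs G l1 \<and> x \<notin> common_nbrs G l2 \<and> x \<notin> l2"
  "x \<in> switch_part G l2 l1 \<longleftrightarrow> x \<in> common_nbrs G l2 \<and> x \<notin> common_nbrs G l1 \<and> x \<notin> l1"
  by (auto simp: switch_part_def)

lemma nbrs_switched: "x \<in> pverts G \<Longrightarrow> nbrs G' x = switched_nbrs G l1 l2 x"
  by (simp add: nbrs_def switched_graph_def)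

text \<open>
  Inside \<open>S\<close>, the switched graph is the original one transported along \<open>\<tau>\<close>: as vertices of
  \<open>S\<close> see each clique entirely or not at all, exchanging the outer neighbours of the two
  cliques is the same as exchanging the cliques.
\<close>
lemma switched_inside:
  assumes x: "x \<in> S" and y: "y \<in> S"
  shows "y \<in> nbrs G' x \<longleftrightarrow> \<tau> y \<in> nbrs G (\<tau> x)"
proof -
  have d: "\<And>z. z \<in> l1 \<Longrightarrow> z \<notin> l2" using lines by blast
  have N: "nbrs G' x = switched_nbrs G l1 l2 x" using x lines nbrs_switched by blast
  consider "x \<in> l1" "y \<in> l1" | "x \<in> l1" "y \<in> l2" | "x \<in> l1" "y \<notin> l1" "y \<notin> l2"
    | "x \<in> l2" "y \<in> l1" | "x \<in> l2" "y \<in> l2" | "x \<in> l2" "y \<notin> l1" "y \<notin> l2"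
    | "x \<notin> l1" "x \<notin> l2" "y \<in> l1" | "x \<notin> l1" "x \<notin> l2" "y \<in> l2"
    | "x \<notin> l1" "x \<notin> l2" "y \<notin> l1" "y \<notin> l2" by blast
  then show ?thesis
  proof cases
    case 1
    then show ?thesis unfolding N using d
      by (auto simp: switched_nbrs_def Let_def switch_part_iff not_common_nbr line_clique_iff swap swap_eq_iff)
  next
    case 2
    then show ?thesis unfolding N using d cross_nbr[OF 2 swap(2)[OF 2(2)] swap(1)[OF 2(1)]] nbr_sym
      by (auto simp: switched_nbrs_def Let_def switch_part_iff not_common_nbr)
  next
    case 3
    then show ?thesis unfolding N using d y
      by (auto simp: switched_nbrs_def Let_def switch_part_iff line_nbr_iff' swap)
  next
    case 4
    then show ?thesis unfolding N using d cross_nbr[OF 4(2,1) swap(2)[OF 4(1)] swap(1)[OF 4(2)]] nbr_sym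
      by (auto simp: switched_nbrs_def Let_def switch_part_iff not_common_nbr)
  next
    case 5
    then show ?thesis unfolding N using d
      by (auto simp: switched_nbrs_def Let_def switch_part_iff not_common_nbr line_clique_iff swap swap_eq_iff)
  next
    case 6
    then show ?thesis unfolding N using d y
      by (auto simp: switched_nbrs_def Let_def switch_part_iff line_nbr_iff' swap)
  next
    case 7
    then show ?thesis unfolding N using d x
      by (auto simp: switched_nbrs_def Let_def switch_part_iff line_nbr_iff swap)
  next
    case 8
    then show ?thesis unfolding N using d x
      by (auto simp: switched_nbrs_def Let_def switch_part_iff line_nbr_iff swap)
  next
    case 9
    then show ?thesis unfolding N
      by (auto simp: switched_nbrs_def Let_def swap)
  qed
qed

lemma switched_outside:
  assumes x: "x \<in> S" and y: "y \<notin> S"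
  shows "y \<in> nbrs G' x \<longleftrightarrow> y \<in> nbrs G x"
proof -
  have "y \<notin> common_nbrs G l1" "y \<notin> common_nbrs G l2" "y \<notin> l1" "y \<notin> l2"
    using y inner lines by blast+
  then show ?thesis
    using x lines by (auto simp: nbrs_switched subsetD switched_nbrs_def Let_def switch_part_iff)
qed

lemma swap_S: "\<tau> x \<in> S \<longleftrightarrow> x \<in> S"
  using swap lines by (metis subsetD)

text \<open>
  The inner common neighbours of \<open>T\<close> in the switched graph correspond to those of \<open>\<tau> ` T\<close> in
  \<open>G\<close>, the outer ones are those of \<open>T\<close> itself. Written with sums instead of differences,
  since these are natural numbers.
\<close>
lemma card_common_nbrs_switched:
  assumes T: "T \<subseteq> S" "T \<noteq> {}"
  shows "card (common_nbrs G' T) + card (common_nbrs G (\<tau> ` T) - S) =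
    card (common_nbrs G (\<tau> ` T)) + card (common_nbrs G T - S)"
proof -
  have fin: "finite (common_nbrs G U)" if "U \<noteq> {}" for U
  proof -
    obtain u where "u \<in> U" using \<open>U \<noteq> {}\<close> by blast
    then have "common_nbrs G U \<subseteq> pverts G" using nbrs_subset by (auto simp: common_nbrs_def)
    then show ?thesis using pair_finite_verts finite_subset by blast
  qed
  have "common_nbrs G' T = \<tau> ` (common_nbrs G (\<tau> ` T) \<inter> S) \<union> (common_nbrs G T - S)"
  proof (intro equalityI subsetI)
    fix y assume y: "y \<in> common_nbrs G' T"
    show "y \<in> \<tau> ` (common_nbrs G (\<tau> ` T) \<inter> S) \<union> (common_nbrs G T - S)"
    proof (cases "y \<in> S")
      case True
      then have "\<tau> y \<in> common_nbrs G (\<tau> ` T) \<inter> S"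
        using y T switched_inside swap_S by (auto simp: common_nbrs_def)
      then show ?thesis using swap(4) by (metis UnI1 imageI)
    next
      case False
      then show ?thesis using y T switched_outside by (auto simp: common_nbrs_def)
    qed
  next
    fix y assume "y \<in> \<tau> ` (common_nbrs G (\<tau> ` T) \<inter> S) \<union> (common_nbrs G T - S)"
    then consider z where "y = \<tau> z" "z \<in> common_nbrs G (\<tau> ` T)" "z \<in> S"
      | "y \<in> common_nbrs G T" "y \<notin> S" by blast
    then show "y \<in> common_nbrs G' T"
    proof cases
      case 1
      have "y \<in> nbrs G' x" if "x \<in> T" for x
        using 1 that T switched_inside[of x y] swap_S swap(4) by (auto simp: common_nbrs_def)
      then show ?thesis by (simp add: common_nbrs_def)
    next
      case 2
      then show ?thesis using T switched_outside by (auto simp: common_nbrs_def)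
    qed
  qed
  moreover have "\<tau> ` (common_nbrs G (\<tau> ` T) \<inter> S) \<inter> (common_nbrs G T - S) = {}"
    using swap_S by auto
  moreover have "card (\<tau> ` (common_nbrs G (\<tau> ` T) \<inter> S)) = card (common_nbrs G (\<tau> ` T) \<inter> S)"
    by (rule card_image) (auto simp: inj_on_def swap_eq_iff)
  ultimately have "card (common_nbrs G' T) = card (common_nbrs G (\<tau> ` T) \<inter> S) + card (common_nbrs G T - S)"
    using fin T by (simp add: card_Un_disjoint)
  moreover have "card (common_nbrs G (\<tau> ` T)) = card (common_nbrs G (\<tau> ` T) \<inter> S) + card (common_nbrs G (\<tau> ` T) - S)"
    using fin[of "\<tau> ` T"] T by (simp add: card_Int_Diff)
  ultimately show ?thesis by simp
qed

end

section \<open>The field of order \<open>q\<^sup>2\<close>\<close>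

locale quadratic_field =
  fixes q :: nat and field_type :: "'a::{field,finite} itself"
  assumes primepow_q: "primepow q" and card_field: "CARD('a) = q\<^sup>2"

begin

text \<open>
  The conjugation of the field, with the norm and the trace to its fixed field.
\<close>
definition cj :: "'a \<Rightarrow> 'a" where "cj x = x ^ q"

definition Nm :: "'a \<Rightarrow> 'a" where "Nm x = x * cj x"

definition Tr :: "'a \<Rightarrow> 'a" where "Tr x = x + cj x"

definition fixed_field :: "'a set" where "fixed_field = {x. cj x = x}"

lemma q_ge_2: "q \<ge> 2"
  using primepow_gt_Suc_0[OF primepow_q] by simp

text \<open>
  Multiplication by \<open>x\<close> permutes the nonzero elements, so it does not change their product.
\<close>
lemma power_card_field: "x ^ q\<^sup>2 = (x::'a)"
proof (cases "x = 0")
  case False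
  have "(\<Prod>y\<in>-{0}. x * y) = (\<Prod>y\<in>-{0::'a}. y)"
    by (rule prod.reindex_bij_witness[of _ "\<lambda>y. inverse x * y" "\<lambda>y. x * y"]) (use False in auto)
  then have "x ^ card (-{0::'a}) * (\<Prod>y\<in>-{0::'a}. y) = (\<Prod>y\<in>-{0}. y)"
    by (simp add: prod.distrib)
  then have *: "x ^ card (-{0::'a}) = 1" by simp
  have "card (-{0::'a}) = q\<^sup>2 - 1"
    by (simp add: Compl_eq_Diff_UNIV card_Diff_singleton card_field)
  moreover have "Suc (q\<^sup>2 - 1) = q\<^sup>2" using q_ge_2 by simp
  ultimately show ?thesis using * by (metis mult.right_neutral power_Suc)
qed (use q_ge_2 in simp)

text \<open>
  The characteristic divides \<open>q\<close>, because adding 1 permutes the field and hence \<open>q\<^sup>2\<close> is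
  zero in it. As \<open>q\<close> is a power of a prime, it is a power of the characteristic.
\<close>
lemma cj_add: "cj (x + y) = cj x + cj y"
proof -
  let ?p = "CHAR('a)"
  have "?p > 0" by (simp add: finite_imp_CHAR_pos)
  then have p: "prime ?p" by (rule prime_CHAR_semidom)
  obtain r k where r: "prime r" "q = r ^ k" "k > 0"
    using primepow_q unfolding primepow_def by auto
  have "(\<Sum>y\<in>UNIV. y + 1) = (\<Sum>y\<in>UNIV. y::'a)"
    by (rule sum.reindex_bij_witness[of _ "\<lambda>y. y - 1" "\<lambda>y. y + 1"]) auto
  then have "of_nat CARD('a) = (0::'a)" by (simp add: sum.distrib)
  then have "?p dvd q\<^sup>2" unfolding card_field of_nat_eq_0_iff_char_dvd .
  then have "?p dvd r" using r(2) p by (metis prime_dvd_power)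
  then have "r = ?p" using p r(1) primes_dvd_imp_eq by metis
  then show ?thesis unfolding cj_def using freshmans_dream'[OF p, of q k x y] r(2) by simp
qed

lemma cj_mult: "cj (x * y) = cj x * cj y"
  by (simp add: cj_def power_mult_distrib)

lemma cj_0 [simp]: "cj 0 = 0"
  using q_ge_2 by (simp add: cj_def)

lemma cj_1 [simp]: "cj 1 = 1"
  by (simp add: cj_def)

lemma cj_minus: "cj (- x) = - cj x"
  using cj_add[of x "- x"] by (simp add: eq_neg_iff_add_eq_0 add.commute)

lemma cj_diff: "cj (x - y) = cj x - cj y"
  using cj_add[of x "- y"] by (simp add: cj_minus)

lemma cj_cj [simp]: "cj (cj x) = x"
  using power_card_field[of x] by (simp add: cj_def power2_eq_square flip: power_mult)

lemma cj_eq_0_iff [simp]: "cj x = 0 \<longleftrightarrow> x = 0"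
  using q_ge_2 by (simp add: cj_def)

lemma cj_inverse: "cj (inverse x) = inverse (cj x)"
  by (simp add: cj_def power_inverse)

lemma cj_divide: "cj (x / y) = cj x / cj y"
  by (simp add: cj_def power_divide)

lemmas cj_simps = cj_add cj_mult cj_minus cj_diff cj_inverse cj_divide

lemma fixed_field_iff: "x \<in> fixed_field \<longleftrightarrow> cj x = x"
  by (simp add: fixed_field_def)

lemma zero_in_fixed_field [simp]: "0 \<in> fixed_field" and one_in_fixed_field [simp]: "1 \<in> fixed_field"
  by (simp_all add: fixed_field_iff)

lemma Nm_in_fixed_field [simp]: "Nm x \<in> fixed_field"
  by (simp add: fixed_field_iff Nm_def cj_simps mult.commute)

lemma Tr_in_fixed_field [simp]: "Tr x \<in> fixed_field"
  by (simp add: fixed_field_iff Tr_def cj_simps add.commute)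

lemma Nm_eq_0_iff [simp]: "Nm x = 0 \<longleftrightarrow> x = 0"
  by (simp add: Nm_def)

lemma Nm_0 [simp]: "Nm 0 = 0" by simp

lemma Nm_1 [simp]: "Nm 1 = 1"
  by (simp add: Nm_def)

lemma Nm_mult: "Nm (x * y) = Nm x * Nm y"
  by (simp add: Nm_def cj_simps)

lemma Nm_cj [simp]: "Nm (cj x) = Nm x"
  by (simp add: Nm_def mult.commute)

lemma Tr_0 [simp]: "Tr 0 = 0"
  by (simp add: Tr_def)

lemma Tr_cj [simp]: "Tr (cj x) = Tr x"
  by (simp add: Tr_def add.commute)

lemma Nm_add: "Nm (x + y) = Nm x + Nm y + Tr (x * cj y)"
  by (simp add: Nm_def Tr_def cj_simps algebra_simps)

lemma card_power_add_root_le: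
  assumes "d < k"
  shows "card {x::'a. x ^ k + a * x ^ d + c = 0} \<le> k"
proof -
  let ?p = "Polynomial.monom 1 k + Polynomial.monom a d + [:c:]"
  have "Polynomial.coeff ?p k = 1" using assms by (cases k) auto
  then have nz: "?p \<noteq> 0" by (metis Polynomial.coeff_0 zero_neq_one)
  have "Polynomial.degree ?p \<le> k"
    using assms by (intro degree_add_le) (auto intro: degree_monom_le order.trans)
  moreover have "{x. Polynomial.poly ?p x = 0} = {x. x ^ k + a * x ^ d + c = 0}"
    by (simp add: poly_monom)
  ultimately show ?thesis using card_poly_roots_bound[OF nz] by simp
qed

lemma card_fixed_field_le: "card fixed_field \<le> q"
proof -
  have "fixed_field = {x. x ^ q + (-1) * x ^ 1 + 0 = 0}"
    by (auto simp: fixed_field_def cj_def)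
  then show ?thesis using card_power_add_root_le[of 1 q "-1" 0] q_ge_2 by simp
qed

text \<open>
  The trace maps into a set of at most \<open>q\<close> elements and each fibre, being the set of roots
  of a polynomial of degree \<open>q\<close>, has at most \<open>q\<close> elements. Since there are \<open>q\<^sup>2\<close> elements to
  distribute, all bounds are attained.
\<close>
lemma Tr_fibers: "card fixed_field = q" "c \<in> fixed_field \<Longrightarrow> card {x. Tr x = c} = q"
proof -
  have le: "card {x. Tr x = c} \<le> q" for c
  proof -
    have "{x. Tr x = c} = {x. x ^ q + 1 * x ^ 1 + (- c) = 0}"
      by (auto simp: Tr_def cj_def add.commute eq_neg_iff_add_eq_0 algebra_simps)
    then show ?thesis using card_power_add_root_le[of 1 q 1 "- c"] q_ge_2 by simp
  qed
  have "UNIV = (\<Union>c\<in>fixed_field. {x. Tr x = c})" by auto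
  then have "q\<^sup>2 = card (\<Union>c\<in>fixed_field. {x. Tr x = c})" using card_field by metis
  also have "\<dots> = (\<Sum>c\<in>fixed_field. card {x. Tr x = c})"
    by (rule card_UN_disjoint) auto
  finally have s: "(\<Sum>c\<in>fixed_field. card {x. Tr x = c}) = q * q" by (simp add: power2_eq_square)
  show "card fixed_field = q" "c \<in> fixed_field \<Longrightarrow> card {x. Tr x = c} = q"
    using sum_bound_attained[OF _ card_fixed_field_le le _ s] q_ge_2 by auto
qed

lemmas card_fixed_field = Tr_fibers(1) and card_Tr_eq = Tr_fibers(2)

lemma Tr_surj: assumes "c \<in> fixed_field" obtains x where "Tr x = c"
proof -
  have "{x. Tr x = c} \<noteq> {}" using card_Tr_eq[OF assms] q_ge_2 by force
  then show ?thesis using that by blast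
qed

text \<open>
  The same argument as for the trace, with the \<open>q\<^sup>2 - 1 = (q - 1) * (q + 1)\<close> nonzero
  elements.
\<close>
lemma card_Nm_eq: assumes "c \<in> fixed_field" "c \<noteq> 0" shows "card {x. Nm x = c} = q + 1"
proof -
  have le: "card {x. Nm x = c} \<le> q + 1" for c
  proof -
    have "{x. Nm x = c} = {x. x ^ (q + 1) + 0 * x ^ 0 + (- c) = 0}"
      by (auto simp: Nm_def cj_def mult.commute)
    then show ?thesis using card_power_add_root_le[of 0 "q + 1" 0 "- c"] by simp
  qed
  have "UNIV - {0} = (\<Union>c\<in>fixed_field - {0}. {x. Nm x = c})" by auto
  then have "q\<^sup>2 - 1 = card (\<Union>c\<in>fixed_field - {0}. {x. Nm x = c})"
    using card_field by (metis card_Diff_singleton UNIV_I)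
  also have "\<dots> = (\<Sum>c\<in>fixed_field - {0}. card {x. Nm x = c})"
    by (rule card_UN_disjoint) auto
  also have "q\<^sup>2 - 1 = (q - 1) * (q + 1)" by (simp add: power2_eq_square algebra_simps)
  finally have s: "(\<Sum>c\<in>fixed_field - {0}. card {x. Nm x = c}) = (q - 1) * (q + 1)" by simp
  have "card (fixed_field - {0}) \<le> q - 1" using card_fixed_field by simp
  then show ?thesis
    using sum_bound_attained(2)[OF _ _ le _ s, of c] assms by auto
qed

lemma Nm_surj: assumes "c \<in> fixed_field" obtains x where "Nm x = c"
proof (cases "c = 0")
  case False
  then have "{x. Nm x = c} \<noteq> {}" using card_Nm_eq[OF assms False] by force
  then show ?thesis using that by blast
qed (use that[of 0] in simp)

lemma nonfixed_exists: obtains s where "s \<notin> fixed_field"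
proof -
  have "q < q ^ 2" using q_ge_2 by (simp add: power2_eq_square)
  then have "card fixed_field < CARD('a)" by (simp add: card_fixed_field card_field)
  then have "fixed_field \<noteq> UNIV" by auto
  then show ?thesis using that by blast
qed

text \<open>
  The values \<open>h a b\<close> for which the neighbours \<open>\<langle>v + a\<rangle>\<close> and \<open>\<langle>v + b\<rangle>\<close> of a vertex \<open>\<langle>v\<rangle>\<close> are
  adjacent.
\<close>
definition K :: "'a set" where "K = {k. Nm (1 + k) = 1}"

lemma zero_in_K [simp]: "0 \<in> K"
  by (simp add: K_def)

lemma card_K: "card K = q + 1"
proof -
  have "bij_betw (\<lambda>k. 1 + k) K {x. Nm x = 1}"
    by (rule bij_betw_byWitness[where f' = "\<lambda>x. x - 1"]) (auto simp: K_def)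
  from bij_betw_same_card[OF this] show ?thesis using card_Nm_eq[of 1] by simp
qed

lemma K_iff: "k \<in> K \<longleftrightarrow> k + cj k + k * cj k = 0"
  by (simp add: K_def Nm_def cj_simps algebra_simps)

lemma K_cj: "k \<in> K \<Longrightarrow> cj k \<in> K"
  by (simp add: K_iff cj_simps algebra_simps)

text \<open>
  For nonzero \<open>b \<in> K\<close> the number \<open>cj b\<close> is a rational function of \<open>b\<close>; substituting it turns
  membership of \<open>cj t * b\<close> into a linear equation for \<open>b\<close>.
\<close>
lemma K_scaled_iff:
  assumes "b \<in> K" "b \<noteq> 0" "t \<noteq> 0" "t \<noteq> 1"
  shows "cj t * b \<in> K \<longleftrightarrow> t \<noteq> cj t \<and> b = (t - cj t) / (cj t * (1 - t))"
proof -
  have b: "cj b * (1 + b) = - b" using assms(1) by (simp add: K_iff eq_neg_iff_add_eq_0 algebra_simps)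
  then have b1: "1 + b \<noteq> 0" using assms(2) by auto
  have "cj t * b \<in> K \<longleftrightarrow> cj t * b + t * cj b + t * cj t * b * cj b = 0"
    by (simp add: K_iff cj_simps algebra_simps)
  also have "\<dots> \<longleftrightarrow> (cj t * b + t * cj b + t * cj t * b * cj b) * (1 + b) = 0"
    using b1 by simp
  also have "(cj t * b + t * cj b + t * cj t * b * cj b) * (1 + b) =
      cj t * b * (1 + b) + t * (cj b * (1 + b)) + t * cj t * b * (cj b * (1 + b))"
    by (simp add: algebra_simps)
  also have "\<dots> = b * (cj t * (1 - t) * b - (t - cj t))"
    by (simp only: b) (simp add: algebra_simps)
  also have "\<dots> = 0 \<longleftrightarrow> cj t * (1 - t) * b = t - cj t"
    using assms(2) by simp
  also have "\<dots> \<longleftrightarrow> t \<noteq> cj t \<and> b = (t - cj t) / (cj t * (1 - t))"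
    using assms by (auto simp: field_simps)
  finally show ?thesis .
qed

text \<open>
  This is where collinear triangles split into two classes: the ratio \<open>t\<close> decides whether
  \<open>0\<close> is the only solution.
\<close>
lemma card_K_scaled:
  assumes "t \<noteq> 0" "t \<noteq> 1"
  shows "card {b\<in>K. cj t * b \<in> K} = (if t \<in> fixed_field then 1 else 2)"
proof -
  let ?b = "(t - cj t) / (cj t * (1 - t))"
  have c1: "cj t \<noteq> 1" using assms(2) by (metis cj_cj cj_1)
  have "?b \<in> K"
    using assms c1 by (simp add: K_iff cj_simps divide_simps) (simp add: algebra_simps)
  have "cj t * b \<in> K \<longleftrightarrow> b = 0 \<or> t \<notin> fixed_field \<and> b = ?b" if "b \<in> K" for b
  proof (cases "b = 0")
    case False
    then show ?thesis
      unfolding K_scaled_iff[OF that False assms] fixed_field_iff using False by metis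
  qed simp
  then have "{b\<in>K. cj t * b \<in> K} = {b\<in>K. b = 0 \<or> t \<notin> fixed_field \<and> b = ?b}" by blast
  also have "\<dots> = (if t \<in> fixed_field then {0} else {0, ?b})"
    using \<open>?b \<in> K\<close> by auto
  finally show ?thesis using assms by (auto simp: fixed_field_iff)
qed

text \<open>
  In terms of the norm-one elements \<open>x = 1 + b\<close>, \<open>y = 1 + c\<close>, \<open>z = 1 + k\<close> the right-hand
  side reads \<open>y = x * z\<close>. Since conjugation inverts these elements, the trace is an explicit
  multiple of \<open>z / y - 1 / x\<close>.
\<close>
lemma Tr_K_quotient_eq_0_iff:
  assumes "b \<in> K" "c \<in> K" "k \<in> K" "b \<noteq> 0" "c \<noteq> 0" "k \<noteq> 0"
  shows "Tr (c * cj b / k) = 0 \<longleftrightarrow> c = b + k + b * k"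
proof -
  define x y z where "x = 1 + b" and "y = 1 + c" and "z = 1 + k"
  have n: "x * cj x = 1" "y * cj y = 1" "z * cj z = 1"
    using assms(1-3) by (simp_all add: K_def Nm_def x_def y_def z_def)
  then have nz: "x \<noteq> 0" "y \<noteq> 0" "z \<noteq> 0" by auto
  have inv: "cj x = 1 / x" "cj y = 1 / y" "cj z = 1 / z"
    using n nz by (simp_all add: field_simps)
  have e: "b = x - 1" "c = y - 1" "k = z - 1" by (simp_all add: x_def y_def z_def)
  have z1: "z - 1 \<noteq> 0" "1 - z \<noteq> 0" "x - 1 \<noteq> 0" "y - 1 \<noteq> 0" using assms e by auto
  have "Tr (c * cj b / k) = (y - 1) * (1 / x - 1) / (z - 1) + (1 / y - 1) * (x - 1) / (1 / z - 1)"
    by (simp add: Tr_def e cj_simps inv)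
  also have "\<dots> = (y - 1) * (x - 1) / (z - 1) * (z / y - 1 / x)"
  proof -
    have "1 / z - 1 = - (z - 1) / z" "1 / x - 1 = - (x - 1) / x" "1 / y - 1 = - (y - 1) / y"
      using nz by (simp_all add: field_simps)
    then show ?thesis using nz z1 by (simp add: divide_simps) (simp add: algebra_simps)
  qed
  also have "\<dots> = 0 \<longleftrightarrow> z / y = 1 / x" using z1 by simp
  also have "\<dots> \<longleftrightarrow> y = x * z" using nz by (auto simp: field_simps)
  also have "\<dots> \<longleftrightarrow> c = b + k + b * k" by (auto simp: e algebra_simps)
  finally show ?thesis .
qed

lemma card_Tr_mult_eq_0: "u \<noteq> 0 \<Longrightarrow> card {c. Tr (c * u) = 0} = q"
proof -
  assume u: "u \<noteq> 0"
  have "bij_betw (\<lambda>c. c * u) {c. Tr (c * u) = 0} {x. Tr x = 0}"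
    by (rule bij_betw_byWitness[where f' = "\<lambda>x. x / u"]) (use u in auto)
  from bij_betw_same_card[OF this] show ?thesis using card_Tr_eq[of 0] by simp
qed

lemma card_Tr_zeros:
  assumes "k \<noteq> 0"
  shows "card {p. Tr (snd p * cj (fst p) / k) = 0} = q ^ 2 + (q ^ 2 - 1) * q"
proof -
  have "{p. Tr (snd p * cj (fst p) / k) = 0} = (SIGMA b:UNIV. {c. Tr (c * (cj b / k)) = 0})"
    by auto
  then have "card {p. Tr (snd p * cj (fst p) / k) = 0} = (\<Sum>b\<in>UNIV. card {c. Tr (c * (cj b / k)) = 0})"
    by simp
  also have "\<dots> = card {c::'a. Tr (c * (cj 0 / k)) = 0} + (\<Sum>b\<in>UNIV - {0}. card {c. Tr (c * (cj b / k)) = 0})"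
    by (rule sum.remove) auto
  also have "(\<Sum>b\<in>UNIV - {0}. card {c. Tr (c * (cj b / k)) = 0}) = (\<Sum>b\<in>UNIV - {0::'a}. q)"
    using assms by (intro sum.cong refl card_Tr_mult_eq_0) auto
  finally show ?thesis by (simp add: card_field)
qed

text \<open>
  For \<open>b = 0\<close> all \<open>q + 1\<close> values of \<open>c\<close> are zeros. For \<open>b = cj k\<close> the solution
  \<open>c = b + k + b * k\<close> is \<open>0\<close> itself, and for each of the other \<open>q - 1\<close> values of \<open>b\<close> there
  are the two zeros \<open>c = 0\<close> and \<open>c = b + k + b * k\<close>.
\<close>
lemma card_Tr_zeros_K:
  assumes k: "k \<in> K" "k \<noteq> 0"
  shows "card {p\<in>K \<times> K. Tr (snd p * cj (fst p) / k) = 0} = 3 * q"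
proof -
  let ?Z = "\<lambda>b. {c\<in>K. Tr (c * cj b / k) = 0}"
  have "{p\<in>K \<times> K. Tr (snd p * cj (fst p) / k) = 0} = (SIGMA b:K. ?Z b)"
    by auto
  then have "card {p\<in>K \<times> K. Tr (snd p * cj (fst p) / k) = 0} = (\<Sum>b\<in>K. card (?Z b))"
    by simp
  also have "\<dots> = card (?Z 0) + (\<Sum>b\<in>K - {0}. card (?Z b))"
    by (rule sum.remove) auto
  \<comment> \<open>The value \<open>b = cj k\<close> is split off because there the two zeros coincide.\<close>
  also have "(\<Sum>b\<in>K - {0}. card (?Z b)) = card (?Z (cj k)) + (\<Sum>b\<in>K - {0} - {cj k}. card (?Z b))"
    by (rule sum.remove) (use k K_cj in auto)
  also have "?Z (cj k) = {0}"
  proof -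
    have "cj k + k + cj k * k = 0" using k(1) by (simp add: K_iff algebra_simps)
    then show ?thesis using Tr_K_quotient_eq_0_iff[of "cj k" _ k] k K_cj by auto
  qed
  also have "(\<Sum>b\<in>K - {0} - {cj k}. card (?Z b)) = (\<Sum>b\<in>K - {0} - {cj k}. 2)"
  proof (rule sum.cong[OF refl])
    fix b assume b: "b \<in> K - {0} - {cj k}"
    let ?c = "b + k + b * k"
    have "1 + ?c = (1 + b) * (1 + k)" by (simp add: algebra_simps)
    then have cK: "?c \<in> K" using b k by (simp add: K_def Nm_mult)
    have "?c \<noteq> 0"
    proof
      assume "?c = 0"
      then have "b * (1 + k) = - k" by (simp add: algebra_simps eq_neg_iff_add_eq_0)
      moreover have "cj k * (1 + k) = - k" using k(1) by (simp add: K_iff algebra_simps eq_neg_iff_add_eq_0)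
      ultimately have "b * (1 + k) = cj k * (1 + k)" by simp
      moreover have "1 + k \<noteq> 0" using k(1) by (auto simp: K_def Nm_0)
      ultimately show False using b by simp
    qed
    then have "?Z b = {0, ?c}"
      using Tr_K_quotient_eq_0_iff[of b _ k] b k cK by auto
    then show "card (?Z b) = 2" using \<open>?c \<noteq> 0\<close> by simp
  qed
  finally show ?thesis using k K_cj card_K q_ge_2 by (simp add: card_Diff_singleton)
qed

end

section \<open>Independent vectors, points and lines\<close>

text \<open>
  Lists keep repeated vectors apart from single ones, and their lengths give the exponents
  in the counts below.
\<close>
definition lin_indep :: "('a::field ^ 'n) list \<Rightarrow> bool" where
  "lin_indep xs \<longleftrightarrow> distinct xs \<and> vec.independent (set xs)"

lemma lin_indep_Nil [simp]: "lin_indep []"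
  by (simp add: lin_indep_def vec.independent_empty)

lemma lin_indep_Cons: "lin_indep (x # xs) \<longleftrightarrow> lin_indep xs \<and> x \<notin> vec.span (set xs)"
  by (auto simp: lin_indep_def vec.independent_insert vec.span_base)

lemma lin_indep_rotate: "lin_indep (xs @ [x]) \<longleftrightarrow> lin_indep (x # xs)"
  by (auto simp: lin_indep_def)

lemma lin_indep_exchange:
  fixes xs ys :: "('a::field ^ 'n) list"
  assumes "lin_indep xs" "length ys \<le> length xs" "set xs \<subseteq> vec.span (set ys)"
  shows "lin_indep ys"
proof -
  have le: "length xs \<le> card (set ys)"
    using vec.independent_span_bound[of "set ys" "set xs"] assms
    by (simp add: lin_indep_def distinct_card)
  then have d: "distinct ys" using assms(2) card_length[of ys] by (intro card_distinct) simp
  have "length xs = vec.dim (set xs)" using assms(1)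
    by (simp add: lin_indep_def distinct_card vec.dim_eq_card_independent)
  also have "\<dots> \<le> vec.dim (set ys)" using assms(3) by (rule vec.dim_mono)
  finally have "vec.independent (set ys)"
    using assms(2) card_length[of ys] by (intro vec.card_le_dim_spanning[of _ "set ys"]) (auto simp: vec.span_superset)
  then show ?thesis using d by (simp add: lin_indep_def)
qed

lemma notin_span_scale:
  fixes r :: "'a::field ^ 'n"
  assumes "r \<notin> vec.span S" "k \<noteq> 0"
  shows "k *s r \<notin> vec.span S"
proof
  assume "k *s r \<in> vec.span S"
  then have "inverse k *s (k *s r) \<in> vec.span S" by (rule vec.span_scale)
  then show False using assms by (simp add: vector_smult_assoc)
qed

lemma is_point_iff: "is_point X \<longleftrightarrow> (\<exists>x. x \<noteq> 0 \<and> X = vec.span {x})"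
proof
  assume "is_point X"
  then have X: "vec.subspace X" "vec.dim X = 1" by (simp_all add: is_point_def)
  obtain B where B: "B \<subseteq> X" "vec.independent B" "X \<subseteq> vec.span B" "card B = vec.dim X"
    by (rule vec.basis_exists)
  then obtain x where x: "B = {x}" using X(2) card_1_singletonE by metis
  have "x \<noteq> 0" using B(2) x vec.dependent_zero by auto
  moreover have "X = vec.span {x}" using B x X(1) vec.span_minimal by blast
  ultimately show "\<exists>x. x \<noteq> 0 \<and> X = vec.span {x}" by blast
qed (auto simp: is_point_def)

lemma is_line_span: "lin_indep [x, y] \<Longrightarrow> is_line (vec.span {x, y})"
  by (auto simp: is_line_def lin_indep_def vec.dim_eq_card_independent)

lemma span_singleton_eqE:
  fixes x y :: "'a::field ^ 'n"
  assumes "vec.span {x} = vec.span {y}"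
  obtains c where "y = c *s x"
proof -
  have "y \<in> vec.span {x}" using assms vec.span_base by blast
  then show ?thesis using that by (auto simp: vec.span_singleton)
qed

lemma span_scale_singleton: "c \<noteq> (0::'a::field) \<Longrightarrow> vec.span {c *s x} = vec.span {x}"
proof -
  assume c: "c \<noteq> 0"
  have "x = inverse c *s (c *s x)" using c by (simp add: vector_smult_assoc)
  then have "x \<in> vec.span {c *s x}" by (metis vec.span_base vec.span_scale insertI1)
  then show ?thesis by (auto simp: vec.span_eq intro: vec.span_scale vec.span_base)
qed

lemma in_span_pair: "w \<in> vec.span {x, y} \<longleftrightarrow> (\<exists>a b. w = a *s x + b *s y)"
  by (auto simp: vec.span_insert vec.span_singleton algebra_simps)

section \<open>Values of a Hermitian form\<close>

locale unitary_space = quadratic_field q "TYPE('a)"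
  for q :: nat and h :: "'a::{field,finite} ^ 'n \<Rightarrow> 'a ^ 'n \<Rightarrow> 'a" +
  assumes hermitian: "hermitian_form q h" and nondegenerate: "nondegenerate_form h"

begin

lemma h_add_left: "h (x + y) z = h x z + h y z"
  using hermitian[unfolded hermitian_form_def, THEN conjunct1] by simp

lemma h_scale_left: "h (c *s x) y = c * h x y"
  using hermitian[unfolded hermitian_form_def, THEN conjunct2, THEN conjunct1] by simp

lemma h_flip: "h y x = cj (h x y)"
  unfolding cj_def
  by (rule hermitian[unfolded hermitian_form_def, THEN conjunct2, THEN conjunct2, rule_format])

lemma h_add_right: "h x (y + z) = h x y + h x z"
  by (metis h_flip h_add_left cj_add)

lemma h_scale_right: "h x (c *s y) = cj c * h x y"
  by (metis h_flip h_scale_left cj_mult)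

lemma h_0_left [simp]: "h 0 x = 0" and h_0_right [simp]: "h x 0 = 0"
  using h_scale_left[of 0 0 x] h_scale_right[of x 0 0] by simp_all

lemma h_minus_left: "h (- x) y = - h x y" and h_minus_right: "h y (- x) = - h y x"
  using h_add_left[of x "- x" y] h_add_right[of y x "- x"]
  by (simp_all add: eq_neg_iff_add_eq_0 add.commute)

lemma h_diff_left: "h (x - z) y = h x y - h z y" and h_diff_right: "h y (x - z) = h y x - h y z"
  using h_add_left[of x "- z" y] h_add_right[of y x "- z"]
  by (simp_all add: h_minus_left h_minus_right)

lemmas h_simps = h_add_left h_add_right h_scale_left h_scale_right h_diff_left h_diff_right

lemma h_self_fixed_field [simp]: "h x x \<in> fixed_field"
  by (metis fixed_field_iff h_flip)

lemma h_eq_0_commute: "h x y = 0 \<longleftrightarrow> h y x = 0"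
  by (metis h_flip cj_eq_0_iff)

text \<open>
  If \<open>r\<close> is isotropic and not orthogonal to \<open>w\<close>, the last summand takes every value of the
  fixed field. Most isotropic vectors below are found in this way.
\<close>
lemma h_self_add_scale:
  "h (w + s *s r) (w + s *s r) = h w w + Nm s * h r r + Tr (cj s * h w r)"
  by (simp add: h_simps Nm_def Tr_def cj_simps h_flip[of r w] algebra_simps)

text \<open>
  The usual certificate of independence: a vector \<open>w\<close> orthogonal to \<open>S\<close> but not to \<open>x\<close>.
\<close>
lemma not_in_span:
  assumes "\<And>y. y \<in> S \<Longrightarrow> h y w = 0" and "h x w \<noteq> 0"
  shows "x \<notin> vec.span S"
proof
  assume "x \<in> vec.span S"
  then have "h x w = 0"
    by (rule vec.span_induct) (auto simp: vec.subspace_def h_simps assms(1))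
  then show False using assms(2) by simp
qed

text \<open>
  Riesz representation. The map sending \<open>w\<close> to its products with the standard basis is
  injective because the form is nondegenerate, hence surjective because the space is finite.
\<close>
lemma represent_conjugate_linear:
  fixes f :: "'a ^ 'n \<Rightarrow> 'a"
  assumes f: "\<And>x y. f (x + y) = f x + f y" "\<And>c x. f (c *s x) = cj c * f x"
  obtains w where "\<And>x. h w x = f x"
proof -
  have expand: "g x = (\<Sum>j\<in>UNIV. cj (x $ j) * g (axis j 1))"
    if g: "\<And>x y. g (x + y) = g x + g y" "\<And>c x. g (c *s x) = cj c * g x"
    for g :: "'a ^ 'n \<Rightarrow> 'a" and x
  proof -
    have g0: "g 0 = 0" using g(2)[of 0 0] by simp
    have gs: "g (sum F A) = (\<Sum>a\<in>A. g (F a))" if "finite A" for F and A :: "'n set"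
      using that by (induction A rule: finite_induct) (auto simp: g g0)
    have "g x = g (\<Sum>j\<in>UNIV. x $ j *s axis j 1)" by (simp only: basis_expansion)
    also have "\<dots> = (\<Sum>j\<in>UNIV. cj (x $ j) * g (axis j 1))"
      by (simp add: gs g(2))
    finally show ?thesis .
  qed
  define \<psi> where "\<psi> w = (\<chi> j. h w (axis j 1))" for w
  have agree: "h w x = g x" if "\<And>j. h w (axis j 1) = g (axis j 1)"
    and "\<And>x y. g (x + y) = g x + g y" "\<And>c x. g (c *s x) = cj c * g x" for w g x
    unfolding expand[of "h w" x, OF h_add_right h_scale_right] expand[of g x, OF that(2,3)]
    by (simp only: that(1))
  have "inj \<psi>"
  proof (rule injI)
    fix w w' assume "\<psi> w = \<psi> w'"
    then have "h w (axis j 1) = h w' (axis j 1)" for j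
      unfolding \<psi>_def vec_eq_iff by simp
    then have "h w x = h w' x" for x by (rule agree[OF _ h_add_right h_scale_right])
    then have "h (w - w') x = 0" for x by (simp only: h_diff_left right_minus_eq)
    then have "w - w' = 0" using nondegenerate unfolding nondegenerate_form_def by blast
    then show "w = w'" by simp
  qed
  then have "surj \<psi>" by (rule finite_UNIV_inj_surj[OF finite])
  then obtain w where w: "(\<chi> j. f (axis j 1)) = \<psi> w" by (rule surjE)
  have "h w (axis j 1) = f (axis j 1)" for j
    using w unfolding \<psi>_def vec_eq_iff by simp
  then have "h w x = f x" for x by (rule agree[OF _ f])
  then show ?thesis using that by blast
qed

text \<open>
  A linear map with prescribed values on \<open>B\<close> exists, and its conjugate is represented by a
  vector. The coordinate \<open>undefined\<close> only serves to embed scalars into the vector space.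
\<close>
lemma prescribe_products:
  assumes "vec.independent B"
  obtains w where "\<And>b. b \<in> B \<Longrightarrow> h w b = \<beta> b"
proof -
  define g where "g = vec.construct B (\<lambda>b. cj (\<beta> b) *s axis undefined (1::'a))"
  have lin: "Vector_Spaces.linear (*s) (*s) g"
    unfolding g_def using assms by (rule vec.linear_construct)
  have "cj (g (x + y) $ undefined) = cj (g x $ undefined) + cj (g y $ undefined)"
    and "cj (g (c *s x) $ undefined) = cj c * cj (g x $ undefined)" for c x y
    by (simp_all add: vec.linear_add[OF lin] vec.linear_scale[OF lin] cj_simps)
  from represent_conjugate_linear[OF this]
  obtain w where w: "\<And>x. h w x = cj (g x $ undefined)" by blast
  have "h w b = \<beta> b" if "b \<in> B" for b
    using that by (simp add: w g_def vec.construct_basis[OF assms] axis_def)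
  then show ?thesis using that by blast
qed

lemma card_vectors: "CARD('a ^ 'n) = q ^ (2 * CARD('n))"
  by (simp add: card_field flip: power_mult)

text \<open>
  Products with independent vectors take all combinations of values, and they do so equally
  often because two fibres differ by a translation.
\<close>
lemma card_prescribed_products:
  assumes "lin_indep xs" "length ys = length xs"
  shows "card {w. map (h w) xs = ys} * q ^ (2 * length xs) = q ^ (2 * CARD('n))"
proof -
  let ?T = "{ys::'a list. length ys = length xs}"
  let ?fib = "\<lambda>ys. {w. map (h w) xs = ys}"
  have ex: "\<exists>w. map (h w) xs = zs" if "zs \<in> ?T" for zs
  proof -
    have d: "distinct xs" and ind: "vec.independent (set xs)"
      using assms(1) by (simp_all add: lin_indep_def)
    obtain w where w: "\<And>b. b \<in> set xs \<Longrightarrow> h w b = the (map_of (zip xs zs) b)"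
      using prescribe_products[OF ind, of "\<lambda>b. the (map_of (zip xs zs) b)"] by metis
    have "h w (xs ! i) = zs ! i" if "i < length xs" for i
    proof -
      have "map_of (zip xs zs) (xs ! i) = Some (zs ! i)"
        using d that \<open>zs \<in> ?T\<close> by (intro map_of_zip_nth) auto
      then show ?thesis using w[OF nth_mem[OF that]] by simp
    qed
    then have "map (h w) xs = zs"
      using \<open>zs \<in> ?T\<close> by (intro nth_equalityI) auto
    then show ?thesis by blast
  qed
  have same: "card (?fib zs) = card (?fib (map (\<lambda>_. 0) xs))" if "zs \<in> ?T" for zs
  proof -
    obtain v where v: "map (h v) xs = zs" using ex[OF \<open>zs \<in> ?T\<close>] by blast
    have "bij_betw (\<lambda>w. w - v) (?fib zs) (?fib (map (\<lambda>_. 0) xs))"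
      by (rule bij_betw_byWitness[where f' = "\<lambda>w. w + v"]) (auto simp: h_simps v[symmetric])
    then show ?thesis by (rule bij_betw_same_card)
  qed
  have T: "finite ?T" "card ?T = q ^ (2 * length xs)"
    using finite_lists_length_eq[of "UNIV :: 'a set"] card_lists_length_eq[of "UNIV :: 'a set"]
    by (simp_all add: card_field flip: power_mult)
  have "CARD('a ^ 'n) = (\<Sum>zs\<in>?T. card {w\<in>UNIV. map (h w) xs = zs})"
    by (rule card_sum_fibers) (auto simp: T)
  also have "\<dots> = card ?T * card (?fib (map (\<lambda>_. 0) xs))"
    using same by simp
  finally show ?thesis using same[of ys] assms(2) T(2) card_vectors by (simp add: mult.commute)
qed

text \<open>
  Translating by multiples of an isotropic \<open>r\<close> that has a fixed nonzero product with the
  elements of \<open>S\<close> changes the value of the form by an arbitrary element of the fixed field,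
  so all \<open>q\<close> values are equally frequent in \<open>S\<close>.
\<close>
lemma card_isotropic_slice:
  assumes r: "h r r = 0" and S: "\<And>w s. w \<in> S \<Longrightarrow> w + s *s r \<in> S"
    and \<beta>: "\<And>w. w \<in> S \<Longrightarrow> h w r = \<beta>" "\<beta> \<noteq> 0" and c: "c \<in> fixed_field"
  shows "card {w\<in>S. h w w = c} * q = card S"
proof -
  have le: "card {w\<in>S. h w w = d} \<le> card {w\<in>S. h w w = e}" if "d \<in> fixed_field" "e \<in> fixed_field" for d e
  proof -
    have "e - d \<in> fixed_field" using that by (simp add: fixed_field_iff cj_simps)
    then obtain x where x: "Tr x = e - d" by (rule Tr_surj)
    let ?f = "\<lambda>w. w + cj (x / \<beta>) *s r"
    have "?f ` {w\<in>S. h w w = d} \<subseteq> {w\<in>S. h w w = e}"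
      using S \<beta> x by (auto simp: h_self_add_scale r)
    then show ?thesis by (intro card_inj_on_le[of ?f]) (auto intro: inj_onI)
  qed
  have "card S = (\<Sum>d\<in>fixed_field. card {w\<in>S. h w w = d})"
    by (rule card_sum_fibers) auto
  also have "\<dots> = (\<Sum>d\<in>fixed_field. card {w\<in>S. h w w = c})"
    using le c by (intro sum.cong refl antisym) auto
  finally show ?thesis by (simp add: card_fixed_field mult.commute)
qed

lemma card_isotropic_prescribed:
  assumes "lin_indep (r # xs)" "length ys = length xs" and r: "h r r = 0"
    "\<forall>x\<in>set xs. h r x = 0" and "\<beta> \<noteq> 0" "c \<in> fixed_field"
  shows "card {w. h w w = c \<and> h w r = \<beta> \<and> map (h w) xs = ys} * q ^ (2 * length xs + 3)
    = q ^ (2 * CARD('n))"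
proof -
  let ?S = "{w. map (h w) (r # xs) = \<beta> # ys}"
  have slice: "card {w\<in>?S. h w w = c} * q = card ?S"
  proof (rule card_isotropic_slice[OF r(1)])
    fix w s assume "w \<in> ?S"
    moreover have "map (h (w + s *s r)) xs = map (h w) xs"
      using r(2) by (simp add: h_simps)
    ultimately show "w + s *s r \<in> ?S" by (simp add: h_simps r)
  qed (use assms in auto)
  have "{w. h w w = c \<and> h w r = \<beta> \<and> map (h w) xs = ys} = {w\<in>?S. h w w = c}"
    by auto
  moreover have "q ^ (2 * length xs + 3) = q * q ^ (2 * length (r # xs))"
    by (simp add: power_add numeral_3_eq_3)
  moreover have "card ?S * q ^ (2 * length (r # xs)) = q ^ (2 * CARD('n))"
    by (rule card_prescribed_products) (use assms in auto)
  ultimately show ?thesis by (simp only: slice flip: mult.assoc)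
qed

text \<open>
  Scaling by \<open>x\<close> multiplies the value of the form by \<open>Nm x\<close>, and every nonzero element of
  the fixed field is a norm.
\<close>
lemma card_cone:
  assumes S: "\<And>z c. z \<in> S \<Longrightarrow> c *s z \<in> S"
  shows "c \<in> fixed_field \<Longrightarrow> c \<noteq> 0 \<Longrightarrow> card {z\<in>S. h z z = c} = card {z\<in>S. h z z = 1}"
    and "card S = card {z\<in>S. h z z = 0} + (q - 1) * card {z\<in>S. h z z = 1}"
proof -
  have eq: "card {z\<in>S. h z z = c} = card {z\<in>S. h z z = 1}" if c: "c \<in> fixed_field" "c \<noteq> 0" for c
  proof -
    obtain x where x: "Nm x = c" using c(1) by (rule Nm_surj)
    then have x0: "x \<noteq> 0" using c(2) by auto
    have hs: "h (a *s z) (a *s z) = Nm a * h z z" for a z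
      by (simp add: h_simps Nm_def)
    have "Nm (inverse x) * Nm x = 1" using x0 by (simp flip: Nm_mult)
    then have "bij_betw (\<lambda>z. inverse x *s z) {z\<in>S. h z z = c} {z\<in>S. h z z = 1}"
      using x0 x S
      by (intro bij_betw_byWitness[where f' = "\<lambda>z. x *s z"])
         (auto simp: hs vector_smult_assoc)
    then show ?thesis by (rule bij_betw_same_card)
  qed
  show "c \<in> fixed_field \<Longrightarrow> c \<noteq> 0 \<Longrightarrow> card {z\<in>S. h z z = c} = card {z\<in>S. h z z = 1}" by (rule eq)
  have "card S = (\<Sum>c\<in>fixed_field. card {z\<in>S. h z z = c})"
    by (rule card_sum_fibers) auto
  also have "\<dots> = card {z\<in>S. h z z = 0} + (\<Sum>c\<in>fixed_field - {0}. card {z\<in>S. h z z = c})"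
    by (rule sum.remove) auto
  also have "(\<Sum>c\<in>fixed_field - {0}. card {z\<in>S. h z z = c}) = (\<Sum>c\<in>fixed_field - {0}. card {z\<in>S. h z z = 1})"
    by (rule sum.cong) (auto intro: eq)
  finally show "card S = card {z\<in>S. h z z = 0} + (q - 1) * card {z\<in>S. h z z = 1}"
    by (simp add: card_fixed_field)
qed

section \<open>Adjacency in terms of the form\<close>

definition isotropic_points :: "('a ^ 'n) set set" where
  "isotropic_points = {vec.span {x} |x. x \<noteq> 0 \<and> h x x = 0}"

abbreviation G :: "('a ^ 'n) set pair_pre_digraph" where "G \<equiv> NU isotropic_points"

abbreviation pt :: "'a ^ 'n \<Rightarrow> ('a ^ 'n) set" where "pt x \<equiv> vec.span {x}"

lemma absolute_points_eq:
  assumes "\<And>U. vec.subspace U \<Longrightarrow> \<rho> U = {x. \<forall>u\<in>U. h x u = 0}"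
  shows "absolute_points \<rho> = isotropic_points"
proof -
  have "X \<subseteq> \<rho> X \<longleftrightarrow> h x x = 0" if "X = pt x" for X x
  proof -
    have "\<rho> X = {x. \<forall>u\<in>X. h x u = 0}" using assms[of X] that vec.subspace_span by simp
    then have "X \<subseteq> \<rho> X \<longleftrightarrow> (\<forall>a b. h (a *s x) (b *s x) = 0)"
      using that by (auto simp: vec.span_singleton)
    also have "\<dots> \<longleftrightarrow> h x x = 0"
      by (metis vec.scale_one h_scale_left h_scale_right mult_zero_right)
    finally show ?thesis .
  qed
  then show ?thesis unfolding absolute_points_def isotropic_points_def is_point_iff by blast
qed

lemma pt_isotropic_iff: "x \<noteq> 0 \<Longrightarrow> pt x \<in> isotropic_points \<longleftrightarrow> h x x = 0"
  by (auto simp: isotropic_points_def h_simps elim!: span_singleton_eqE)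

text \<open>
  Norms reach the inverse of \<open>h x x\<close>, so every non-isotropic vector can be scaled to a unit
  vector.
\<close>
lemma normalize:
  assumes "h x x \<noteq> 0"
  obtains c where "c \<noteq> 0" "Nm c * h x x = 1" "h (c *s x) (c *s x) = 1"
proof -
  have "inverse (h x x) \<in> fixed_field" using h_self_fixed_field[of x] by (simp add: fixed_field_iff cj_simps)
  then obtain c where c: "Nm c = inverse (h x x)" by (rule Nm_surj)
  then have "c \<noteq> 0" "Nm c * h x x = 1" using assms by auto
  moreover have "h (c *s x) (c *s x) = 1"
    using \<open>Nm c * h x x = 1\<close> unfolding h_scale_left h_scale_right Nm_def by (simp only: mult_ac)
  ultimately show ?thesis using that by blast
qed

lemma vertex_iff: "X \<in> pverts G \<longleftrightarrow> (\<exists>x. h x x = 1 \<and> X = pt x)"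
proof
  assume "X \<in> pverts G"
  then obtain x where x: "x \<noteq> 0" "X = pt x" "X \<notin> isotropic_points" by (auto simp: NU_def is_point_iff)
  then have "h x x \<noteq> 0" using pt_isotropic_iff by blast
  then obtain c where "c \<noteq> 0" "h (c *s x) (c *s x) = 1" by (rule normalize)
  then show "\<exists>x. h x x = 1 \<and> X = pt x" using x span_scale_singleton by metis
next
  assume "\<exists>x. h x x = 1 \<and> X = pt x"
  then obtain x where x: "h x x = 1" "X = pt x" by blast
  then have "x \<noteq> 0" by auto
  then show "X \<in> pverts G" using x pt_isotropic_iff by (auto simp: NU_def is_point_iff)
qed

lemma pt_vertex_iff: "pt x \<in> pverts G \<longleftrightarrow> h x x \<noteq> 0"
proof -
  have "pt 0 \<notin> pverts G" by (auto simp: NU_def is_point_def)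
  then show ?thesis using pt_isotropic_iff[of x] by (cases "x = 0") (auto simp: NU_def is_point_iff)
qed

lemma pt_neq_iff_lin_indep:
  assumes "x \<noteq> 0" "y \<noteq> 0"
  shows "pt x \<noteq> pt y \<longleftrightarrow> lin_indep [x, y]"
proof
  assume ne: "pt x \<noteq> pt y"
  have "x \<notin> pt y"
  proof
    assume "x \<in> pt y"
    then obtain c where c: "x = c *s y" by (auto simp: vec.span_singleton)
    then have "c \<noteq> 0" using assms(1) by auto
    then show False using ne c span_scale_singleton[of c y] by simp
  qed
  then show "lin_indep [x, y]" using assms(2) by (simp add: lin_indep_Cons)
next
  assume "lin_indep [x, y]"
  then have "x \<notin> pt y" by (simp add: lin_indep_Cons)
  then show "pt x \<noteq> pt y" using vec.span_base[of x "{x}"] by auto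
qed

text \<open>
  Completing the square.
\<close>
lemma isotropic_on_line:
  assumes "h x x = 1"
  shows "h (y + a *s x) (y + a *s x) = h y y - Nm (h y x) + Nm (a + h y x)"
proof -
  have "Nm (a + h y x) = Nm a + Nm (h y x) + Tr (cj (cj a * h y x))"
    by (simp add: Nm_add cj_simps)
  then show ?thesis by (simp add: h_self_add_scale assms)
qed

text \<open>
  The isotropic points of the line are \<open>pt (y + a *s x)\<close> for the solutions \<open>a\<close> of
  \<open>Nm (a + h y x) = Nm (h y x) - 1\<close>. There is exactly one solution if the right-hand side is
  \<open>0\<close>, and there are \<open>q + 1\<close> otherwise.
\<close>
lemma tangent_iff:
  assumes x: "h x x = 1" and y: "h y y = 1" and ind: "lin_indep [x, y]"
  shows "tangent_line isotropic_points (vec.span {x, y}) \<longleftrightarrow> Nm (h x y) = 1"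
proof -
  let ?L = "vec.span {x, y}" and ?c = "h y x" and ?d = "Nm (h y x) - 1"
  let ?P = "\<lambda>a. pt (y + a *s x)"
  have x0: "x \<noteq> 0" using x by auto
  have nz: "y + a *s x \<noteq> 0" for a
  proof
    assume "y + a *s x = 0"
    then have "y = (- a) *s x" by (simp add: eq_neg_iff_add_eq_0)
    then have "y \<in> vec.span {x}" by (metis vec.span_base vec.span_scale insertI1)
    then show False using ind lin_indep_Cons[of y "[x]"] by (auto simp: lin_indep_def insert_commute)
  qed
  have iso: "h (y + a *s x) (y + a *s x) = 0 \<longleftrightarrow> Nm (a + ?c) = ?d" for a
    unfolding isotropic_on_line[OF x] y by (auto simp: algebra_simps)
  \<comment> \<open>Distinct parameters give distinct points, as \<open>x\<close> and \<open>y\<close> are independent.\<close>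
  have inj: "a = b" if "?P a = ?P b" for a b
  proof -
    obtain k where "y + b *s x = k *s (y + a *s x)" using \<open>?P a = ?P b\<close> by (rule span_singleton_eqE)
    then have "(1 - k) *s y + (b - k * a) *s x = 0"
      by (simp add: vec.scale_right_distrib vec.scale_left_diff_distrib vector_smult_assoc algebra_simps)
    moreover have "\<And>u v. u *s y + v *s x = 0 \<Longrightarrow> u = 0 \<and> v = 0"
    proof -
      fix u v assume e: "u *s y + v *s x = 0"
      have "u = 0"
      proof (rule ccontr)
        assume "u \<noteq> 0"
        then have "y + (v / u) *s x = inverse u *s (u *s y + v *s x)"
          by (simp add: vec.scale_right_distrib vector_smult_assoc field_simps)
        then show False using nz[of "v / u"] e by simp
      qed
      then show "u = 0 \<and> v = 0" using e x0 by simp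
    qed
    ultimately have "1 - k = 0" "b - k * a = 0" by blast+
    then show ?thesis by simp
  qed
  have pts: "points_of ?L \<inter> isotropic_points = ?P ` {a. Nm (a + ?c) = ?d}"
  proof (intro equalityI subsetI)
    fix X assume X: "X \<in> points_of ?L \<inter> isotropic_points"
    then obtain w where w: "w \<noteq> 0" "h w w = 0" "X = pt w" by (auto simp: isotropic_points_def)
    then have "w \<in> ?L" using X vec.span_base[of w "{w}"] by (auto simp: points_of_def)
    then obtain u v where uv: "w = u *s x + v *s y" by (auto simp: in_span_pair)
    have "v \<noteq> 0"
    proof
      assume "v = 0"
      then show False using w uv x by (auto simp: h_simps)
    qed
    then have e: "w = v *s (y + (u / v) *s x)"
      by (simp add: uv vec.scale_right_distrib vector_smult_assoc add.commute)
    then have X: "X = ?P (u / v)" using w(3) \<open>v \<noteq> 0\<close> span_scale_singleton by metis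
    moreover have "h (y + (u / v) *s x) (y + (u / v) *s x) = 0"
      using X w(2,3) pt_isotropic_iff[OF nz] pt_isotropic_iff[OF w(1)] by simp
    ultimately show "X \<in> ?P ` {a. Nm (a + ?c) = ?d}" using iso by blast
  next
    fix X assume "X \<in> ?P ` {a. Nm (a + ?c) = ?d}"
    then obtain a where a: "X = ?P a" "Nm (a + ?c) = ?d" by blast
    have "y + a *s x \<in> ?L" unfolding in_span_pair by (rule exI[of _ a], rule exI[of _ 1]) (simp add: add.commute)
    then have "X \<subseteq> ?L" unfolding a(1) by (intro vec.span_minimal) auto
    moreover have "is_point X" using a nz by (auto simp: is_point_iff)
    moreover have "X \<in> isotropic_points" using a iso nz by (auto simp: pt_isotropic_iff)
    ultimately show "X \<in> points_of ?L \<inter> isotropic_points" by (simp add: points_of_def)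
  qed
  have "(\<exists>!X. X \<in> points_of ?L \<inter> isotropic_points) \<longleftrightarrow> ?d = 0"
  proof
    assume "?d = 0"
    then have "{a. Nm (a + ?c) = ?d} = {- ?c}" by (auto simp: eq_neg_iff_add_eq_0)
    then show "\<exists>!X. X \<in> points_of ?L \<inter> isotropic_points" unfolding pts by auto
  next
    assume ex1: "\<exists>!X. X \<in> points_of ?L \<inter> isotropic_points"
    show "?d = 0"
    proof (rule ccontr)
      assume d: "?d \<noteq> 0"
      have "?d \<in> fixed_field" using Nm_in_fixed_field[of ?c] by (simp add: fixed_field_iff cj_simps)
      then have "card {b. Nm b = ?d} = q + 1" using d by (rule card_Nm_eq)
      then have "card {b. Nm b = ?d} \<ge> 2" using q_ge_2 by simp
      then obtain b1 b2 where b: "Nm b1 = ?d" "Nm b2 = ?d" "b1 \<noteq> b2"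
        using card_le_Suc0_iff_eq[of "{b. Nm b = ?d}"] by auto
      have "?P (b1 - ?c) \<in> points_of ?L \<inter> isotropic_points" "?P (b2 - ?c) \<in> points_of ?L \<inter> isotropic_points"
        unfolding pts by (intro image_eqI[OF refl]; simp add: b)+
      then have "?P (b1 - ?c) = ?P (b2 - ?c)" using ex1 by metis
      then have "b1 - ?c = b2 - ?c" by (rule inj)
      then show False using b by simp
    qed
  qed
  moreover have "?d = 0 \<longleftrightarrow> Nm (h x y) = 1" by (simp add: h_flip[of x y])
  ultimately show ?thesis using is_line_span[OF ind] by (simp add: tangent_line_def)
qed

lemma adjacent_unit_iff:
  assumes "h x x = 1" "h y y = 1"
  shows "pt y \<in> nbrs G (pt x) \<longleftrightarrow> pt x \<noteq> pt y \<and> Nm (h x y) = 1"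
proof -
  have nz: "x \<noteq> 0" "y \<noteq> 0" using assms by auto
  have j: "join (pt x) (pt y) = vec.span {x, y}"
    unfolding join_def vec.span_eq
    using vec.span_mono[of "{x}" "{x, y}"] vec.span_mono[of "{y}" "{x, y}"]
    by (auto intro!: vec.span_base)
  have "pt x \<in> {X. is_point X} - isotropic_points" "pt y \<in> {X. is_point X} - isotropic_points"
    using assms pt_vertex_iff[of x] pt_vertex_iff[of y] by (simp_all add: NU_def)
  then show ?thesis
    using tangent_iff[OF assms] pt_neq_iff_lin_indep[OF nz] by (auto simp: nbrs_def NU_def j)
qed

lemma adjacent_iff:
  assumes "h x x \<noteq> 0" "h y y \<noteq> 0"
  shows "pt y \<in> nbrs G (pt x) \<longleftrightarrow> pt x \<noteq> pt y \<and> Nm (h x y) = h x x * h y y"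
proof -
  obtain c where c: "c \<noteq> 0" "Nm c * h x x = 1" "h (c *s x) (c *s x) = 1"
    using assms(1) by (rule normalize)
  obtain d where d: "d \<noteq> 0" "Nm d * h y y = 1" "h (d *s y) (d *s y) = 1"
    using assms(2) by (rule normalize)
  have "pt (d *s y) \<in> nbrs G (pt (c *s x)) \<longleftrightarrow>
      pt (c *s x) \<noteq> pt (d *s y) \<and> Nm (h (c *s x) (d *s y)) = 1"
    using c(3) d(3) by (rule adjacent_unit_iff)
  also have "Nm (h (c *s x) (d *s y)) = Nm c * Nm d * Nm (h x y)"
    by (simp add: h_simps Nm_mult)
  also have "\<dots> = 1 \<longleftrightarrow> Nm (h x y) = h x x * h y y"
  proof -
    have "Nm c = 1 / h x x" "Nm d = 1 / h y y" using c(2) d(2) assms by (simp_all add: field_simps)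
    show ?thesis unfolding \<open>Nm c = _\<close> \<open>Nm d = _\<close> using assms by (simp add: field_simps)
  qed
  finally show ?thesis by (simp only: span_scale_singleton[OF c(1)] span_scale_singleton[OF d(1)])
qed

lemma nbrs_sym: "Y \<in> nbrs G X \<longleftrightarrow> X \<in> nbrs G Y"
  by (auto simp: nbrs_def NU_def join_commute)

lemma nbrs_vertex: "Y \<in> nbrs G X \<Longrightarrow> X \<in> pverts G \<and> Y \<in> pverts G"
  by (auto simp: nbrs_def NU_def)

lemma not_self_nbr: "X \<notin> nbrs G X"
  by (auto simp: nbrs_def NU_def)

lemma pt_add_eqD:
  assumes "h v v = 1" "h z v = 0" "h z' v = 0" "pt (v + z) = pt (v + z')"
  shows "z = z'"
proof -
  obtain c where c: "v + z' = c *s (v + z)" using assms(4) by (rule span_singleton_eqE)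
  have "h (v + z') v = c * h (v + z) v" unfolding c by (rule h_scale_left)
  then have "c = 1" using assms by (simp add: h_simps)
  then show ?thesis using c by simp
qed

end

section \<open>Isotropic vectors with prescribed products\<close>

text \<open>
  The bound on the dimension makes all exponents in the counts below nonnegative.
\<close>
locale unitary_space_dim5 = unitary_space q h
  for q :: nat and h :: "'a::{field,finite} ^ 'n \<Rightarrow> 'a ^ 'n \<Rightarrow> 'a" +
  assumes dim_ge_5: "CARD('n) \<ge> 5"

begin

text \<open>
  A common factor of the counts below: four prescribed products together with a prescribed
  value of the form leave exactly this many vectors. Fewer conditions leave a power of \<open>q\<close>
  times as many.
\<close>
definition E :: nat where "E = q ^ (2 * CARD('n) - 9)"

lemma E_pos [simp]: "E > 0"
  using q_ge_2 by (simp add: E_def)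

lemma card_vectors_E: "q ^ (2 * CARD('n)) = q ^ 9 * E"
  using dim_ge_5 by (simp add: E_def flip: power_add)

lemma cancel_q_power: "a * q ^ k = b * q ^ k \<longleftrightarrow> a = (b::nat)"
  using q_ge_2 by simp

lemma card_eq_from_product:
  assumes "m * q ^ i = q ^ (2 * CARD('n))" "i + j = 9"
  shows "m = q ^ j * E"
proof -
  have "m * q ^ i = q ^ j * E * q ^ i"
    using assms(1) unfolding card_vectors_E assms(2)[symmetric] by (simp only: power_add mult_ac)
  then show ?thesis using cancel_q_power by blast
qed

lemma card_perp1: "v \<noteq> 0 \<Longrightarrow> card {z. h z v = 0} = q ^ 7 * E"
  using card_prescribed_products[of "[v]" "[0]"]
  by (intro card_eq_from_product[where i = 2]) (simp_all add: lin_indep_Cons numeral_2_eq_2)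

lemma card_prescribed3:
  "lin_indep [a, b, c] \<Longrightarrow> card {z. h z a = x \<and> h z b = y \<and> h z c = w} = q ^ 3 * E"
  using card_prescribed_products[of "[a, b, c]" "[x, y, w]"]
  by (intro card_eq_from_product[where i = 6]) simp_all

lemma card_isotropic2:
  assumes "lin_indep [r, a]" "h r r = 0" "h r a = 0" "\<beta> \<noteq> 0" "c \<in> fixed_field"
  shows "card {w. h w w = c \<and> h w r = \<beta> \<and> h w a = x} = q ^ 4 * E"
  using card_isotropic_prescribed[of r "[a]" "[x]" \<beta> c] assms
  by (intro card_eq_from_product[where i = 5]) simp_all

lemma card_isotropic3:
  assumes "lin_indep [r, a, b]" "h r r = 0" "h r a = 0" "h r b = 0" "\<beta> \<noteq> 0" "c \<in> fixed_field"
  shows "card {w. h w w = c \<and> h w r = \<beta> \<and> h w a = x \<and> h w b = y} = q ^ 2 * E"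
  using card_isotropic_prescribed[of r "[a, b]" "[x, y]" \<beta> c] assms
  by (intro card_eq_from_product[where i = 7]) simp_all

lemma card_isotropic4:
  assumes "lin_indep [r, a, b, d]" "h r r = 0" "h r a = 0" "h r b = 0" "h r d = 0" "\<beta> \<noteq> 0" "c \<in> fixed_field"
  shows "card {w. h w w = c \<and> h w r = \<beta> \<and> h w a = x \<and> h w b = y \<and> h w d = z} = E"
  using card_isotropic_prescribed[of r "[a, b, d]" "[x, y, z]" \<beta> c] assms
    card_eq_from_product[where i = 9 and j = 0] by simp

definition isotropic_perp :: "'a ^ 'n \<Rightarrow> ('a ^ 'n) set" where "isotropic_perp v = {z. h z v = 0 \<and> h z z = 0}"

text \<open>
  Sorting the isotropic vectors \<open>w\<close> by \<open>a = h w v\<close>: subtracting \<open>a *s v\<close> leaves a vector of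
  \<open>v\<^sup>\<bottom>\<close> on which the form is \<open>- Nm a\<close>, and the nonzero values of the form on \<open>v\<^sup>\<bottom>\<close> are
  equally frequent. The left summand is therefore determined by the number of all isotropic
  vectors.
\<close>
lemma card_isotropic_perp_eq:
  assumes v: "h v v = 1"
  shows "q * card (isotropic_perp v) + card {w. h w w = 0} = (q + 1) * (q ^ 7 * E)"
proof -
  have v0: "v \<noteq> 0" using v by auto
  let ?V = "{z. h z v = 0}"
  note cone = card_cone[of ?V]
  let ?Y = "card {z\<in>?V. h z z = 1}"
  have X: "card (isotropic_perp v) = card {z\<in>?V. h z z = 0}" by (simp add: isotropic_perp_def)
  have fib: "card {w\<in>{w. h w w = 0}. h w v = a} = card {z\<in>?V. h z z = - Nm a}" for a
  proof -
    define b where "b = - a"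
    have hv: "h (w + s *s v) v = h w v + s" for w s by (simp add: h_simps v)
    have "Nm b + Tr (cj b * a) = - Nm a" "b + a = 0" "a + b = 0"
      by (simp_all add: b_def Nm_def Tr_def cj_simps)
    then have "bij_betw (\<lambda>w. w + b *s v) {w\<in>{w. h w w = 0}. h w v = a} {z\<in>?V. h z z = - Nm a}"
      by (intro bij_betw_byWitness[where f' = "\<lambda>z. z + a *s v"])
        (auto simp: h_self_add_scale hv v add.assoc simp flip: vec.scale_left_distrib)
    then show ?thesis by (rule bij_betw_same_card)
  qed
  have "card {w. h w w = 0} = (\<Sum>a\<in>UNIV. card {w\<in>{w. h w w = 0}. h w v = a})"
    by (rule card_sum_fibers) auto
  also have "\<dots> = card (isotropic_perp v) + (\<Sum>a\<in>UNIV - {0::'a}. ?Y)"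
    unfolding fib X
  proof (subst sum.remove[of _ 0], goal_cases)
    case 3
    have "card {z\<in>?V. h z z = - Nm a} = ?Y" if "a \<noteq> 0" for a
      by (rule cone(1)) (use that in \<open>auto simp: h_simps fixed_field_iff cj_simps Nm_def\<close>)
    then show ?case by (simp add: Nm_0)
  qed auto
  also have "\<dots> = card (isotropic_perp v) + (q ^ 2 - 1) * ?Y"
    by (simp add: card_field)
  finally have Z: "card {w. h w w = 0} = card (isotropic_perp v) + (q ^ 2 - 1) * ?Y" .
  have "card ?V = card (isotropic_perp v) + (q - 1) * ?Y"
    unfolding X by (rule cone(2)) (auto simp: h_simps)
  then have S: "card (isotropic_perp v) + (q - 1) * ?Y = q ^ 7 * E"
    using card_perp1[OF v0] by simp
  have "q ^ 2 - 1 = (q + 1) * (q - 1)" by (simp add: power2_eq_square algebra_simps)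
  then show ?thesis unfolding Z S[symmetric] by (simp add: algebra_simps)
qed

text \<open>
  The identity above stands in for Witt's theorem: it determines the number without
  computing it.
\<close>
lemma card_isotropic_perp_const: "h v v = 1 \<Longrightarrow> h u u = 1 \<Longrightarrow> card (isotropic_perp v) = card (isotropic_perp u)"
proof -
  assume "h v v = 1" "h u u = 1"
  then have "q * card (isotropic_perp v) = q * card (isotropic_perp u)"
    using card_isotropic_perp_eq[of v] card_isotropic_perp_eq[of u] by linarith
  then show ?thesis using q_ge_2 by simp
qed

text \<open>
  Every fibre of \<open>z \<mapsto> h z a\<close> over a nonzero value has \<open>q ^ 4 * E\<close> elements. The fibre over
  \<open>0\<close> is eliminated by comparing with the set of all isotropic vectors of \<open>v\<^sup>\<bottom>\<close>.
\<close>
lemma card_triangle_collinear: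
  assumes v: "h v v = 1" and a: "a \<in> isotropic_perp v" "a \<noteq> 0" and t: "t \<noteq> 0" "t \<noteq> 1"
  shows "int (card {z\<in>isotropic_perp v. h z a \<in> K \<and> h z (t *s a) \<in> K}) + (int q ^ 2 - 1) * (int q ^ 4 * int E)
    = int (card (isotropic_perp v)) + (if t \<in> fixed_field then 0 else int q ^ 4 * int E)"
proof -
  have ha: "h a v = 0" "h a a = 0" using a(1) by (simp_all add: isotropic_perp_def)
  have "v \<notin> vec.span {a}" by (rule not_in_span[where w = v]) (use ha v in auto)
  then have ind: "lin_indep [a, v]"
    using a(2) lin_indep_rotate[of "[a]" v] by (simp add: lin_indep_Cons)
  have fib: "card {z\<in>isotropic_perp v. h z a = b} = q ^ 4 * E" if "b \<noteq> 0" for b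
    using card_isotropic2[OF ind ha(2,1) that, of 0 0] by (simp add: isotropic_perp_def conj_ac)
  have all: "int (card (isotropic_perp v)) = int (card {z\<in>isotropic_perp v. h z a = 0}) + (int q ^ 2 - 1) * (int q ^ 4 * int E)"
    using card_values_in_off[of "isotropic_perp v" UNIV 0 "\<lambda>z. h z a" "q ^ 4 * E"] fib
    by (simp add: card_field)
  let ?T = "{b\<in>K. cj t * b \<in> K}"
  have "int (card {z\<in>isotropic_perp v. h z a \<in> ?T}) = int (card {z\<in>isotropic_perp v. h z a = 0}) + (int (card ?T) - 1) * int (q ^ 4 * E)"
    by (rule card_values_in_off) (use fib in auto)
  moreover have "{z\<in>isotropic_perp v. h z a \<in> ?T} = {z\<in>isotropic_perp v. h z a \<in> K \<and> h z (t *s a) \<in> K}"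
    by (auto simp: h_simps)
  ultimately show ?thesis using all card_K_scaled[OF t] by (simp split: if_splits)
qed

text \<open>
  The same elimination for pairs of products: every fibre over a pair other than \<open>(0, 0)\<close>
  has \<open>q ^ 2 * E\<close> elements.
\<close>
lemma card_triangle_isotropic_plane:
  assumes v: "h v v = 1" and ab: "a \<in> isotropic_perp v" "b \<in> isotropic_perp v" "h a b = 0" and ind: "lin_indep [a, b]"
  shows "int (card {z\<in>isotropic_perp v. h z a \<in> K \<and> h z b \<in> K}) + (int q ^ 4 - 1) * (int q ^ 2 * int E)
    = int (card (isotropic_perp v)) + (int q ^ 2 + 2 * int q) * (int q ^ 2 * int E)"
proof -
  have ha: "h a v = 0" "h a a = 0" "h b v = 0" "h b b = 0" "h b a = 0"
    using ab h_eq_0_commute[of a b] by (simp_all add: isotropic_perp_def)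
  have "v \<notin> vec.span {a, b}" by (rule not_in_span[where w = v]) (use ha v in auto)
  then have "lin_indep [v, a, b]" using ind by (simp add: lin_indep_Cons)
  then have ind1: "lin_indep [a, b, v]" and ind2: "lin_indep [b, a, v]"
    by (auto simp: lin_indep_def insert_commute)
  have fib: "card {z\<in>isotropic_perp v. (h z a, h z b) = p} = q ^ 2 * E" if "p \<noteq> (0, 0)" for p
  proof (cases p)
    case (Pair x y)
    show ?thesis
    proof (cases "x = 0")
      case True
      then show ?thesis
        using card_isotropic3[OF ind2, of y 0 x 0] ha that Pair by (simp add: isotropic_perp_def conj_ac)
    next
      case False
      then show ?thesis
        using card_isotropic3[OF ind1, of x 0 y 0] ha ab Pair by (simp add: isotropic_perp_def conj_ac)
    qed
  qed
  have "int (card {z\<in>isotropic_perp v. (h z a, h z b) \<in> UNIV}) = int (card {z\<in>isotropic_perp v. (h z a, h z b) = (0, 0)})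
      + (int CARD('a \<times> 'a) - 1) * int (q ^ 2 * E)"
    by (rule card_values_in_off) (use fib in auto)
  moreover have "int CARD('a \<times> 'a) = int q ^ 4" by (simp add: card_field flip: power_add)
  moreover have "int (card {z\<in>isotropic_perp v. (h z a, h z b) \<in> K \<times> K}) = int (card {z\<in>isotropic_perp v. (h z a, h z b) = (0, 0)})
      + (int (card (K \<times> K)) - 1) * int (q ^ 2 * E)"
    by (rule card_values_in_off) (use fib in auto)
  moreover have "int (card (K \<times> K)) - 1 = int q ^ 2 + 2 * int q"
    by (simp add: card_cartesian_product card_K power2_eq_square algebra_simps)
  ultimately show ?thesis by (simp del: card_prod)
qed

text \<open>
  If \<open>h a b \<noteq> 0\<close> then \<open>a\<close> and \<open>b\<close> span a complement of \<open>{v, a, b}\<^sup>\<bottom>\<close> in \<open>v\<^sup>\<bottom>\<close>. The part of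
  \<open>z\<close> in this plane is determined by the two products, with the trace as the value of the
  form, so the remaining part must have the opposite value.
\<close>
lemma card_hyperbolic_values:
  assumes v: "h v v = 1" and ab: "a \<in> isotropic_perp v" "b \<in> isotropic_perp v" "h a b \<noteq> 0"
  defines "Zs \<equiv> \<lambda>i. card {z. h z v = 0 \<and> h z a = 0 \<and> h z b = 0 \<and> h z z = i}"
  shows "Zs 0 + (q - 1) * Zs 1 = q ^ 3 * E"
    and "card {z\<in>isotropic_perp v. (h z a, h z b) \<in> T} =
      card {p\<in>T. Tr (snd p * cj (fst p) / h a b) = 0} * Zs 0 +
      card {p\<in>T. Tr (snd p * cj (fst p) / h a b) \<noteq> 0} * Zs 1"
proof -
  let ?k = "h a b"
  let ?S = "{z. h z v = 0 \<and> h z a = 0 \<and> h z b = 0}"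
  have ha: "h a v = 0" "h a a = 0" "h b v = 0" "h b b = 0" "h b a = cj ?k"
    using ab h_flip[of b a] by (simp_all add: isotropic_perp_def)
  have Zs: "Zs i = card {z\<in>?S. h z z = i}" for i by (simp add: Zs_def)
  have cone: "c *s z \<in> ?S" if "z \<in> ?S" for c z using that by (simp add: h_simps)
  have "v \<notin> vec.span {a, b}" by (rule not_in_span[where w = v]) (use ha v in auto)
  moreover have "a \<notin> vec.span {b}" by (rule not_in_span[where w = b]) (use ha ab in auto)
  moreover have "b \<noteq> 0" using ab by auto
  ultimately have "lin_indep [v, a, b]" by (simp add: lin_indep_Cons)
  then have "card ?S = q ^ 3 * E" by (rule card_prescribed3)
  then show "Zs 0 + (q - 1) * Zs 1 = q ^ 3 * E"
    using card_cone(2)[of ?S, OF cone] by (simp only: Zs)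
  have fib: "card {z\<in>isotropic_perp v. (h z a, h z b) = p} =
      (if Tr (snd p * cj (fst p) / ?k) = 0 then Zs 0 else Zs 1)" for p
  proof (cases p)
    case (Pair x y)
    \<comment> \<open>The vector of the plane spanned by \<open>a\<close> and \<open>b\<close> that has the prescribed products.\<close>
    define u where "u = (y / ?k) *s a + (x / cj ?k) *s b"
    define d where "d = Tr (y * cj x / ?k)"
    have k0: "cj ?k \<noteq> 0" using ab by simp
    have hu: "h u v = 0" "h u a = x" "h u b = y"
      using ab(3) k0 by (simp_all add: u_def h_simps ha)
    have huu: "h u u = d"
      using ab(3) k0 by (simp add: u_def h_simps ha d_def Tr_def cj_simps field_simps)
    have huz: "h u z = 0" if "z \<in> ?S" for z
      using that h_eq_0_commute[of z] by (simp add: u_def h_simps)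
    have dz: "h z u = 0" if "z \<in> ?S" for z
      using huz[OF that] h_eq_0_commute by blast
    have "bij_betw (\<lambda>z. z - u) {z\<in>isotropic_perp v. (h z a, h z b) = p} {z\<in>?S. h z z = - d}"
    proof (rule bij_betw_byWitness[where f' = "\<lambda>z. z + u"])
      show "(\<lambda>z. z - u) ` {z\<in>isotropic_perp v. (h z a, h z b) = p} \<subseteq> {z\<in>?S. h z z = - d}"
      proof safe
        fix z assume z: "z \<in> isotropic_perp v" "p = (h z a, h z b)"
        then have S: "z - u \<in> ?S" using hu Pair by (simp add: h_simps isotropic_perp_def)
        then show "h (z - u) v = 0" "h (z - u) a = 0" "h (z - u) b = 0" by simp_all
        have "h z z = h ((z - u) + u) ((z - u) + u)" by simp
        also have "\<dots> = h (z - u) (z - u) + d"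
          unfolding h_add_left h_add_right using huz[OF S] dz[OF S] huu by simp
        finally show "h (z - u) (z - u) = - d" using z by (simp add: isotropic_perp_def eq_neg_iff_add_eq_0)
      qed
      show "(\<lambda>z. z + u) ` {z\<in>?S. h z z = - d} \<subseteq> {z\<in>isotropic_perp v. (h z a, h z b) = p}"
      proof
        fix y assume "y \<in> (\<lambda>z. z + u) ` {z\<in>?S. h z z = - d}"
        then obtain z where y: "y = z + u" and S: "z \<in> ?S" and z: "h z z = - d" by blast
        have "h y y = 0" unfolding y h_add_left h_add_right using huz[OF S] dz[OF S] huu z by simp
        moreover have "h y v = 0" "(h y a, h y b) = p" using S hu Pair by (auto simp: y h_add_left)
        ultimately show "y \<in> {z\<in>isotropic_perp v. (h z a, h z b) = p}" by (simp add: isotropic_perp_def)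
      qed
    qed auto
    then have "card {z\<in>isotropic_perp v. (h z a, h z b) = p} = card {z\<in>?S. h z z = - d}"
      by (rule bij_betw_same_card)
    also have "\<dots> = (if d = 0 then Zs 0 else Zs 1)"
    proof (cases "d = 0")
      case False
      have "- d \<in> fixed_field" using Tr_in_fixed_field[of "y * cj x / ?k"] by (simp add: d_def fixed_field_iff cj_simps)
      then show ?thesis using False card_cone(1)[of ?S "- d", OF cone] by (simp add: Zs)
    qed (simp add: Zs)
    finally show ?thesis by (simp add: Pair d_def)
  qed
  let ?z = "\<lambda>p. Tr (snd p * cj (fst p) / ?k) = 0"
  have "card {z\<in>isotropic_perp v. (h z a, h z b) \<in> T} = (\<Sum>p\<in>T. if ?z p then Zs 0 else Zs 1)"
    using card_values_in[of "isotropic_perp v" T "\<lambda>z. (h z a, h z b)"] by (simp add: fib)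
  also have "\<dots> = card {p\<in>T. ?z p} * Zs 0 + card {p\<in>T. \<not> ?z p} * Zs 1"
    by (subst sum.If_cases) (auto simp: Int_def Collect_conj_eq[symmetric] Compl_eq)
  finally show "card {z\<in>isotropic_perp v. (h z a, h z b) \<in> T} =
      card {p\<in>T. ?z p} * Zs 0 + card {p\<in>T. \<not> ?z p} * Zs 1" .
qed

text \<open>
  The two unknowns \<open>z0\<close> and \<open>z1\<close>, the numbers of vectors of \<open>{v, a, b}\<^sup>\<bottom>\<close> on which the form
  is \<open>0\<close> and \<open>1\<close>, are determined by the first two equations: the second one is the count of
  all isotropic vectors of \<open>v\<^sup>\<bottom>\<close>, sorted by their products with \<open>a\<close> and \<open>b\<close>.
\<close>
lemma hyperbolic_complement:
  assumes v: "h v v = 1" and ab: "a \<in> isotropic_perp v" "b \<in> isotropic_perp v" "h a b \<noteq> 0"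
  obtains z0 z1 :: int where "z0 + (int q - 1) * z1 = int q ^ 3 * int E"
    and "int (card (isotropic_perp v)) = int q ^ 2 * z0 + int q * (int q ^ 2 - 1) * (int q ^ 3 * int E)"
    and "int (card {z\<in>isotropic_perp v. h z a \<in> K \<and> h z b \<in> K}) =
      int (card {p\<in>K \<times> K. Tr (snd p * cj (fst p) / h a b) = 0}) * z0
      + ((int q + 1) ^ 2 - int (card {p\<in>K \<times> K. Tr (snd p * cj (fst p) / h a b) = 0})) * z1"
proof -
  define Zs where "Zs i = card {z. h z v = 0 \<and> h z a = 0 \<and> h z b = 0 \<and> h z z = i}" for i
  note hyp = card_hyperbolic_values[OF v ab, folded Zs_def]
  let ?c = "\<lambda>T. card {p\<in>T. Tr (snd p * cj (fst p) / h a b) = 0}"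
  have cT: "int (card {z\<in>isotropic_perp v. (h z a, h z b) \<in> T}) =
      int (?c T) * int (Zs 0) + (int (card T) - int (?c T)) * int (Zs 1)" for T
    unfolding hyp(2)[of T] by (simp add: card_filter_not)
  have q1: "int (q - 1) = int q - 1" and q2: "int (q ^ 2 - 1) = int q ^ 2 - 1"
    using q_ge_2 by (simp_all add: of_nat_diff)
  have e1: "int (Zs 0) + (int q - 1) * int (Zs 1) = int q ^ 3 * int E"
    using arg_cong[OF hyp(1), of int] q1 by simp
  have "int (?c UNIV) = int q ^ 2 + (int q ^ 2 - 1) * int q"
    using card_Tr_zeros[OF ab(3)] q2 by simp
  moreover have "int (card (UNIV :: ('a \<times> 'a) set)) = int q ^ 4"
    by (simp add: card_field flip: power_add)
  ultimately have "int (card (isotropic_perp v)) = (int q ^ 2 + (int q ^ 2 - 1) * int q) * int (Zs 0)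
      + (int q ^ 4 - (int q ^ 2 + (int q ^ 2 - 1) * int q)) * int (Zs 1)"
    using cT[of UNIV] by simp
  also have "\<dots> = int q ^ 2 * int (Zs 0) + int q * (int q ^ 2 - 1) * (int (Zs 0) + (int q - 1) * int (Zs 1))"
    by (simp add: algebra_simps power2_eq_square power4_eq_xxxx)
  finally have e2: "int (card (isotropic_perp v)) = int q ^ 2 * int (Zs 0) + int q * (int q ^ 2 - 1) * (int q ^ 3 * int E)"
    unfolding e1 .
  have "int (card (K \<times> K)) = (int q + 1) ^ 2"
    by (simp add: card_cartesian_product card_K power2_eq_square algebra_simps)
  then show ?thesis using that[OF e1 e2] cT[of "K \<times> K"] by simp
qed

section \<open>Codegrees of triangles and paths\<close>

lemma unit_add_isotropic_perp:
  assumes "h v v = 1" "z \<in> isotropic_perp v"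
  shows "h (v + z) (v + z) = 1"
  using assms h_eq_0_commute[of z v] by (simp add: isotropic_perp_def h_simps)

text \<open>
  A neighbour can be rescaled so that its product with \<open>v\<close> is \<open>1\<close>; adjacency then says that
  it is again a unit vector, so that the difference to \<open>v\<close> is isotropic and orthogonal to
  \<open>v\<close>.
\<close>
lemma nbrs_unit:
  assumes v: "h v v = 1"
  shows "nbrs G (pt v) = (\<lambda>z. pt (v + z)) ` (isotropic_perp v - {0})"
proof (intro equalityI subsetI)
  fix Y assume Y: "Y \<in> nbrs G (pt v)"
  then obtain y where y: "h y y = 1" "Y = pt y" using nbrs_vertex vertex_iff by blast
  then have ad: "pt v \<noteq> pt y" "Nm (h v y) = 1" using Y adjacent_unit_iff[OF v y(1)] by simp_all
  then have c: "h y v \<noteq> 0" using h_eq_0_commute by fastforce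
  \<comment> \<open>Rescale \<open>y\<close> to have product \<open>1\<close> with \<open>v\<close>.\<close>
  define c where "c = h y v"
  define z where "z = inverse c *s y - v"
  have c0: "c \<noteq> 0" using c by (simp add: c_def)
  have zv: "h z v = 0" "h v z = 0"
    using c v h_eq_0_commute[of z v] by (simp_all add: h_simps z_def c_def)
  have yz: "y = c *s (v + z)" using c0 by (simp add: vector_smult_assoc z_def)
  have "Nm c = 1" using ad(2) h_flip[of y v] by (simp add: c_def)
  moreover have "h (c *s (v + z)) (c *s (v + z)) = Nm c * (h v v + h v z + h z v + h z z)"
    by (simp add: h_simps Nm_def algebra_simps)
  ultimately have "h z z = 0" using y(1) v zv unfolding yz by simp
  moreover have "z \<noteq> 0"
  proof
    assume "z = 0"
    then have "pt y = pt v" unfolding yz using span_scale_singleton[OF c0, of v] by simp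
    then show False using ad(1) by simp
  qed
  moreover have "Y = pt (v + z)" unfolding y(2) yz by (rule span_scale_singleton[OF c0])
  ultimately show "Y \<in> (\<lambda>z. pt (v + z)) ` (isotropic_perp v - {0})" using zv by (simp add: isotropic_perp_def)
next
  fix Y assume "Y \<in> (\<lambda>z. pt (v + z)) ` (isotropic_perp v - {0})"
  then obtain z where z: "z \<in> isotropic_perp v" "z \<noteq> 0" "Y = pt (v + z)" by blast
  have "pt v \<noteq> pt (v + z)" using pt_add_eqD[of v 0 z] v z by (auto simp: isotropic_perp_def)
  moreover have "h v (v + z) = 1" using v z h_eq_0_commute[of z v] by (simp add: h_simps isotropic_perp_def)
  ultimately show "Y \<in> nbrs G (pt v)"
    using adjacent_unit_iff[OF v unit_add_isotropic_perp[OF v z(1)]] z(3) by simp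
qed

lemma local_adjacent_iff:
  assumes v: "h v v = 1" and z: "z \<in> isotropic_perp v" "a \<in> isotropic_perp v"
  shows "pt (v + z) \<in> nbrs G (pt (v + a)) \<longleftrightarrow> z \<noteq> a \<and> h z a \<in> K"
proof -
  have "pt (v + a) \<noteq> pt (v + z) \<longleftrightarrow> z \<noteq> a"
    using pt_add_eqD[of v a z] v z by (auto simp: isotropic_perp_def)
  moreover have "h (v + a) (v + z) = cj (1 + h z a)"
    using v z h_eq_0_commute[of z v] h_flip[of a z] by (simp add: h_simps isotropic_perp_def cj_simps)
  ultimately show ?thesis
    using adjacent_unit_iff[OF unit_add_isotropic_perp[OF v z(2)] unit_add_isotropic_perp[OF v z(1)]] by (simp add: K_def)
qed

lemma card_common_nbrs3:
  assumes v: "h v v = 1" and ab: "a \<in> isotropic_perp v" "b \<in> isotropic_perp v"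
  shows "card (common_nbrs G {pt v, pt (v + a), pt (v + b)}) =
    card ({z\<in>isotropic_perp v. h z a \<in> K \<and> h z b \<in> K} - {0, a, b})"
proof -
  let ?S = "{z\<in>isotropic_perp v. h z a \<in> K \<and> h z b \<in> K} - {0, a, b}"
  have "common_nbrs G {pt v, pt (v + a), pt (v + b)} = (\<lambda>z. pt (v + z)) ` ?S"
  proof (intro equalityI subsetI)
    fix Y assume Y: "Y \<in> common_nbrs G {pt v, pt (v + a), pt (v + b)}"
    then obtain z where z: "z \<in> isotropic_perp v" "z \<noteq> 0" "Y = pt (v + z)"
      by (auto simp: common_nbrs3 nbrs_unit[OF v])
    then have "z \<in> ?S"
      using Y local_adjacent_iff[OF v z(1) ab(1)] local_adjacent_iff[OF v z(1) ab(2)]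
      by (simp add: common_nbrs3)
    then show "Y \<in> (\<lambda>z. pt (v + z)) ` ?S" using z(3) by blast
  next
    fix Y assume "Y \<in> (\<lambda>z. pt (v + z)) ` ?S"
    then obtain z where z: "z \<in> ?S" "Y = pt (v + z)" by blast
    then show "Y \<in> common_nbrs G {pt v, pt (v + a), pt (v + b)}"
      using local_adjacent_iff[OF v _ ab(1), of z] local_adjacent_iff[OF v _ ab(2), of z]
      by (simp add: common_nbrs3 nbrs_unit[OF v])
  qed
  moreover have "inj_on (\<lambda>z. pt (v + z)) ?S"
    by (rule inj_onI, rule pt_add_eqD[OF v]) (auto simp: isotropic_perp_def)
  ultimately show ?thesis by (simp add: card_image)
qed

lemma h_K_sym: "h a b \<in> K \<longleftrightarrow> h b a \<in> K"
  using K_cj h_flip by metis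

text \<open>
  The vectors \<open>0\<close>, \<open>a\<close>, \<open>b\<close> satisfy the conditions on \<open>z\<close> but give the vertices of the
  triangle.
\<close>
lemma card_common_nbrs_triangle:
  assumes v: "h v v = 1" and ab: "a \<in> isotropic_perp v" "b \<in> isotropic_perp v" "a \<noteq> 0" "b \<noteq> 0" "a \<noteq> b" "h a b \<in> K"
  shows "int (card (common_nbrs G {pt v, pt (v + a), pt (v + b)})) + 3 =
    int (card {z\<in>isotropic_perp v. h z a \<in> K \<and> h z b \<in> K})"
proof -
  let ?S = "{z\<in>isotropic_perp v. h z a \<in> K \<and> h z b \<in> K}"
  have "{0, a, b} \<subseteq> ?S" using ab h_K_sym[of a b] by (auto simp: isotropic_perp_def)
  then have "card (?S - {0, a, b}) = card ?S - card {0, a, b}" "card {0, a, b} \<le> card ?S"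
    by (auto simp: card_Diff_subset intro: card_mono)
  then show ?thesis unfolding card_common_nbrs3[OF v ab(1,2)] using ab by simp
qed

lemma triangleE:
  assumes "X2 \<in> nbrs G X1" "X3 \<in> nbrs G X1"
  obtains v a b where "h v v = 1" "a \<in> isotropic_perp v" "b \<in> isotropic_perp v" "a \<noteq> 0" "b \<noteq> 0"
    "X1 = pt v" "X2 = pt (v + a)" "X3 = pt (v + b)"
proof -
  obtain v where v: "h v v = 1" "X1 = pt v" using assms(1) nbrs_vertex vertex_iff by blast
  then obtain a b where "a \<in> isotropic_perp v - {0}" "X2 = pt (v + a)" "b \<in> isotropic_perp v - {0}" "X3 = pt (v + b)"
    using assms nbrs_unit[OF v(1)] by auto
  then show ?thesis using that v by blast
qed

text \<open>
  The four possible codegrees, in the order collinear with ratio in the fixed field,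
  collinear with another ratio, totally isotropic plane, nonorthogonal.
\<close>
lemma triangle_codegrees:
  assumes tri: "X2 \<in> nbrs G X1" "X3 \<in> nbrs G X1" "X3 \<in> nbrs G X2" and u: "h u u = 1"
  defines "m \<equiv> int (card (common_nbrs G {X1, X2, X3})) + 3"
    and "X \<equiv> int (card (isotropic_perp u))" and "Q \<equiv> int q" and "e \<equiv> int E"
  shows "m + (Q ^ 2 - 1) * (Q ^ 4 * e) = X \<or> m + (Q ^ 2 - 1) * (Q ^ 4 * e) = X + Q ^ 4 * e \<or>
    m + (Q ^ 4 - 1) * (Q ^ 2 * e) = X + (Q ^ 2 + 2 * Q) * (Q ^ 2 * e) \<or>
    (\<exists>z0 z1. z0 + (Q - 1) * z1 = Q ^ 3 * e \<and> X = Q ^ 2 * z0 + Q * (Q ^ 2 - 1) * (Q ^ 3 * e) \<and>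
      m = 3 * Q * z0 + ((Q + 1) ^ 2 - 3 * Q) * z1)"
proof -
  obtain v a b where v: "h v v = 1" and ab: "a \<in> isotropic_perp v" "b \<in> isotropic_perp v" "a \<noteq> 0" "b \<noteq> 0"
    and X: "X1 = pt v" "X2 = pt (v + a)" "X3 = pt (v + b)"
    using tri(1,2) by (rule triangleE)
  have k: "a \<noteq> b" "h a b \<in> K"
    using tri(3) local_adjacent_iff[OF v ab(2,1)] h_K_sym X by auto
  have m: "m = int (card {z\<in>isotropic_perp v. h z a \<in> K \<and> h z b \<in> K})"
    unfolding m_def X by (rule card_common_nbrs_triangle) (use v ab k in auto)
  have Xv: "X = int (card (isotropic_perp v))" unfolding X_def using card_isotropic_perp_const[OF u v] by simp
  consider (N) "h a b \<noteq> 0" | (D) "h a b = 0" "lin_indep [a, b]" | (C) "\<not> lin_indep [a, b]" by blast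
  then show ?thesis
  proof cases
    case N
    obtain z0 z1 where z: "z0 + (int q - 1) * z1 = int q ^ 3 * int E"
      "int (card (isotropic_perp v)) = int q ^ 2 * z0 + int q * (int q ^ 2 - 1) * (int q ^ 3 * int E)"
      "int (card {z\<in>isotropic_perp v. h z a \<in> K \<and> h z b \<in> K}) =
        int (card {p\<in>K \<times> K. Tr (snd p * cj (fst p) / h a b) = 0}) * z0
        + ((int q + 1) ^ 2 - int (card {p\<in>K \<times> K. Tr (snd p * cj (fst p) / h a b) = 0})) * z1"
      by (rule hyperbolic_complement[OF v ab(1,2) N])
    have t: "int (card {p\<in>K \<times> K. Tr (snd p * cj (fst p) / h a b) = 0}) = 3 * int q"
      using card_Tr_zeros_K[OF k(2) N] by simp
    show ?thesis
      unfolding m Xv Q_def e_def using z unfolding t by (intro disjI2 exI[of _ z0] exI[of _ z1]) simp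
  next
    case D
    then show ?thesis
      unfolding m Xv Q_def e_def using card_triangle_isotropic_plane[OF v ab(1,2) D] by blast
  next
    case C
    then have "pt b = pt a" using pt_neq_iff_lin_indep[OF ab(3,4)] by simp
    then obtain t where t: "b = t *s a" by (metis span_singleton_eqE)
    have "t \<noteq> 0" "t \<noteq> 1" using t ab k by auto
    from card_triangle_collinear[OF v ab(1,3) this] show ?thesis
      unfolding m Xv Q_def e_def t by (simp split: if_splits)
  qed
qed

lemma collinear_codegree:
  assumes v: "h v v = 1" and r: "r \<in> isotropic_perp v" "r \<noteq> 0" and s: "s \<notin> fixed_field" and u: "h u u = 1"
  shows "int (card (common_nbrs G {pt v, pt (v + r), pt (v + s *s r)})) + 3
      + (int q ^ 2 - 1) * (int q ^ 4 * int E) = int (card (isotropic_perp u)) + int q ^ 4 * int E"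
proof -
  have s01: "s \<noteq> 0" "s \<noteq> 1" using s by auto
  have sr: "s *s r \<in> isotropic_perp v" using r(1) by (simp add: isotropic_perp_def h_simps)
  have "r \<noteq> s *s r"
  proof
    assume "r = s *s r"
    have "(1 - s) *s r = r - s *s r" by (simp add: vec.scale_left_diff_distrib)
    also have "\<dots> = 0" using \<open>r = s *s r\<close> by (metis diff_self)
    finally have "1 - s = 0 \<or> r = 0" by (simp only: vec.scale_eq_0_iff)
    then show False using s01 r by simp
  qed
  then have "int (card (common_nbrs G {pt v, pt (v + r), pt (v + s *s r)})) + 3 =
    int (card {z\<in>isotropic_perp v. h z r \<in> K \<and> h z (s *s r) \<in> K})"
    using r s01 sr by (intro card_common_nbrs_triangle[OF v]) (auto simp: h_simps isotropic_perp_def)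
  then show ?thesis
    using card_triangle_collinear[OF v r s01] s card_isotropic_perp_const[OF u v] by simp
qed

text \<open>
  The ends of a path with centre \<open>\<langle>v\<rangle>\<close> are orthogonal iff \<open>h a b = - 1\<close>, which makes this
  number a constant.
\<close>
definition path_zeros :: int where
  "path_zeros = int (card {p\<in>K \<times> K. Tr (snd p * cj (fst p) / (- 1)) = 0})"

text \<open>
  Since \<open>z0\<close> and \<open>z1\<close> are determined by the first two equations, all paths with orthogonal
  ends have the same codegree. In contrast to triangles, only \<open>z = 0\<close> has to be excluded, as
  \<open>- 1\<close> is not in \<open>K\<close>.
\<close>
lemma path_codegree:
  assumes path: "X2 \<in> nbrs G X1" "X3 \<in> nbrs G X1" and X: "X2 = pt x2" "X3 = pt x3" "h x2 x3 = 0"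
    and u: "h u u = 1"
  obtains z0 z1 where "z0 + (int q - 1) * z1 = int q ^ 3 * int E"
    "int (card (isotropic_perp u)) = int q ^ 2 * z0 + int q * (int q ^ 2 - 1) * (int q ^ 3 * int E)"
    "int (card (common_nbrs G {X1, X2, X3})) + 1 =
      path_zeros * z0 + ((int q + 1) ^ 2 - path_zeros) * z1"
proof -
  obtain v a b where v: "h v v = 1" and ab: "a \<in> isotropic_perp v" "b \<in> isotropic_perp v" "a \<noteq> 0" "b \<noteq> 0"
    and X': "X1 = pt v" "X2 = pt (v + a)" "X3 = pt (v + b)"
    using path by (rule triangleE)
  obtain c where c: "v + a = c *s x2" using X(1) X'(2) by (metis span_singleton_eqE)
  obtain d where d: "v + b = d *s x3" using X(2) X'(3) by (metis span_singleton_eqE)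
  have "h (v + a) (v + b) = 0" unfolding c d using X(3) by (simp add: h_simps)
  then have k: "h a b = - 1"
    using v ab h_eq_0_commute[of b v] by (simp add: h_simps isotropic_perp_def eq_neg_iff_add_eq_0 add.commute)
  then have "h a b \<notin> K" by (simp add: K_def)
  then have nK: "h a b \<notin> K" "h b a \<notin> K" using h_K_sym by auto
  let ?S = "{z\<in>isotropic_perp v. h z a \<in> K \<and> h z b \<in> K}"
  have "card (common_nbrs G {X1, X2, X3}) = card (?S - {0, a, b})"
    unfolding X' by (rule card_common_nbrs3[OF v ab(1,2)])
  also have "?S - {0, a, b} = ?S - {0}" using nK by auto
  finally have c: "card (common_nbrs G {X1, X2, X3}) = card (?S - {0})" .
  have "0 \<in> ?S" by (simp add: isotropic_perp_def)
  moreover from this have "?S \<noteq> {}" by blast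
  then have "card ?S > 0" unfolding card_gt_0_iff by simp
  ultimately have *: "int (card (common_nbrs G {X1, X2, X3})) + 1 = int (card ?S)"
    unfolding c by (simp add: card_Diff_singleton)
  have "h a b \<noteq> 0" using k by simp
  then show ?thesis
  proof (rule hyperbolic_complement[OF v ab(1,2)])
    fix z0 z1 :: int
    assume z: "z0 + (int q - 1) * z1 = int q ^ 3 * int E"
      "int (card (isotropic_perp v)) = int q ^ 2 * z0 + int q * (int q ^ 2 - 1) * (int q ^ 3 * int E)"
      "int (card ?S) = int (card {p\<in>K \<times> K. Tr (snd p * cj (fst p) / h a b) = 0}) * z0
        + ((int q + 1) ^ 2 - int (card {p\<in>K \<times> K. Tr (snd p * cj (fst p) / h a b) = 0})) * z1"
    show ?thesis
      by (rule that[of z0 z1]) (use z k * in \<open>simp_all only: path_zeros_def card_isotropic_perp_const[OF u v]\<close>)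
  qed
qed

section \<open>Common neighbours outside a tangent hyperplane\<close>

definition perp :: "'a ^ 'n \<Rightarrow> ('a ^ 'n) set" where "perp p = {x. h x p = 0}"

lemma pt_perp_iff: "pt x \<subseteq> perp p \<longleftrightarrow> h x p = 0"
proof
  assume "pt x \<subseteq> perp p"
  then have "x \<in> perp p" using vec.span_base[of x "{x}"] by auto
  then show "h x p = 0" by (simp add: perp_def)
qed (auto simp: perp_def vec.span_singleton h_simps)

text \<open>
  The common neighbours whose adjacencies to the hyperplane are not affected by the
  switching.
\<close>
definition outer_nbrs :: "'a ^ 'n \<Rightarrow> ('a ^ 'n) set set \<Rightarrow> ('a ^ 'n) set set" where
  "outer_nbrs p S = {Y \<in> common_nbrs G S. \<not> Y \<subseteq> perp p}"

lemma outer_nbr_unit_iff: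
  assumes a: "h a a = 1" "h a p = 0" and w: "h w p = 1"
  shows "pt w \<in> nbrs G (pt a) \<longleftrightarrow> h w w \<noteq> 0 \<and> Nm (h w a) = h w w"
proof (cases "h w w = 0")
  case True
  then show ?thesis using nbrs_vertex[of "pt w" "pt a"] pt_vertex_iff by auto
next
  case False
  have "pt w \<noteq> pt a" using pt_perp_iff[of w p] pt_perp_iff[of a p] a w by auto
  moreover have "Nm (h a w) = Nm (h w a)" by (simp add: h_flip[of a w])
  ultimately show ?thesis using adjacent_iff[of a w] a False by auto
qed

text \<open>
  Points outside \<open>p\<^sup>\<bottom>\<close> have a unique representative \<open>w\<close> with \<open>h w p = 1\<close>.
\<close>
lemma card_outer_nbrs:
  assumes a: "h a a = 1" "h a p = 0" and b: "h b b = 1" "h b p = 0" and c: "h c c = 1" "h c p = 0"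
  shows "card (outer_nbrs p {pt a, pt b, pt c}) =
    card {w. h w p = 1 \<and> h w a \<noteq> 0 \<and> h w w = Nm (h w a) \<and> h w w = Nm (h w b) \<and> h w w = Nm (h w c)}"
    (is "_ = card ?W")
proof -
  have "outer_nbrs p {pt a, pt b, pt c} = pt ` ?W"
  proof (intro equalityI subsetI)
    fix Y assume Y: "Y \<in> outer_nbrs p {pt a, pt b, pt c}"
    then have YG: "Y \<in> nbrs G (pt a)" "Y \<in> nbrs G (pt b)" "Y \<in> nbrs G (pt c)" and "\<not> Y \<subseteq> perp p"
      by (simp_all add: outer_nbrs_def common_nbrs3)
    obtain y where y: "h y y = 1" "Y = pt y" using YG(1) nbrs_vertex vertex_iff by blast
    have yp: "h y p \<noteq> 0" using \<open>\<not> Y \<subseteq> perp p\<close> y(2) pt_perp_iff by simp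
    define w where "w = inverse (h y p) *s y"
    have w: "h w p = 1" "Y = pt w"
      using yp y(2) span_scale_singleton[of "inverse (h y p)" y] by (simp_all add: w_def h_simps)
    then have "w \<in> ?W"
      using YG outer_nbr_unit_iff[OF a w(1)] outer_nbr_unit_iff[OF b w(1)] outer_nbr_unit_iff[OF c w(1)]
      by auto
    then show "Y \<in> pt ` ?W" using w(2) by blast
  next
    fix Y assume "Y \<in> pt ` ?W"
    then obtain w where w: "w \<in> ?W" "Y = pt w" by blast
    then have wp: "h w p = 1" by simp
    then have "\<not> Y \<subseteq> perp p" using w(2) pt_perp_iff by simp
    moreover have "Y \<in> common_nbrs G {pt a, pt b, pt c}"
      using w outer_nbr_unit_iff[OF a wp] outer_nbr_unit_iff[OF b wp] outer_nbr_unit_iff[OF c wp]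
      by (auto simp: common_nbrs3)
    ultimately show "Y \<in> outer_nbrs p {pt a, pt b, pt c}" by (simp add: outer_nbrs_def)
  qed
  moreover have "inj_on pt ?W"
  proof (rule inj_onI)
    fix w w' assume w: "w \<in> ?W" "w' \<in> ?W" "pt w = pt w'"
    obtain k where k: "w' = k *s w" using w(3) by (rule span_singleton_eqE)
    have "h w' p = k * h w p" unfolding k by (rule h_scale_left)
    then have "k = 1" using w(1,2) by simp
    then show "w = w'" using k by simp
  qed
  ultimately show ?thesis by (simp add: card_image)
qed

text \<open>
  The three products can be prescribed freely subject to having equal nonzero norms, which
  allows \<open>(q ^ 2 - 1) * (q + 1) ^ 2\<close> triples; as \<open>p\<close> is isotropic, each of them is attained
  by \<open>E\<close> vectors of the right norm.
\<close>
lemma card_outer_independent: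
  assumes p: "h p p = 0" and a: "h a a = 1" "h a p = 0" and b: "h b b = 1" "h b p = 0"
    and c: "h c c = 1" "h c p = 0" and ind: "lin_indep [p, a, b, c]"
  shows "card (outer_nbrs p {pt a, pt b, pt c}) = (q ^ 2 - 1) * (q + 1) ^ 2 * E"
proof -
  let ?S = "{w. h w p = 1 \<and> h w w = Nm (h w a)}"
  let ?T = "SIGMA x:UNIV - {0}. {y. Nm y = Nm x} \<times> {z. Nm z = Nm x}"
  let ?f = "\<lambda>w. (h w a, h w b, h w c)"
  have hp: "h p a = 0" "h p b = 0" "h p c = 0"
    using a b c h_eq_0_commute[of p a] h_eq_0_commute[of p b] h_eq_0_commute[of p c] by simp_all
  have fib: "card {w\<in>?S. ?f w = t} = E" for t
  proof (cases t)
    case (fields x y z)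
    have "{w\<in>?S. ?f w = t} = {w. h w w = Nm x \<and> h w p = 1 \<and> h w a = x \<and> h w b = y \<and> h w c = z}"
      using fields by auto
    also have "card \<dots> = E" by (rule card_isotropic4[OF ind p hp]) auto
    finally show ?thesis .
  qed
  have "{w. h w p = 1 \<and> h w a \<noteq> 0 \<and> h w w = Nm (h w a) \<and> h w w = Nm (h w b) \<and> h w w = Nm (h w c)}
      = {w\<in>?S. ?f w \<in> ?T}" by auto
  moreover have "card {w\<in>?S. ?f w \<in> ?T} = card ?T * E"
    by (subst card_values_in) (simp_all only: fib finite sum_constant of_nat_id)
  moreover have "card ?T = (\<Sum>x\<in>UNIV - {0}. card ({y. Nm y = Nm x} \<times> {z. Nm z = Nm x}))"
    by (rule card_SigmaI) auto
  moreover have "\<dots> = (\<Sum>x\<in>UNIV - {0::'a}. (q + 1) ^ 2)"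
    by (rule sum.cong) (auto simp: card_cartesian_product card_Nm_eq power2_eq_square)
  moreover have "\<dots> = (q ^ 2 - 1) * (q + 1) ^ 2"
    by (simp add: card_field)
  ultimately show ?thesis using card_outer_nbrs[OF a b c] by simp
qed

text \<open>
  Here only the products \<open>x = h w a\<close> and \<open>y = h w r\<close> are free. The norm conditions say that
  \<open>k = y / x\<close> and \<open>cj s * k\<close> lie in \<open>K\<close>, which leaves two choices of \<open>k\<close> for each nonzero
  \<open>x\<close>.
\<close>
lemma card_outer_collinear:
  assumes p: "h p p = 0" "p \<noteq> 0" and a: "h a a = 1" "h a p = 0" and r: "r \<in> isotropic_perp a" "h r p = 0"
    and ind: "lin_indep [p, r]" and s: "s \<notin> fixed_field"
  shows "card (outer_nbrs p {pt a, pt (a + r), pt (a + s *s r)}) = 2 * (q ^ 2 - 1) * q ^ 2 * E"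
proof -
  let ?S = "{w. h w p = 1 \<and> h w w = Nm (h w a)}"
  let ?T = "(\<lambda>(x, k). (x, k * x)) ` ((UNIV - {0}) \<times> {k\<in>K. cj s * k \<in> K})"
  let ?f = "\<lambda>w. (h w a, h w r)"
  have hr: "h r a = 0" "h a r = 0" "h r r = 0" "h p a = 0" "h p r = 0"
    using r a h_eq_0_commute[of r a] h_eq_0_commute[of p a] h_eq_0_commute[of p r] by (simp_all add: isotropic_perp_def)
  have "a \<notin> vec.span {p, r}" by (rule not_in_span[where w = a]) (use hr a in auto)
  then have "lin_indep [a, p, r]" using ind by (simp add: lin_indep_Cons)
  then have ind3: "lin_indep [p, a, r]" by (auto simp: lin_indep_def insert_commute)
  have s01: "s \<noteq> 0" "s \<noteq> 1" using s by auto
  have unit: "h (a + k *s r) (a + k *s r) = 1" "h (a + k *s r) p = 0" for k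
    using a r hr by (simp_all add: h_simps)
  have fib: "card {w\<in>?S. ?f w = t} = q ^ 2 * E" for t
  proof (cases t)
    case (Pair x y)
    have "{w\<in>?S. ?f w = t} = {w. h w w = Nm x \<and> h w p = 1 \<and> h w a = x \<and> h w r = y}"
      using Pair by auto
    also have "card \<dots> = q ^ 2 * E" by (rule card_isotropic3[OF ind3 p(1) hr(4,5)]) auto
    finally show ?thesis .
  qed
  \<comment> \<open>Dividing by \<open>x\<close> turns equality of norms into membership in \<open>K\<close>.\<close>
  have K_quot: "Nm x = Nm (x + k * y) \<longleftrightarrow> k * y / x \<in> K" if "x \<noteq> 0" for x y k
  proof -
    have "x + k * y = x * (1 + k * y / x)" using that by (simp add: field_simps)
    then have "Nm (x + k * y) = Nm x * Nm (1 + k * y / x)" by (simp only: Nm_mult)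
    then show ?thesis using that by (auto simp: K_def)
  qed
  have T_iff: "(x, y) \<in> ?T \<longleftrightarrow> x \<noteq> 0 \<and> Nm x = Nm (x + y) \<and> Nm x = Nm (x + cj s * y)" for x y
  proof (cases "x = 0")
    case False
    have "(x, y) \<in> ?T \<longleftrightarrow> y / x \<in> K \<and> cj s * (y / x) \<in> K"
    proof
      assume "y / x \<in> K \<and> cj s * (y / x) \<in> K"
      then show "(x, y) \<in> ?T" using False by (intro image_eqI[of _ _ "(x, y / x)"]) auto
    qed (use False in auto)
    then show ?thesis using K_quot[OF False, of 1 y] K_quot[OF False, of "cj s" y] False by simp
  qed auto
  have "card (outer_nbrs p {pt a, pt (a + r), pt (a + s *s r)}) =
      card (outer_nbrs p {pt a, pt (a + 1 *s r), pt (a + s *s r)})"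
    by simp
  also have "\<dots> = card {w. h w p = 1 \<and> h w a \<noteq> 0 \<and> h w w = Nm (h w a) \<and>
      h w w = Nm (h w (a + 1 *s r)) \<and> h w w = Nm (h w (a + s *s r))}"
    by (rule card_outer_nbrs[OF a unit unit])
  also have "\<dots> = card {w\<in>?S. ?f w \<in> ?T}"
    unfolding T_iff by (rule arg_cong[where f = card]) (auto simp: h_simps)
  also have "\<dots> = card ?T * (q ^ 2 * E)"
    by (subst card_values_in) (simp_all only: fib finite sum_constant of_nat_id)
  also have "card ?T = card ((UNIV - {0::'a}) \<times> {k\<in>K. cj s * k \<in> K})"
    by (rule card_image) (auto simp: inj_on_def)
  also have "\<dots> = (q ^ 2 - 1) * 2"
    using card_K_scaled[OF s01] s by (simp add: card_cartesian_product card_field)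
  finally show ?thesis by simp
qed

section \<open>Tangent lines\<close>

text \<open>
  The points other than \<open>\<langle>p\<rangle>\<close> of the line joining \<open>\<langle>p\<rangle>\<close> and \<open>\<langle>u\<rangle>\<close>.
\<close>
definition affine_line :: "'a ^ 'n \<Rightarrow> 'a ^ 'n \<Rightarrow> ('a ^ 'n) set set" where
  "affine_line p u = range (\<lambda>t. pt (u + t *s p))"

text \<open>
  A vector of the line outside \<open>\<langle>p\<rangle>\<close> must be orthogonal to \<open>p\<close>, as otherwise adding a
  multiple of \<open>p\<close> would give a second isotropic point.
\<close>
lemma tangent_lineE:
  assumes p: "p \<noteq> 0" "h p p = 0" and L: "is_line L" "points_of L \<inter> isotropic_points = {pt p}"
  obtains u where "h u u = 1" "h u p = 0" "L = vec.span {p, u}" "points_of L - {pt p} = affine_line p u"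
proof -
  have sub: "vec.subspace L" "vec.dim L = 2" using L(1) by (simp_all add: is_line_def)
  have pL: "p \<in> L" using L(2) vec.span_base[of p "{p}"] by (auto simp: points_of_def)
  have "\<not> L \<subseteq> pt p"
  proof
    assume "L \<subseteq> pt p"
    then have "vec.dim L \<le> 1" using p vec.dim_mono[of L "{p}"] by simp
    then show False using sub by simp
  qed
  then obtain w where w: "w \<in> L" "w \<notin> pt p" by blast
  have only_p: "pt y = pt p" if "y \<in> L" "y \<noteq> 0" "h y y = 0" for y
  proof -
    have "pt y \<subseteq> L" using that sub by (intro vec.span_minimal) auto
    then have "pt y \<in> points_of L \<inter> isotropic_points" using that by (auto simp: points_of_def is_point_iff isotropic_points_def)
    then show ?thesis using L(2) by simp
  qed
  have not_p: "y \<notin> L \<or> h y y \<noteq> 0" if "y \<notin> pt p" for y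
    using only_p[of y] that vec.span_base[of y "{y}"] vec.span_zero[of "{p}"] by auto
  have ww: "h w w \<noteq> 0" using not_p w by blast
  have wp: "h w p = 0"
  proof (rule ccontr)
    assume b: "h w p \<noteq> 0"
    have "- h w w \<in> fixed_field" using h_self_fixed_field[of w] by (simp add: fixed_field_iff cj_simps)
    then obtain x where x: "Tr x = - h w w" by (rule Tr_surj)
    let ?y = "w + cj (x / h w p) *s p"
    have "h ?y ?y = 0" using b by (simp add: h_self_add_scale p x)
    moreover have "?y \<in> L" using sub w pL by (intro vec.subspace_add vec.subspace_scale)
    moreover have "?y \<notin> pt p"
      using w(2) vec.span_add_eq2[of "cj (x / h w p) *s p" "{p}" w]
        vec.span_scale[OF vec.span_base[of p "{p}"]] by auto
    ultimately show False using not_p by blast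
  qed
  obtain c where c: "c \<noteq> 0" "h (c *s w) (c *s w) = 1" using ww by (rule normalize)
  define u where "u = c *s w"
  have u: "h u u = 1" "h u p = 0" using c wp by (simp_all add: u_def h_scale_left)
  have up: "u \<notin> pt p" unfolding u_def by (rule notin_span_scale[OF w(2) c(1)])
  have uL: "u \<in> L" unfolding u_def using sub w by (intro vec.subspace_scale)
  have "lin_indep [u, p]" using up p by (simp add: lin_indep_Cons)
  then have "vec.independent {p, u}" "p \<noteq> u" by (auto simp: lin_indep_def insert_commute)
  then have "vec.dim {p, u} = 2" by (simp add: vec.dim_eq_card_independent)
  then have "vec.span {p, u} = vec.span L"
    using pL uL sub by (intro vec.dim_eq_span) auto
  then have Lspan: "L = vec.span {p, u}" using sub by (metis vec.span_eq_iff)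
  have "points_of L - {pt p} = affine_line p u"
  proof (intro equalityI subsetI)
    fix X assume X: "X \<in> points_of L - {pt p}"
    then obtain y where y: "y \<noteq> 0" "X = pt y" by (auto simp: points_of_def is_point_iff)
    then have "y \<in> L" using X vec.span_base[of y "{y}"] by (auto simp: points_of_def)
    then obtain a b where ab: "y = a *s p + b *s u" unfolding Lspan in_span_pair by blast
    have "b \<noteq> 0"
    proof
      assume "b = 0"
      then have "y = a *s p" "a \<noteq> 0" using ab y by auto
      then have "pt y = pt p" using span_scale_singleton by blast
      then show False using X y by simp
    qed
    then have "y = b *s (u + (a / b) *s p)"
      by (simp add: ab vec.scale_right_distrib vector_smult_assoc add.commute)
    then have "pt y = pt (u + (a / b) *s p)" using span_scale_singleton[OF \<open>b \<noteq> 0\<close>] by metis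
    then show "X \<in> affine_line p u" using y by (auto simp: affine_line_def)
  next
    fix X assume "X \<in> affine_line p u"
    then obtain t where t: "X = pt (u + t *s p)" by (auto simp: affine_line_def)
    have hu: "h (u + t *s p) (u + t *s p) = 1" by (simp add: h_self_add_scale u p)
    then have "u + t *s p \<noteq> 0" by auto
    moreover have "u + t *s p \<in> L" using sub uL pL by (intro vec.subspace_add vec.subspace_scale)
    moreover from this have "X \<subseteq> L" unfolding t using sub by (intro vec.span_minimal) auto
    ultimately have "X \<in> points_of L"
      unfolding points_of_def is_point_iff t by blast
    moreover have "X \<noteq> pt p"
    proof
      assume "X = pt p"
      then have "u + t *s p \<in> pt p" using t vec.span_base[of "u + t *s p" "{u + t *s p}"] by auto
      then obtain k where "u + t *s p = k *s p" by (auto simp: vec.span_singleton)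
      then show False using hu p by (simp add: h_simps)
    qed
    ultimately show "X \<in> points_of L - {pt p}" by simp
  qed
  then show ?thesis using that u Lspan by blast
qed

text \<open>
  If \<open>z\<close> is isotropic, a vector orthogonal to \<open>p\<close> and \<open>u\<close> but not to \<open>z\<close> becomes isotropic
  after adding a multiple of \<open>z\<close>. Otherwise \<open>{p, u, z}\<^sup>\<bottom>\<close> has more than \<open>q ^ 2\<close> elements,
  hence some \<open>y\<close> outside the span; either \<open>y\<close> is isotropic itself, or a multiple of \<open>y\<close>
  cancels the value of the form on \<open>z\<close>.
\<close>
lemma isotropic_outside:
  assumes p: "h p p = 0" and u: "h u u = 1" "h u p = 0" and z: "h z p = 0" "h z u = 0"
    and ind: "lin_indep [p, u, z]"
  shows "h z z = 0 \<Longrightarrow> \<exists>r\<in>isotropic_perp u. h r p = 0 \<and> h r z = 1"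
    and "\<exists>r\<in>isotropic_perp u. h r p = 0 \<and> r \<notin> vec.span {p, u, z}"
proof -
  have sym: "h p u = 0" "h p z = 0" "h u z = 0"
    using u z h_eq_0_commute[of p u] h_eq_0_commute[of p z] h_eq_0_commute[of u z] by simp_all
  show iso: "\<exists>r\<in>isotropic_perp u. h r p = 0 \<and> h r z = 1" if zz: "h z z = 0"
  proof -
    have "p \<noteq> u" "p \<noteq> z" "u \<noteq> z" using ind by (auto simp: lin_indep_def)
    moreover have "vec.independent {p, u, z}" using ind by (simp add: lin_indep_def)
    ultimately obtain y where y: "h y p = 0" "h y u = 0" "h y z = 1"
      using prescribe_products[of "{p, u, z}" "\<lambda>x. if x = z then 1 else 0"] by (metis insert_iff)
    have "- h y y \<in> fixed_field" using h_self_fixed_field[of y] by (simp add: fixed_field_iff cj_simps)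
    then obtain x where x: "Tr x = - h y y" by (rule Tr_surj)
    have "h (y + cj x *s z) (y + cj x *s z) = 0" by (simp add: h_self_add_scale zz y x)
    moreover have "h (y + cj x *s z) u = 0" "h (y + cj x *s z) p = 0" "h (y + cj x *s z) z = 1"
      using y z zz by (simp_all add: h_simps)
    ultimately show ?thesis by (auto simp: isotropic_perp_def)
  qed
  show "\<exists>r\<in>isotropic_perp u. h r p = 0 \<and> r \<notin> vec.span {p, u, z}"
  proof (cases "h z z = 0")
    case True
    then obtain r where r: "r \<in> isotropic_perp u" "h r p = 0" "h r z = 1" using iso by blast
    moreover have "r \<notin> vec.span {p, u, z}"
      by (rule not_in_span[where w = z]) (use sym True r in auto)
    ultimately show ?thesis by blast
  next
    case False
    let ?S = "{w. h w p = 0 \<and> h w u = 0 \<and> h w z = 0}"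
    \<comment> \<open>The radical \<open>pt p\<close> of \<open>{p, u, z}\<^sup>\<bottom>\<close> is the part of it inside the span.\<close>
    have "card (pt p) \<le> q ^ 2"
      unfolding vec.span_singleton using card_image_le[of "UNIV :: 'a set"] card_field by simp
    also have "q ^ 2 < q ^ 3 * E"
    proof -
      have "2 * 1 \<le> q * E" using q_ge_2 E_pos by (intro mult_le_mono) (simp_all add: Suc_leI del: E_pos)
      then have "q ^ 2 * 1 < q ^ 2 * (q * E)" using q_ge_2 by (intro mult_strict_left_mono) auto
      then show ?thesis by (simp add: power2_eq_square power3_eq_cube mult.assoc)
    qed
    also have "q ^ 3 * E = card ?S" using card_prescribed3[OF ind] by simp
    finally have "\<not> ?S \<subseteq> pt p" using card_mono[of "pt p" ?S] by auto
    then obtain y where y: "h y p = 0" "h y u = 0" "h y z = 0" "y \<notin> pt p" by blast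
    have yspan: "y \<notin> vec.span {p, u, z}"
    proof
      assume "y \<in> vec.span {p, u, z}"
      then obtain a b c where e: "y = a *s p + (b *s u + c *s z)"
        by (auto simp: vec.span_insert vec.span_singleton algebra_simps)
      then have "h y u = b" "h y z = c * h z z" using sym u z by (simp_all add: h_simps)
      then have "b = 0" "c = 0" using y False by simp_all
      then show False using e y(4) by (auto simp: vec.span_singleton)
    qed
    show ?thesis
    proof (cases "h y y = 0")
      case True
      then show ?thesis using y yspan by (auto simp: isotropic_perp_def)
    next
      case nz: False
      have "- h z z / h y y \<in> fixed_field"
        using h_self_fixed_field[of z] h_self_fixed_field[of y] by (simp add: fixed_field_iff cj_simps)
      then obtain c where c: "Nm c = - h z z / h y y" by (rule Nm_surj)
      then have c0: "c \<noteq> 0" using False nz by auto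
      have "h z y = 0" using y(3) h_eq_0_commute by blast
      then have "h (z + c *s y) (z + c *s y) = 0" using c nz by (simp add: h_self_add_scale)
      moreover have "h (z + c *s y) u = 0" "h (z + c *s y) p = 0" using y z by (simp_all add: h_simps)
      moreover have "z + c *s y \<notin> vec.span {p, u, z}"
        using notin_span_scale[OF yspan c0] vec.span_add_eq[of z "{p, u, z}" "c *s y"]
        by (simp add: vec.span_base)
      ultimately show ?thesis by (auto simp: isotropic_perp_def)
    qed
  qed
qed

end

section \<open>Comparison of codegrees\<close>

text \<open>
  Here \<open>m\<close> is the shifted codegree of a collinear triangle and \<open>m'\<close> that of the triangle
  obtained by switching; the four claims exclude the four values of \<open>triangle_codegrees\<close>.
  The first three differences are \<open>e\<close> times a polynomial in \<open>Q\<close> without zeros \<open>Q \<ge> 3\<close>. In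
  the last case eliminating \<open>X\<close> and \<open>z1\<close> shows that \<open>d\<close> divides \<open>e * Q\<close>, a power of \<open>Q\<close>,
  although \<open>d > 1\<close> is prime to \<open>Q\<close>.
\<close>
lemma switched_codegree_differs:
  fixes X m m' Q e :: int
  assumes Q: "Q \<ge> 3" and e: "e = Q ^ k"
    and m: "m + (Q ^ 2 - 1) * (Q ^ 4 * e) = X + Q ^ 4 * e"
    and m': "m' = m - 2 * (Q ^ 2 - 1) * Q ^ 2 * e + (Q ^ 2 - 1) * (Q + 1) ^ 2 * e"
  shows "m' + (Q ^ 2 - 1) * (Q ^ 4 * e) \<noteq> X" "m' + (Q ^ 2 - 1) * (Q ^ 4 * e) \<noteq> X + Q ^ 4 * e"
    "m' + (Q ^ 4 - 1) * (Q ^ 2 * e) \<noteq> X + (Q ^ 2 + 2 * Q) * (Q ^ 2 * e)"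
    "\<not> (z0 + (Q - 1) * z1 = Q ^ 3 * e \<and> X = Q ^ 2 * z0 + Q * (Q ^ 2 - 1) * (Q ^ 3 * e) \<and>
      m' = 3 * Q * z0 + ((Q + 1) ^ 2 - 3 * Q) * z1)"
proof -
  have e0: "e \<noteq> 0" using Q e by simp
  have X: "X = m + (Q ^ 2 - 2) * Q ^ 4 * e" using m by (simp add: algebra_simps)
  have QQ: "Q * Q \<ge> 3 * Q" "3 * Q \<ge> 9" "Q * (Q * Q) \<ge> 3 * (Q * Q)"
    using Q by (simp_all add: mult_right_mono)
  have "m' + (Q ^ 2 - 1) * (Q ^ 4 * e) - X = e * (2 * (Q * (Q * Q)) + 2 * (Q * Q) - 2 * Q - 1)"
    unfolding m' X by algebra
  moreover have "2 * (Q * (Q * Q)) + 2 * (Q * Q) - 2 * Q - 1 \<noteq> 0"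
    using QQ Q by linarith
  ultimately show "m' + (Q ^ 2 - 1) * (Q ^ 4 * e) \<noteq> X" using e0 by auto
  have f: "Q * Q - 2 * Q - 1 \<noteq> 0" "Q * Q - 1 \<noteq> 0" using QQ Q by linarith+
  have "m' + (Q ^ 2 - 1) * (Q ^ 4 * e) - (X + Q ^ 4 * e) = - (e * (Q * Q - 2 * Q - 1) * (Q * Q - 1))"
    unfolding m' X by algebra
  then show "m' + (Q ^ 2 - 1) * (Q ^ 4 * e) \<noteq> X + Q ^ 4 * e" using e0 f by auto
  have "m' + (Q ^ 4 - 1) * (Q ^ 2 * e) - (X + (Q ^ 2 + 2 * Q) * (Q ^ 2 * e)) = e * (Q * Q - 2 * Q - 1)"
    unfolding m' X by algebra
  then show "m' + (Q ^ 4 - 1) * (Q ^ 2 * e) \<noteq> X + (Q ^ 2 + 2 * Q) * (Q ^ 2 * e)" using e0 f by auto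
  show "\<not> (z0 + (Q - 1) * z1 = Q ^ 3 * e \<and> X = Q ^ 2 * z0 + Q * (Q ^ 2 - 1) * (Q ^ 3 * e) \<and>
      m' = 3 * Q * z0 + ((Q + 1) ^ 2 - 3 * Q) * z1)"
  proof
    assume z: "z0 + (Q - 1) * z1 = Q ^ 3 * e \<and> X = Q ^ 2 * z0 + Q * (Q ^ 2 - 1) * (Q ^ 3 * e) \<and>
      m' = 3 * Q * z0 + ((Q + 1) ^ 2 - 3 * Q) * z1"
    \<comment> \<open>The coefficient of \<open>z0\<close> after elimination, which is visibly \<open>1\<close> modulo \<open>Q\<close>.\<close>
    define d where "d = Q * (Q - 1) * (Q - 2) + 1"
    have "m' = X - (Q ^ 2 - 2) * Q ^ 4 * e - 2 * (Q ^ 2 - 1) * Q ^ 2 * e + (Q ^ 2 - 1) * (Q + 1) ^ 2 * e"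
      unfolding m' X by simp
    then have "d * z0 = e * ((Q ^ 2 - 1) * d + Q)"
      using z unfolding d_def by algebra
    then have "e * Q = d * (z0 - e * (Q ^ 2 - 1))" by (simp add: algebra_simps)
    then have "d dvd Q ^ Suc k" using e by (simp add: dvd_def mult.commute)
    moreover have "coprime d (Q ^ Suc k)"
    proof -
      have "coprime (Q * ((Q - 1) * (Q - 2)) + 1) Q"
        by (rule coprimeI) (metis dvd_add_right_iff dvd_mult2)
      then show ?thesis unfolding d_def by (simp only: mult.assoc coprime_power_right_iff) simp
    qed
    ultimately have "is_unit d" by (metis coprime_common_divisor dvd_refl)
    moreover have "d \<ge> 7"
    proof -
      have "Q * ((Q - 1) * (Q - 2)) \<ge> 3 * (2 * 1)"
        using Q by (intro mult_mono) auto
      then show ?thesis by (simp add: d_def mult.assoc)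
    qed
    ultimately show False by simp
  qed
qed

section \<open>Switching along two tangent lines\<close>

text \<open>
  The geometric situation in coordinates: the two lines are \<open>vec.span {p, u1}\<close> and
  \<open>vec.span {p, u2}\<close>.
\<close>
locale two_tangent_lines = unitary_space_dim5 q h
  for q :: nat and h :: "'a::{field,finite} ^ 'n \<Rightarrow> 'a ^ 'n \<Rightarrow> 'a" +
  fixes p u1 u2 :: "'a ^ 'n"
  assumes p: "h p p = 0" and u1: "h u1 u1 = 1" "h u1 p = 0" and u2: "h u2 u2 = 1" "h u2 p = 0"
    and ind: "lin_indep [p, u1, u2]"

begin

abbreviation "l1 \<equiv> affine_line p u1"

abbreviation "l2 \<equiv> affine_line p u2"

definition tangent_vertices :: "('a ^ 'n) set set" where "tangent_vertices = {X \<in> pverts G. X \<subseteq> perp p}"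

definition \<tau> :: "('a ^ 'n) set \<Rightarrow> ('a ^ 'n) set" where
  "\<tau> X = (if X \<in> l1 then pt (u2 + (SOME t. X = pt (u1 + t *s p)) *s p)
    else if X \<in> l2 then pt (u1 + (SOME t. X = pt (u2 + t *s p)) *s p) else X)"

lemma p_nonzero: "p \<noteq> 0"
  using ind vec.dependent_zero by (auto simp: lin_indep_def)

lemma on_line:
  assumes u: "h u u = 1" "h u p = 0"
  shows "h (u + t *s p) (u + t *s p) = 1" "h (u + t *s p) p = 0"
    "pt (u + t *s p) = pt (u + t' *s p) \<longleftrightarrow> t = t'"
proof -
  have pu: "h p u = 0" using u(2) h_eq_0_commute by blast
  show "h (u + t *s p) (u + t *s p) = 1" by (simp add: h_self_add_scale u p)
  show "h (u + t *s p) p = 0" by (simp add: h_simps u p)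
  show "pt (u + t *s p) = pt (u + t' *s p) \<longleftrightarrow> t = t'"
  proof
    assume "pt (u + t *s p) = pt (u + t' *s p)"
    then have "t *s p = t' *s p" using pu by (intro pt_add_eqD[OF u(1)]) (simp_all add: h_scale_left)
    then show "t = t'" using p_nonzero by simp
  qed simp
qed

lemma affine_line_subset: "h u u = 1 \<Longrightarrow> h u p = 0 \<Longrightarrow> affine_line p u \<subseteq> tangent_vertices"
proof
  fix X assume u: "h u u = 1" "h u p = 0" and "X \<in> affine_line p u"
  then obtain t where "X = pt (u + t *s p)" by (auto simp: affine_line_def)
  then show "X \<in> tangent_vertices" using on_line(1,2)[OF u, of t] by (simp add: tangent_vertices_def pt_perp_iff pt_vertex_iff)
qed

lemma affine_line_clique:
  assumes u: "h u u = 1" "h u p = 0" and X: "X \<in> affine_line p u" "Y \<in> affine_line p u" "X \<noteq> Y"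
  shows "Y \<in> nbrs G X"
proof -
  obtain s t where st: "X = pt (u + s *s p)" "Y = pt (u + t *s p)" using X by (auto simp: affine_line_def)
  have "h p u = 0" using u(2) h_eq_0_commute by blast
  then have "h (u + s *s p) (u + t *s p) = 1" using u p by (simp add: h_simps)
  then show ?thesis
    using adjacent_unit_iff[OF on_line(1)[OF u, of s] on_line(1)[OF u, of t]] X(3) st by simp
qed

text \<open>
  Vectors orthogonal to \<open>p\<close> have the same product with all representatives \<open>u + t *s p\<close>.
\<close>
lemma affine_line_uniform:
  assumes u: "h u u = 1" "h u p = 0" and X: "X \<in> tangent_vertices - affine_line p u" and Y: "Y \<in> affine_line p u" "Y \<in> nbrs G X"
  shows "X \<in> common_nbrs G (affine_line p u)"
proof -
  obtain x where x: "h x x = 1" "X = pt x" "h x p = 0"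
    using X by (auto simp: tangent_vertices_def vertex_iff pt_perp_iff)
  have xt: "h (u + t *s p) x = h u x" for t
    using x(3) h_eq_0_commute[of p x] by (simp add: h_simps)
  have ne: "pt (u + t *s p) \<noteq> pt x" for t using X x(2) by (auto simp: affine_line_def)
  obtain t where "Y = pt (u + t *s p)" using Y by (auto simp: affine_line_def)
  then have "Nm (h u x) = 1"
    using Y(2) nbrs_sym adjacent_unit_iff[OF on_line(1)[OF u, of t] x(1)] x(2) xt by metis
  then have "pt x \<in> nbrs G (pt (u + t *s p))" for t
    using adjacent_unit_iff[OF on_line(1)[OF u, of t] x(1)] ne xt by simp
  then show ?thesis by (auto simp: common_nbrs_def affine_line_def x(2))
qed

text \<open>
  If \<open>x\<close> is not orthogonal to \<open>p\<close>, it is orthogonal to \<open>u + t *s p\<close> for some \<open>t\<close> and so not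
  adjacent to that point.
\<close>
lemma affine_line_inner:
  assumes u: "h u u = 1" "h u p = 0"
  shows "common_nbrs G (affine_line p u) \<subseteq> tangent_vertices"
proof
  fix X assume X: "X \<in> common_nbrs G (affine_line p u)"
  then have nb: "X \<in> nbrs G (pt (u + t *s p))" for t by (auto simp: common_nbrs_def affine_line_def)
  then have XV: "X \<in> pverts G" using nbrs_vertex by blast
  then obtain x where x: "h x x = 1" "X = pt x" by (auto simp: vertex_iff)
  have "h p x = 0"
  proof (rule ccontr)
    assume px: "h p x \<noteq> 0"
    let ?t = "- h u x / h p x"
    have "h (u + ?t *s p) x = 0" using px by (simp add: h_simps)
    then show False
      using nb[of ?t] adjacent_unit_iff[OF on_line(1)[OF u, of ?t] x(1)] x(2) by simp
  qed
  then have "h x p = 0" using h_eq_0_commute by blast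
  then show "X \<in> tangent_vertices" using XV x by (simp add: tangent_vertices_def pt_perp_iff)
qed

lemma outside_lines:
  assumes "r \<notin> vec.span {p, u1, u2}" "k \<noteq> 0" and u: "u = u1 \<or> u = u2"
  shows "pt (u + k *s r) \<notin> l1" "pt (u + k *s r) \<notin> l2"
proof -
  have "pt (u + k *s r) \<noteq> pt (w + t *s p)" if w: "w = u1 \<or> w = u2" for w t
  proof
    assume "pt (u + k *s r) = pt (w + t *s p)"
    then obtain c where c: "u + k *s r = c *s (w + t *s p)" by (metis span_singleton_eqE)
    have "p \<in> vec.span {p, u1, u2}" "w \<in> vec.span {p, u1, u2}" "u \<in> vec.span {p, u1, u2}"
      using u w by (auto intro: vec.span_base)
    then have "c *s (w + t *s p) - u \<in> vec.span {p, u1, u2}"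
      by (intro vec.span_diff vec.span_scale vec.span_add)
    then have "k *s r \<in> vec.span {p, u1, u2}" unfolding c[symmetric] by simp
    then show False using notin_span_scale[OF assms(1,2)] by simp
  qed
  then show "pt (u + k *s r) \<notin> l1" "pt (u + k *s r) \<notin> l2" by (auto simp: affine_line_def)
qed

lemma lines_disjoint: "pt (u1 + t *s p) \<noteq> pt (u2 + t' *s p)"
proof
  assume "pt (u1 + t *s p) = pt (u2 + t' *s p)"
  then obtain c where c: "u2 + t' *s p = c *s (u1 + t *s p)" by (metis span_singleton_eqE)
  have "c *s (u1 + t *s p) - t' *s p \<in> vec.span {p, u1}"
    by (intro vec.span_diff vec.span_scale vec.span_add vec.span_base) auto
  then have "u2 \<in> vec.span {p, u1}" unfolding c[symmetric] by simp
  moreover have "lin_indep [u2, p, u1]" using ind by (auto simp: lin_indep_def insert_commute)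
  ultimately show False by (simp add: lin_indep_Cons)
qed

lemma \<tau>_line:
  "\<tau> (pt (u1 + t *s p)) = pt (u2 + t *s p)" "\<tau> (pt (u2 + t *s p)) = pt (u1 + t *s p)"
  "X \<notin> l1 \<Longrightarrow> X \<notin> l2 \<Longrightarrow> \<tau> X = X"
proof -
  have d: "pt (u2 + t *s p) \<notin> l1" "pt (u1 + t *s p) \<in> l1" "pt (u2 + t *s p) \<in> l2"
    using lines_disjoint[symmetric] by (auto simp: affine_line_def)
  show "\<tau> (pt (u1 + t *s p)) = pt (u2 + t *s p)" "\<tau> (pt (u2 + t *s p)) = pt (u1 + t *s p)"
    unfolding \<tau>_def using d by (simp_all add: on_line(3)[OF u1] on_line(3)[OF u2])
qed (simp add: \<tau>_def)

lemma \<tau>_u: "\<tau> (pt u1) = pt u2" "\<tau> (pt u2) = pt u1"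
  using \<tau>_line(1,2)[of 0] by simp_all

sublocale line_switching G l1 l2 tangent_vertices \<tau>
proof -
  interpret pair_graph G by (rule pair_graph_NU)
  show "line_switching G l1 l2 tangent_vertices \<tau>"
  proof unfold_locales
    show "l1 \<noteq> {}" "l2 \<noteq> {}" by (auto simp: affine_line_def)
    show "l1 \<inter> l2 = {}" using lines_disjoint by (auto simp: affine_line_def)
    show "l1 \<subseteq> tangent_vertices" "l2 \<subseteq> tangent_vertices" using affine_line_subset u1 u2 by blast+
    show "tangent_vertices \<subseteq> pverts G" by (auto simp: tangent_vertices_def)
    show "common_nbrs G l1 \<subseteq> tangent_vertices" "common_nbrs G l2 \<subseteq> tangent_vertices" using affine_line_inner u1 u2 by blast+
    fix x y :: "('a ^ 'n) set"
    show "y \<in> nbrs G x" if "x \<in> l1" "y \<in> l1" "x \<noteq> y" using affine_line_clique[OF u1] that by blast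
    show "y \<in> nbrs G x" if "x \<in> l2" "y \<in> l2" "x \<noteq> y" using affine_line_clique[OF u2] that by blast
    show "x \<in> common_nbrs G l1" if "x \<in> tangent_vertices - l1" "y \<in> l1" "y \<in> nbrs G x"
      using affine_line_uniform[OF u1] that by blast
    show "x \<in> common_nbrs G l2" if "x \<in> tangent_vertices - l2" "y \<in> l2" "y \<in> nbrs G x"
      using affine_line_uniform[OF u2] that by blast
    show "\<tau> x \<in> l2" if "x \<in> l1" using that \<tau>_line by (auto simp: affine_line_def)
    show "\<tau> x \<in> l1" if "x \<in> l2" using that \<tau>_line by (auto simp: affine_line_def)
    show "\<tau> x = x" if "x \<notin> l1" "x \<notin> l2" using that \<tau>_line by blast
    show "\<tau> (\<tau> x) = x"
      by (cases "x \<in> l1"; cases "x \<in> l2") (use \<tau>_line in \<open>auto simp: affine_line_def\<close>)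
  qed
qed

lemma common_nbrs_outside: "T \<noteq> {} \<Longrightarrow> common_nbrs G T - tangent_vertices = outer_nbrs p T"
  using nbrs_subset by (fastforce simp: tangent_vertices_def outer_nbrs_def common_nbrs_def)

lemma pair_graph_switched: "pair_graph G'"
  using pair_graph_switched_graph[OF pair_graph_NU] lines by (meson order_trans)

lemma card_switched:
  assumes "T \<subseteq> tangent_vertices" "T \<noteq> {}"
  shows "card (common_nbrs G' T) + card (outer_nbrs p (\<tau> ` T)) =
    card (common_nbrs G (\<tau> ` T)) + card (outer_nbrs p T)"
  using card_common_nbrs_switched[OF assms] assms by (simp add: common_nbrs_outside)

text \<open>
  The configuration used for \<open>q > 2\<close> as well as for \<open>q = 2\<close>, on a further tangent line
  \<open>vec.span {u, r}\<close>. Replacing \<open>u\<close> by \<open>u'\<close>, which is the effect of \<open>\<tau>\<close>, makes the triple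
  independent modulo \<open>p\<close> and changes the number of outer common neighbours.
\<close>
lemma collinear_triple:
  assumes u: "h u u = 1" "h u p = 0" and u': "h u' u' = 1" "h u' p = 0" and uu: "{u, u'} = {u1, u2}"
    and r: "r \<in> isotropic_perp u" "h r p = 0" "r \<notin> vec.span {p, u1, u2}" and s: "s \<notin> fixed_field"
  defines "a \<equiv> pt (u + r)" and "b \<equiv> pt (u + s *s r)"
  shows "a \<in> tangent_vertices" "b \<in> tangent_vertices" "\<tau> a = a" "\<tau> b = b"
    and "a \<in> nbrs G (pt u)" "b \<in> nbrs G (pt u)" "b \<in> nbrs G a"
    and "card (outer_nbrs p {pt u, a, b}) = 2 * (q ^ 2 - 1) * q ^ 2 * E"
    and "card (outer_nbrs p {pt u', a, b}) = (q ^ 2 - 1) * (q + 1) ^ 2 * E"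
proof -
  have s01: "s \<noteq> 0" "s \<noteq> 1" using s by auto
  have r0: "r \<noteq> 0" using r(3) vec.span_zero by auto
  have sr: "s *s r \<in> isotropic_perp u" "s *s r \<noteq> 0" using r(1) r0 s01 by (simp_all add: isotropic_perp_def h_simps)
  have "r \<noteq> s *s r"
  proof
    assume "r = s *s r"
    have "(1 - s) *s r = r - s *s r" by (simp add: vec.scale_left_diff_distrib)
    also have "\<dots> = 0" using \<open>r = s *s r\<close> by (metis diff_self)
    finally have "1 - s = 0 \<or> r = 0" by (simp only: vec.scale_eq_0_iff)
    then show False using s01 r0 by simp
  qed
  have ab: "a \<notin> l1" "a \<notin> l2" "b \<notin> l1" "b \<notin> l2"
    using outside_lines[OF r(3), of 1 u] outside_lines[OF r(3) s01(1), of u] uu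
    by (auto simp: a_def b_def doubleton_eq_iff)
  then show "\<tau> a = a" "\<tau> b = b" by (simp_all add: \<tau>_line(3))
  have units: "h (u + r) (u + r) = 1" "h (u + s *s r) (u + s *s r) = 1"
    using unit_add_isotropic_perp[OF u(1)] r(1) sr(1) by simp_all
  have perps: "h (u + r) p = 0" "h (u + s *s r) p = 0" using u r by (simp_all add: h_simps)
  show "a \<in> tangent_vertices" "b \<in> tangent_vertices"
    using units perps by (simp_all add: tangent_vertices_def a_def b_def pt_perp_iff pt_vertex_iff)
  show "a \<in> nbrs G (pt u)" "b \<in> nbrs G (pt u)"
    using nbrs_unit[OF u(1)] r(1) r0 sr by (auto simp: a_def b_def)
  have "h r (s *s r) = 0" "h (s *s r) r = 0" using r(1) by (simp_all add: isotropic_perp_def h_simps)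
  then show "b \<in> nbrs G a"
    using local_adjacent_iff[OF u(1) sr(1) r(1)] \<open>r \<noteq> s *s r\<close> by (auto simp: a_def b_def)
  have "vec.span {p} \<subseteq> vec.span {p, u1, u2}" by (rule vec.span_mono) auto
  then have "r \<notin> vec.span {p}" using r(3) by blast
  then have "lin_indep [r, p]" using p_nonzero by (simp add: lin_indep_Cons)
  then have "lin_indep [p, r]" by (auto simp: lin_indep_def insert_commute)
  then show "card (outer_nbrs p {pt u, a, b}) = 2 * (q ^ 2 - 1) * q ^ 2 * E"
    unfolding a_def b_def by (intro card_outer_collinear p p_nonzero u r s)
  have ind4: "lin_indep [r, p, u1, u2]" using ind r(3) by (simp add: lin_indep_Cons)
  have "set [r, p, u1, u2] \<subseteq> vec.span (set [p, u', u + r, u + s *s r])"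
  proof -
    let ?V = "vec.span {p, u', u + r, u + s *s r}"
    have V: "p \<in> ?V" "u' \<in> ?V" "u + r \<in> ?V" "u + s *s r \<in> ?V" by (auto intro: vec.span_base)
    have "(u + r) - (u + s *s r) = (1 - s) *s r" by (simp add: vec.scale_left_diff_distrib)
    then have "(1 - s) *s r \<in> ?V" using vec.span_diff[OF V(3,4)] by simp
    then have rV: "r \<in> ?V" using notin_span_scale[of r _ "1 - s"] s01 by auto
    have "u \<in> ?V" using vec.span_diff[OF V(3) rV] by simp
    then have "u1 \<in> ?V" "u2 \<in> ?V" using V(2) uu by (auto simp: doubleton_eq_iff)
    then show ?thesis using V rV by simp
  qed
  then have "lin_indep [p, u', u + r, u + s *s r]"
    by (intro lin_indep_exchange[OF ind4]) simp_all
  then show "card (outer_nbrs p {pt u', a, b}) = (q ^ 2 - 1) * (q + 1) ^ 2 * E"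
    unfolding a_def b_def by (intro card_outer_independent p u' units perps)
qed

section \<open>Non-isomorphism\<close>

text \<open>
  The switched graph has the triangle \<open>{pt u1, a, b}\<close>, which \<open>\<tau>\<close> maps to the collinear
  triangle \<open>{pt u2, a, b}\<close>. Its codegree is that of the latter, corrected by the two outer
  counts, and no triangle of \<open>G\<close> has this codegree.
\<close>
lemma not_isomorphic_large:
  assumes q: "q > 2"
  shows "\<not> graph_isomorphic G G'"
proof
  assume iso: "graph_isomorphic G G'"
  \<comment> \<open>The component of \<open>u1\<close> orthogonal to \<open>u2\<close>.\<close>
  define z where "z = u1 - h u1 u2 *s u2"
  have hz: "h z p = 0" "h z u2 = 0" using u1 u2 by (simp_all add: z_def h_simps)
  have "set [p, u1, u2] \<subseteq> vec.span (set [p, u2, z])"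
  proof -
    have V: "p \<in> vec.span {p, u2, z}" "u2 \<in> vec.span {p, u2, z}" "z \<in> vec.span {p, u2, z}"
      by (auto intro: vec.span_base)
    have "u1 = z + h u1 u2 *s u2" by (simp add: z_def)
    then have "u1 \<in> vec.span {p, u2, z}" using vec.span_add[OF V(3) vec.span_scale[OF V(2), of "h u1 u2"]] by simp
    then show ?thesis using V by simp
  qed
  note sub = this
  have "lin_indep [p, u2, z]" by (rule lin_indep_exchange[OF ind _ sub]) simp
  from isotropic_outside(2)[OF p u2 hz this]
  obtain r where r: "r \<in> isotropic_perp u2" "h r p = 0" "r \<notin> vec.span {p, u2, z}" by blast
  have "vec.span {p, u1, u2} \<subseteq> vec.span {p, u2, z}"
    using sub by (intro vec.span_minimal) simp_all
  then have r': "r \<notin> vec.span {p, u1, u2}" using r(3) by blast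
  have r0: "r \<noteq> 0" using r' vec.span_zero by auto
  obtain s where s: "s \<notin> fixed_field" by (rule nonfixed_exists)
  define a where "a = pt (u2 + r)"
  define b where "b = pt (u2 + s *s r)"
  note triple = collinear_triple[OF u2 u1 insert_commute r(1,2) r' s, folded a_def b_def]
  have uS: "pt u1 \<in> tangent_vertices" "pt u2 \<in> tangent_vertices" using u1 u2 by (simp_all add: tangent_vertices_def pt_perp_iff pt_vertex_iff)
  define T where "T = {pt u1, a, b}"
  have T: "T \<subseteq> tangent_vertices" "T \<noteq> {}" using uS triple by (auto simp: T_def)
  have \<tau>T: "\<tau> ` T = {pt u2, a, b}" using triple by (simp add: T_def \<tau>_u)
  define d where "d = q ^ 2 - 1"
  have d: "int d = int q ^ 2 - 1" using q_ge_2 by (simp add: d_def of_nat_diff)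
  have "card (common_nbrs G' T) + 2 * d * q ^ 2 * E = card (common_nbrs G {pt u2, a, b}) + d * (q + 1) ^ 2 * E"
    using card_switched[OF T] triple(8,9) unfolding \<tau>T d_def by (simp add: T_def)
  from arg_cong[OF this, of int]
  have m': "int (card (common_nbrs G' T)) + 3 = int (card (common_nbrs G {pt u2, a, b})) + 3
      - 2 * (int q ^ 2 - 1) * int q ^ 2 * int E + (int q ^ 2 - 1) * (int q + 1) ^ 2 * int E"
    unfolding d[symmetric] by (simp only: of_nat_add of_nat_mult of_nat_power of_nat_numeral of_nat_1)
  have m: "int (card (common_nbrs G {pt u2, a, b})) + 3 + (int q ^ 2 - 1) * (int q ^ 4 * int E) =
      int (card (isotropic_perp u2)) + int q ^ 4 * int E"
    unfolding a_def b_def by (rule collinear_codegree[OF u2(1) r(1) r0 s u2(1)])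
  have TV: "T \<subseteq> pverts G'" using T lines by (simp add: switched_graph_def)
  obtain f where f: "\<And>x y. x \<in> T \<Longrightarrow> y \<in> T \<Longrightarrow> f y \<in> nbrs G (f x) \<longleftrightarrow> y \<in> nbrs G' x"
    "card (common_nbrs G (f ` T)) = card (common_nbrs G' T)"
    using graph_isomorphic_codegree[OF pair_graph_NU pair_graph_switched iso TV T(2)] by metis
  have adj: "y \<in> nbrs G' x \<longleftrightarrow> \<tau> y \<in> nbrs G (\<tau> x)" if "x \<in> T" "y \<in> T" for x y
    using switched_inside T that by blast
  have "f a \<in> nbrs G (f (pt u1))" "f b \<in> nbrs G (f (pt u1))" "f b \<in> nbrs G (f a)"
    using triple by (simp_all add: f adj \<tau>_u T_def)
  note cases = triangle_codegrees[OF this u2(1)]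
  have fT: "f ` T = {f (pt u1), f a, f b}" by (simp add: T_def)
  have e: "int E = int q ^ (2 * CARD('n) - 9)" by (simp add: E_def)
  have Q: "int q \<ge> 3" using q by simp
  show False
    using cases switched_codegree_differs[OF Q e m m'] unfolding fT[symmetric] f(2) by blast
qed

text \<open>
  Now \<open>\<tau>\<close> maps a collinear triple through \<open>pt u1\<close> to a path with ends \<open>pt u2\<close> and \<open>b\<close>. In
  the switched graph the triple is itself such a path, and its codegree differs from the
  common value in \<open>G\<close> because the outer counts are \<open>24 * E\<close> and \<open>27 * E\<close>.
\<close>
lemma not_isomorphic_two:
  assumes q: "q = 2" and u12: "h u1 u2 \<noteq> 0"
  shows "\<not> graph_isomorphic G G'"
proof
  assume iso: "graph_isomorphic G G'"
  \<comment> \<open>For \<open>q = 2\<close>, two distinct vertices are adjacent iff they are not orthogonal.\<close>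
  have Nm2: "Nm x = 1" if "x \<noteq> 0" for x
  proof -
    have "card {0, 1::'a} = card fixed_field" using q card_fixed_field by simp
    then have "fixed_field = {0, 1}" by (metis card_subset_eq empty_subsetI finite insert_subset one_in_fixed_field zero_in_fixed_field)
    then show ?thesis using Nm_in_fixed_field[of x] that by simp
  qed
  have u21: "h u2 u1 \<noteq> 0" using u12 h_eq_0_commute by blast
  \<comment> \<open>The component of \<open>u2\<close> orthogonal to \<open>u1\<close>. It is isotropic, since \<open>u1\<close> and \<open>u2\<close> are adjacent.\<close>
  define z where "z = u2 - h u2 u1 *s u1"
  have hz: "h z p = 0" "h z u1 = 0" using u1 u2 by (simp_all add: z_def h_simps)
  have "u2 = z + h u2 u1 *s u1" by (simp add: z_def)
  then have "h u2 u2 = h (z + h u2 u1 *s u1) (z + h u2 u1 *s u1)" by simp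
  also have "\<dots> = h z z + 1" by (simp add: h_self_add_scale hz u1 Nm2[OF u21])
  finally have zz: "h z z = 0" using u2 by simp
  have "set [p, u1, u2] \<subseteq> vec.span (set [p, u1, z])"
  proof -
    have V: "p \<in> vec.span {p, u1, z}" "u1 \<in> vec.span {p, u1, z}" "z \<in> vec.span {p, u1, z}"
      by (auto intro: vec.span_base)
    have "u2 \<in> vec.span {p, u1, z}"
      using vec.span_add[OF V(3) vec.span_scale[OF V(2), of "h u2 u1"]] by (simp add: z_def)
    then show ?thesis using V by simp
  qed
  then have "lin_indep [p, u1, z]" by (rule lin_indep_exchange[OF ind, rotated]) simp
  from isotropic_outside(1)[OF p u1 hz this zz]
  obtain r0 where r0: "r0 \<in> isotropic_perp u1" "h r0 p = 0" "h r0 z = 1" by blast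
  have r0u2: "h r0 u2 = 1"
  proof -
    have "h r0 z = h r0 u2 - cj (h u2 u1) * h r0 u1" by (simp add: z_def h_simps)
    then show ?thesis using r0 by (simp add: isotropic_perp_def)
  qed
  have "h p z = 0" "h u1 z = 0" using hz h_eq_0_commute by blast+
  then have "h u2 z = 0" using zz by (simp add: h_diff_left h_scale_left z_def)
  then have r0_out: "r0 \<notin> vec.span {p, u1, u2}"
    by (intro not_in_span[where w = z]) (use \<open>h p z = 0\<close> \<open>h u1 z = 0\<close> r0 in auto)
  obtain s where s: "s \<notin> fixed_field" by (rule nonfixed_exists)
  then have s0: "s \<noteq> 0" by auto
  \<comment> \<open>The scaling of \<open>r0\<close> for which \<open>u2\<close> is orthogonal to \<open>u1 + s *s r\<close> but not to \<open>u1 + r\<close>.\<close>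
  define c where "c = - h u1 u2 / s"
  have c0: "c \<noteq> 0" using s0 u12 by (simp add: c_def)
  define r where "r = c *s r0"
  have r: "r \<in> isotropic_perp u1" "h r p = 0" using r0 by (simp_all add: r_def isotropic_perp_def h_simps)
  have r_out: "r \<notin> vec.span {p, u1, u2}" unfolding r_def by (rule notin_span_scale[OF r0_out c0])
  have ru2: "h r u2 = c" using r0u2 by (simp add: r_def h_simps)
  define a where "a = pt (u1 + r)"
  define b where "b = pt (u1 + s *s r)"
  note triple = collinear_triple[OF u1 u2 refl r r_out s, folded a_def b_def]
  have bu2: "h (u1 + s *s r) u2 = 0" using s0 by (simp add: h_simps ru2 c_def)
  have au2: "h (u1 + r) u2 \<noteq> 0"
  proof
    assume "h (u1 + r) u2 = 0"
    then have "h u1 u2 * (s - 1) = 0" using s0 by (simp add: h_simps ru2 c_def field_simps)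
    then show False using u12 s by auto
  qed
  have units: "h (u1 + r) (u1 + r) = 1" "h (u1 + s *s r) (u1 + s *s r) = 1"
    by (rule unit_add_isotropic_perp[OF u1(1)], use r(1) in \<open>simp add: isotropic_perp_def h_simps\<close>)+
  have a_u2: "pt u2 \<in> nbrs G a"
  proof -
    have "pt u2 \<in> l2" using rangeI[of "\<lambda>t. pt (u2 + t *s p)" 0] by (simp add: affine_line_def)
    moreover have "a \<notin> l2"
      using outside_lines(2)[OF r_out, of 1 u1] by (simp add: a_def)
    ultimately have "a \<noteq> pt u2" by blast
    then show ?thesis unfolding a_def adjacent_unit_iff[OF units(1) u2(1)] using Nm2[OF au2] by simp
  qed
  have b_u2: "b \<notin> nbrs G (pt u2)"
    using adjacent_unit_iff[OF u2(1) units(2)] bu2 h_eq_0_commute[of "u1 + s *s r" u2] by (simp add: b_def)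
  have uS: "pt u1 \<in> tangent_vertices" "pt u2 \<in> tangent_vertices" using u1 u2 by (simp_all add: tangent_vertices_def pt_perp_iff pt_vertex_iff)
  define T where "T = {a, pt u1, b}"
  have T: "T \<subseteq> tangent_vertices" "T \<noteq> {}" using uS triple by (auto simp: T_def)
  have \<tau>T: "\<tau> ` T = {a, pt u2, b}" using triple by (simp add: T_def \<tau>_u)
  have "card (common_nbrs G' T) + (q ^ 2 - 1) * (q + 1) ^ 2 * E =
      card (common_nbrs G (\<tau> ` T)) + 2 * (q ^ 2 - 1) * q ^ 2 * E"
    using card_switched[OF T] triple(8,9) unfolding \<tau>T by (simp add: T_def insert_commute)
  then have ne: "card (common_nbrs G' T) \<noteq> card (common_nbrs G {a, pt u2, b})"
    using q E_pos unfolding \<tau>T by simp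
  have TV: "T \<subseteq> pverts G'" using T lines by (simp add: switched_graph_def)
  obtain f where f: "inj_on f T" "f ` T \<subseteq> pverts G"
    "\<And>x y. x \<in> T \<Longrightarrow> y \<in> T \<Longrightarrow> f y \<in> nbrs G (f x) \<longleftrightarrow> y \<in> nbrs G' x"
    "card (common_nbrs G (f ` T)) = card (common_nbrs G' T)"
    using graph_isomorphic_codegree[OF pair_graph_NU pair_graph_switched iso TV T(2)] by metis
  have adj: "y \<in> nbrs G' x \<longleftrightarrow> \<tau> y \<in> nbrs G (\<tau> x)" if "x \<in> T" "y \<in> T" for x y
    using switched_inside T that by blast
  have fadj: "f (pt u1) \<in> nbrs G (f a)" "f b \<in> nbrs G (f a)" "f b \<notin> nbrs G (f (pt u1))"
    using triple a_u2 b_u2 by (simp_all add: f adj \<tau>_u T_def)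
  obtain x y where x: "h x x = 1" "f (pt u1) = pt x" and y: "h y y = 1" "f b = pt y"
    using f(2) vertex_iff by (auto simp: T_def)
  have "b \<noteq> pt u1" using triple not_self_nbr by metis
  then have "pt x \<noteq> pt y" using f(1) x y by (auto simp: T_def inj_on_def)
  then have xy: "h x y = 0"
    using fadj(3) adjacent_unit_iff[OF x(1) y(1)] Nm2 x y by metis
  obtain z0 z1 where z: "z0 + (int q - 1) * z1 = int q ^ 3 * int E"
    "int (card (isotropic_perp u2)) = int q ^ 2 * z0 + int q * (int q ^ 2 - 1) * (int q ^ 3 * int E)"
    "int (card (common_nbrs G {f a, f (pt u1), f b})) + 1 =
      path_zeros * z0 + ((int q + 1) ^ 2 - path_zeros) * z1"
    using path_codegree[OF fadj(1,2) x(2) y(2) xy u2(1)] by metis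
  obtain w0 w1 where w: "w0 + (int q - 1) * w1 = int q ^ 3 * int E"
    "int (card (isotropic_perp u2)) = int q ^ 2 * w0 + int q * (int q ^ 2 - 1) * (int q ^ 3 * int E)"
    "int (card (common_nbrs G {a, pt u2, b})) + 1 =
      path_zeros * w0 + ((int q + 1) ^ 2 - path_zeros) * w1"
    using path_codegree[OF a_u2 triple(7) refl b_def _ u2(1)] bu2 h_eq_0_commute[of "u1 + s *s r" u2] by metis
  have "z0 = w0" using z(2) w(2) q by simp
  moreover have "z1 = w1" using z(1) w(1) \<open>z0 = w0\<close> q by simp
  ultimately have "card (common_nbrs G {f a, f (pt u1), f b}) = card (common_nbrs G {a, pt u2, b})"
    using z(3) w(3) by simp
  moreover have "f ` T = {f a, f (pt u1), f b}" by (simp add: T_def)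
  ultimately show False using ne f(4) by simp
qed

text \<open>
  If \<open>u1\<close> and \<open>u2\<close> were orthogonal, every \<open>u1 + c *s u2\<close> with \<open>Nm c = - 1\<close> would be
  isotropic. Two of these vectors together with \<open>p\<close> are independent, so the isotropic points
  of the plane could not form a line.
\<close>
lemma line_section_not_orthogonal:
  assumes m: "is_line m"
    "points_of (join (vec.span {p, u1}) (vec.span {p, u2})) \<inter> isotropic_points = points_of m"
  shows "h u1 u2 \<noteq> 0"
proof
  assume orth: "h u1 u2 = 0"
  then have orth': "h u2 u1 = 0" using h_eq_0_commute by blast
  let ?J = "join (vec.span {p, u1}) (vec.span {p, u2})"
  have V: "p \<in> ?J" "u1 \<in> ?J" "u2 \<in> ?J" unfolding join_def by (auto intro!: vec.span_base)
  have J: "vec.subspace ?J" by (simp add: join_def)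
  have in_m: "y \<in> m" if "y \<in> ?J" "y \<noteq> 0" "h y y = 0" for y
  proof -
    have "pt y \<subseteq> ?J" using that J by (intro vec.span_minimal) auto
    then have "pt y \<in> points_of ?J \<inter> isotropic_points" using that by (auto simp: points_of_def is_point_iff isotropic_points_def)
    then have "pt y \<subseteq> m" using m(2) by (auto simp: points_of_def)
    then show ?thesis using vec.span_base[of y "{y}"] by auto
  qed
  have "card {c. Nm c = - 1} = q + 1" by (rule card_Nm_eq) (auto simp: fixed_field_iff cj_simps)
  then have "card {c. Nm c = - 1} \<ge> 2" using q_ge_2 by simp
  then obtain c d where cd: "Nm c = - 1" "Nm d = - 1" "c \<noteq> d"
    using card_le_Suc0_iff_eq[of "{c. Nm c = - 1}"] by auto
  have iso: "u1 + c *s u2 \<in> m" if "Nm c = - 1" for c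
  proof (rule in_m)
    show "u1 + c *s u2 \<in> ?J" using V J by (intro vec.subspace_add vec.subspace_scale)
    show "h (u1 + c *s u2) (u1 + c *s u2) = 0" by (simp add: h_self_add_scale u1 u2 orth that)
    have "h (u1 + c *s u2) u1 = 1" by (simp add: h_simps u1 orth')
    then show "u1 + c *s u2 \<noteq> 0" by auto
  qed
  have "set [p, u1, u2] \<subseteq> vec.span (set [p, u1 + c *s u2, u1 + d *s u2])"
  proof -
    let ?V = "vec.span {p, u1 + c *s u2, u1 + d *s u2}"
    have W: "p \<in> ?V" "u1 + c *s u2 \<in> ?V" "u1 + d *s u2 \<in> ?V" by (auto intro: vec.span_base)
    have "(u1 + c *s u2) - (u1 + d *s u2) = (c - d) *s u2" by (simp add: vec.scale_left_diff_distrib)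
    then have "(c - d) *s u2 \<in> ?V" using vec.span_diff[OF W(2,3)] by simp
    then have "u2 \<in> ?V" using notin_span_scale[of u2 _ "c - d"] cd(3) by auto
    moreover from this have "u1 \<in> ?V" using vec.span_diff[OF W(2) vec.span_scale[of u2 _ c]] by simp
    ultimately show ?thesis using W by simp
  qed
  then have "lin_indep [p, u1 + c *s u2, u1 + d *s u2]"
    by (rule lin_indep_exchange[OF ind, rotated]) simp
  then have "card {p, u1 + c *s u2, u1 + d *s u2} = 3" "vec.independent {p, u1 + c *s u2, u1 + d *s u2}"
    using distinct_card[of "[p, u1 + c *s u2, u1 + d *s u2]"] by (simp_all add: lin_indep_def)
  moreover have "{p, u1 + c *s u2, u1 + d *s u2} \<subseteq> m"
    using in_m[OF V(1) p_nonzero p] iso cd by simp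
  ultimately have "3 \<le> vec.dim m" using vec.independent_card_le_dim by metis
  then show False using m(1) by (simp add: is_line_def)
qed

end

theorem theorem4p9:
  fixes q n :: nat
    and H :: "('a::{field,finite} ^ 'n) set set"
    and P L1 L2 :: "('a ^ 'n) set"
  assumes "primepow q" and "CARD('a) = q\<^sup>2"
    and "n \<ge> 4" and "CARD('n) = n + 1"
    and "hermitian_variety q H"
    and "P \<in> H"
    and "is_line L1" and "is_line L2" and "L1 \<noteq> L2"
    and "points_of L1 \<inter> H = {P}" and "points_of L2 \<inter> H = {P}"
  shows "(q > 2 \<and> hermitian_pencil q (points_of (join L1 L2) \<inter> H) \<longrightarrow>
            \<not> graph_isomorphic (NU H)
                (switched_graph (NU H) (points_of L1 - {P}) (points_of L2 - {P}))) \<and>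
         ((\<exists>m. is_line m \<and> points_of (join L1 L2) \<inter> H = points_of m) \<longrightarrow>
            \<not> graph_isomorphic (NU H)
                (switched_graph (NU H) (points_of L1 - {P}) (points_of L2 - {P})))"
proof -
  obtain \<rho> h where h: "hermitian_form q h" "nondegenerate_form h"
    and \<rho>: "\<And>U. vec.subspace U \<Longrightarrow> \<rho> U = {x. \<forall>u\<in>U. h x u = 0}" and H\<rho>: "H = absolute_points \<rho>"
    using assms(5) unfolding hermitian_variety_def unitary_polarity_def by blast
  interpret unitary_space_dim5 q h
    by unfold_locales (use assms h in auto)
  have HH: "H = unitary_space.isotropic_points h" unfolding H\<rho> by (rule absolute_points_eq[OF \<rho>])
  obtain p where p: "p \<noteq> 0" "h p p = 0" "P = pt p" using assms(6) unfolding HH isotropic_points_def by blast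
  obtain u1 where u1: "h u1 u1 = 1" "h u1 p = 0" "L1 = vec.span {p, u1}" "points_of L1 - {pt p} = affine_line p u1"
    using tangent_lineE[OF p(1,2) assms(7)] assms(10) unfolding HH p(3) by blast
  obtain u2 where u2: "h u2 u2 = 1" "h u2 p = 0" "L2 = vec.span {p, u2}" "points_of L2 - {pt p} = affine_line p u2"
    using tangent_lineE[OF p(1,2) assms(8)] assms(11) unfolding HH p(3) by blast
  have "u2 \<notin> vec.span {p, u1}"
  proof
    assume "u2 \<in> vec.span {p, u1}"
    then have "L2 \<subseteq> L1" unfolding u1(3) u2(3) by (intro vec.span_minimal) (auto intro: vec.span_base)
    then have "L2 = L1"
      using assms(7,8) by (intro vec.subspace_dim_equal) (simp_all add: is_line_def)
    then show False using assms(9) by simp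
  qed
  moreover have "u1 \<notin> vec.span {p}"
    by (rule not_in_span[where w = u1]) (use u1 h_eq_0_commute[of p u1] in auto)
  then have "lin_indep [u1, p]" using p(1) by (simp add: lin_indep_Cons)
  then have "lin_indep [p, u1]" by (auto simp: lin_indep_def insert_commute)
  ultimately have "lin_indep [u2, p, u1]" by (simp add: lin_indep_Cons)
  then have "lin_indep [p, u1, u2]" by (auto simp: lin_indep_def insert_commute)
  then interpret T: two_tangent_lines q h p u1 u2
    by unfold_locales (use p u1 u2 in auto)
  have lines: "points_of L1 - {P} = affine_line p u1" "points_of L2 - {P} = affine_line p u2"
    using u1(4) u2(4) p(3) by simp_all
  have large: "\<not> graph_isomorphic (NU H) (switched_graph (NU H) (points_of L1 - {P}) (points_of L2 - {P}))"
    if "q > 2" using T.not_isomorphic_large[OF that] unfolding lines HH .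
  have "\<not> graph_isomorphic (NU H) (switched_graph (NU H) (points_of L1 - {P}) (points_of L2 - {P}))"
    if "is_line m" "points_of (join L1 L2) \<inter> H = points_of m" for m
  proof (cases "q > 2")
    case False
    then have q: "q = 2" using q_ge_2 by simp
    have "h u1 u2 \<noteq> 0"
      using T.line_section_not_orthogonal that unfolding u1(3) u2(3) HH by blast
    then show ?thesis using T.not_isomorphic_two[OF q] unfolding lines HH by blast
  qed (rule large)
  then show ?thesis using large by blast
qed

end
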